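(* Let $\mu,\nu$ be two non-zero, finite, compactly supported Borel measures on $\mathbb{R}^d$. Let $p\ge1$, $q\ge2p'$, and $p_0:=\frac{q(p-1)}{q(p-1)-p}$. If $$d-D_{p_0}(\mu)<\dim_{\mathrm F}\nu,$$ then $$\big\|\widehat{f\,d\mu}\,\widehat{g\,d\nu}\big\|_{L^q(\mathbb{R}^d)}\lesssim\|f\|_{L^p(d\mu)}\|g\|_{L^p(d\nu)}$$ holds for all $f\in L^p(d\mu)$, $g\in L^p(d\nu)$.
   Context: For a finite Borel measure $\mu$ on $\mathbb{R}^d$ and $f\in L^1(\mu)$, $\widehat{f\,d\mu}(\xi)=\int f(x)e^{-2\pi i x\cdot\xi}\,d\mu(x)$, and $\widehat{d\mu}$ is the case $f\equiv1$. $p'$ is the Hölder conjugate of $p$. $A\lesssim B$ means $A\le CB$ for a constant $0<C<\infty$, here independent of $f,g$. When $q=\infty$ (in particular when $p=1$, where $p'=\infty$ forces $q=\infty$), $p_0$ is read as $1$. $L^s$-dimension: for $s>1$, $$D_s(\mu)=\sup\Big\{t\in[0,d]:\int\Big(\int\frac{d\mu(y)}{|x-y|^t}\Big)^{s-1}d\mu(x)<\infty\Big\};$$ equivalently, for $s\ge0$, $s\ne1$, $D_s(\mu)=\liminf_{r\to0}\frac{\log\int\mu(B(x,r))^{s-1}d\mu(x)}{(s-1)\log r}$; and $D_1(\mu)=\liminf_{r\to0}\frac{\int\log\mu(B(x,r))\,d\mu(x)}{\log r}$. Fourier dimension of a measure: $\dim_{\mathrm F}\nu=\sup\{s\in[0,d]:\sup_{\xi\in\mathbb{R}^d}|\widehat{d\nu}(\xi)|^2|\xi|^s<\infty\}$.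 *)

theory Defs
  imports "HOL-Probability.Probability"
begin

(* Power a^r with extended nonnegative base and real exponent r \<ge> 0. In contrast to powr,
   a^0 = 1 also for a = 0. *)
definition epow :: "ennreal \<Rightarrow> real \<Rightarrow> ennreal" where
  "epow a r = (if r = 0 then 1 else if a = \<infinity> then \<infinity> else ennreal (enn2real a powr r))"

definition Lp_norm :: "ennreal \<Rightarrow> 'a measure \<Rightarrow> ('a \<Rightarrow> complex) \<Rightarrow> ennreal" where
  "Lp_norm p M f =
     (if p = \<infinity> then esssup M (\<lambda>x. ennreal (norm (f x)))
      else epow (\<integral>\<^sup>+ x. ennreal (norm (f x) powr enn2real p) \<partial>M) (1 / enn2real p))"

definition Lp_space :: "ennreal \<Rightarrow> 'a measure \<Rightarrow> ('a \<Rightarrow> complex) set" where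
  "Lp_space p M = {f \<in> borel_measurable M. Lp_norm p M f < \<infinity>}"

definition measure_support :: "'a::metric_space measure \<Rightarrow> 'a set" where
  "measure_support M = {x. \<forall>r>0. emeasure M (ball x r) > 0}"

(* The Fourier transform of the complex measure f dM. *)
definition fourier :: "'a::euclidean_space measure \<Rightarrow> ('a \<Rightarrow> complex) \<Rightarrow> 'a \<Rightarrow> complex" where
  "fourier M f \<xi> = (\<integral>x. f x * exp (- 2 * pi * \<i> * of_real (x \<bullet> \<xi>)) \<partial>M)"

definition fourier_dim :: "'a::euclidean_space measure \<Rightarrow> ereal" where
  "fourier_dim M =
     (SUP s\<in>{s. 0 \<le> s \<and> s \<le> real DIM('a) \<and>
                bdd_above (range (\<lambda>\<xi>. (norm (fourier M (\<lambda>_. 1) \<xi>))\<^sup>2 * norm \<xi> powr s))}. ereal s)"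

(* The L^s-dimension for s \<ge> 1. The kernel |x - y|^(-t) is infinite on the diagonal if t > 0
   and identically 1 if t = 0. No normalisation of the total mass is built into the case s = 1. *)
definition Ls_dim :: "real \<Rightarrow> 'a::euclidean_space measure \<Rightarrow> ereal" where
  "Ls_dim s M =
     (if s = 1
      then Liminf (at_right 0) (\<lambda>r. ereal ((\<integral>x. ln (measure M (ball x r)) \<partial>M) / ln r))
      else (SUP t\<in>{t. 0 \<le> t \<and> t \<le> real DIM('a) \<and>
              (\<integral>\<^sup>+ x. epow (\<integral>\<^sup>+ y. 1 / epow (ennreal (norm (x - y))) t \<partial>M) (s - 1) \<partial>M) < \<infinity>}.
            ereal t))"

(* p0 = q(p - 1) / (q(p - 1) - p), read as 1 for q = \<infinity> and as its limit q / (q - 1)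
   for p = \<infinity> and finite q. *)
definition p0_exponent :: "ennreal \<Rightarrow> ennreal \<Rightarrow> real" where
  "p0_exponent p q =
     (if q = \<infinity> then 1
      else if p = \<infinity> then enn2real q / (enn2real q - 1)
      else enn2real q * (enn2real p - 1) / (enn2real q * (enn2real p - 1) - enn2real p))"

end

(* On the Fourier side the product is the transform of the convolution (f dmu) * (g dnu), so
   Hausdorff--Young reduces the estimate to an L^{q'} bound for that convolution. Hoelder's
   inequality splits off (|f|^p dmu) * (|g|^p dnu), which has finite mass, and leaves the
   L^{p0} norm of mu * nu, where 1 < p0 <= 2. To bound the latter one decomposes frequency space
   dyadically: convolution with the piece of nu at frequency 2^{j/2} is bounded on L^1, and has
   norm 2^{-j sigma/4} on L^2 by Fourier decay, hence norm 2^{-j sigma (p0-1)/(2 p0)} on L^{p0};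
   the mollification of mu at this scale has L^{p0} norm at most 2^{j (d-t)(p0-1)/(2 p0)} because
   its t-energy is finite. The dimension hypothesis sigma + t > d makes the pieces summable.
   Everything is done for Gaussian mollifications, with bounds uniform in the scale, so that
   neither densities nor Fourier inversion for general functions are required. *)

theory Submission
  imports Defs "HOL-Computational_Algebra.Polynomial"
begin

section \<open>The Gaussian and its Fourier transform\<close>

text \<open>For finite q the condition q \<ge> 2p' says that p0 \<le> 2, which places L^{p0} between
  L^1 and L^2; for q = \<infinity> both transforms are simply bounded by L^1 norms. The pieces of nu
  need L^1 bounds uniform in the scale, so the frequency cut-offs are polynomials in Gaussians:
  every monomial is again a Gaussian, and no kernel has to be estimated. A plain difference of
  consecutive Gaussians vanishes only to second order at frequency 0, which exploits Fourier decay
  only up to \<sigma> = 4; the powers (1 - P)^N remove this restriction in high dimensions. Each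
  cut-off must also leave a factor P over, since that factor mollifies mu and so brings in its
  energy. All exponents meet in the number (p0 - 1)(\<sigma> + t - d)/2, whose positivity is the
  dimension hypothesis. Hausdorff--Young is used only in the form that bounded inputs have bounded
  transforms; the estimate is proved on unit balls, and homogeneity is restored by scaling at the
  end.\<close>

definition gauss_kernel :: "real \<Rightarrow> 'a::euclidean_space \<Rightarrow> real" where
  "gauss_kernel a x = a powr (- (real DIM('a) / 2)) * exp (- (pi * (norm x)\<^sup>2 / a))"

text \<open>The parameter \<open>a\<close> is a squared length: the kernel has width of order sqrt a
  and its transform lives at frequencies of order 1 / sqrt a. With the factors \<pi> placed like
  this the kernel has mass 1, and multiplying multipliers adds their parameters.\<close>

definition gauss_mult :: "real \<Rightarrow> 'a::euclidean_space \<Rightarrow> real" where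
  "gauss_mult a \<xi> = exp (- (pi * a * (norm \<xi>)\<^sup>2))"

lemma gauss_kernel_measurable [measurable]: "gauss_kernel a \<in> borel_measurable borel"
  unfolding gauss_kernel_def[abs_def] by measurable

lemma gauss_mult_measurable [measurable]: "gauss_mult a \<in> borel_measurable borel"
  unfolding gauss_mult_def[abs_def] by measurable

text \<open>Both claims are rescalings of the standard normal distribution, whose characteristic
  function is known.\<close>

lemma gauss_fourier_real:
  fixes a t :: real
  assumes a: "0 < a"
  shows "integrable lborel (\<lambda>x. exp (- (pi * a * x\<^sup>2)))"
    and "(\<integral>x. of_real (exp (- (pi * a * x\<^sup>2))) * cis (2 * pi * (x * t)) \<partial>lborel)
          = complex_of_real (a powr (- (1/2)) * exp (- (pi * t\<^sup>2 / a)))"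
proof -
  define c where "c = sqrt (2 * pi * a)"
  have c: "c > 0" "c\<^sup>2 = 2 * pi * a" using a by (auto simp: c_def)
  have e: "std_normal_density (c * x) = exp (- (pi * a * x\<^sup>2)) / sqrt (2 * pi)" for x
    by (simp add: std_normal_density_def power_mult_distrib c(2))
  have e': "std_normal_density (x * c) = exp (- (pi * (a * x\<^sup>2))) / sqrt (pi * 2)" for x
    using e[of x] by (simp add: mult_ac)
  have "integrable lborel (\<lambda>x. std_normal_density (0 + c * x))"
    using c by (intro lborel_integrable_real_affine) auto
  then have "integrable lborel (\<lambda>x. sqrt (2 * pi) * std_normal_density (0 + c * x))"
    by (intro integrable_mult_right)
  then show "integrable lborel (\<lambda>x. exp (- (pi * a * x\<^sup>2)))" by (simp add: e)
  \<comment> \<open>The frequency at which the normal characteristic function must be read off: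
    after the substitution x -> c x, the phase s c x is 2 \<pi> t x.\<close>
  define s where "s = 2 * pi * t / c"
  have "complex_of_real (exp (- (s\<^sup>2 / 2))) = (CLINT x|std_normal_distribution. iexp (s * x))"
    using char_std_normal_distribution by (simp add: char_def fun_eq_iff)
  also have "\<dots> = (\<integral>x. std_normal_density x *\<^sub>R iexp (s * x) \<partial>lborel)"
    by (subst integral_density) auto
  also have "\<dots> = \<bar>c\<bar> *\<^sub>R (\<integral>x. std_normal_density (0 + c * x) *\<^sub>R iexp (s * (0 + c * x)) \<partial>lborel)"
    using c by (intro lborel_integral_real_affine) auto
  also have "(\<lambda>x. std_normal_density (0 + c * x) *\<^sub>R iexp (s * (0 + c * x)))
      = (\<lambda>x. of_real (1 / sqrt (2*pi)) * (of_real (exp (- (pi * a * x\<^sup>2))) * cis (2 * pi * (x * t))))"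
    using c(1) by (auto simp: e' scaleR_conv_of_real cis_conv_exp s_def mult_ac fun_eq_iff)
  finally have *: "complex_of_real (exp (- (s\<^sup>2 / 2))) = of_real (c / sqrt (2 * pi)) *
     (\<integral>x. of_real (exp (- (pi * a * x\<^sup>2))) * cis (2 * pi * (x * t)) \<partial>lborel)"
    using c by (simp add: scaleR_conv_of_real mult_ac)
  have cs: "c / sqrt (2*pi) = sqrt a" by (simp add: c_def real_sqrt_mult)
  have ss: "s\<^sup>2 / 2 = pi * t\<^sup>2 / a" using a by (simp add: s_def power_divide c(2) power_mult_distrib) (simp add: field_simps power2_eq_square)
  have ap: "a powr (- (1/2)) = 1 / sqrt a" using a by (simp add: powr_minus_divide powr_half_sqrt)
  show "(\<integral>x. of_real (exp (- (pi * a * x\<^sup>2))) * cis (2 * pi * (x * t)) \<partial>lborel)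
          = complex_of_real (a powr (- (1/2)) * exp (- (pi * t\<^sup>2 / a)))"
    using * a unfolding cs ss ap by (simp add: field_simps)
qed

lemma prod_cis: "(\<Prod>i\<in>I. cis (f i)) = cis (\<Sum>i\<in>I. f i)"
  by (induction I rule: infinite_finite_induct) (auto simp: cis_mult)

text \<open>Both the Gaussian and the character factor over the coordinates with respect to
  \<open>Basis\<close>, so the integral is a product of one-dimensional ones.\<close>

lemma gauss_fourier:
  fixes x :: "'a::euclidean_space"
  assumes a: "0 < a"
  shows integrable_gauss_mult: "integrable lborel (gauss_mult a :: 'a \<Rightarrow> real)"
    and "(\<integral>\<xi>. of_real (gauss_mult a \<xi>) * cis (2 * pi * (\<xi> \<bullet> x)) \<partial>lborel)
          = complex_of_real (gauss_kernel a x)"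
proof -
  interpret product_sigma_finite "\<lambda>_::'a. lborel :: real measure" ..
  let ?P = "\<Pi>\<^sub>M b\<in>(Basis::'a set). (lborel::real measure)"
  let ?E = "\<lambda>f::'a\<Rightarrow>real. \<Sum>b\<in>Basis. f b *\<^sub>R b"
  have nrm: "(norm (?E f))\<^sup>2 = (\<Sum>b\<in>Basis. (f b)\<^sup>2)" for f
    by (subst power2_norm_eq_inner, subst euclidean_inner) (simp add: power2_eq_square)
  have gm: "gauss_mult a (?E f) = (\<Prod>b\<in>Basis. exp (- (pi * a * (f b)\<^sup>2)))" for f
    by (simp add: gauss_mult_def nrm sum_distrib_left exp_sum flip: sum_negf)
  have "integrable ?P (\<lambda>f. \<Prod>b\<in>Basis. exp (- (pi * a * (f b)\<^sup>2)))"
    by (intro product_integrable_prod gauss_fourier_real a) auto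
  then show "integrable lborel (gauss_mult a :: 'a \<Rightarrow> real)"
    by (subst lborel_eq, subst integrable_distr_eq) (simp_all add: gm)
  have i1: "integrable lborel (\<lambda>y. of_real (exp (- (pi * a * y\<^sup>2))) * cis (2 * pi * (y * s)))" for s
    by (rule Bochner_Integration.integrable_bound[OF gauss_fourier_real(1)[OF a]])
       (auto simp: norm_mult cis_conv_exp)
  have "(\<integral>\<xi>. of_real (gauss_mult a \<xi>) * cis (2 * pi * (\<xi> \<bullet> x)) \<partial>lborel)
     = (\<integral>f. of_real (gauss_mult a (?E f)) * cis (2 * pi * (?E f \<bullet> x)) \<partial>?P)"
    by (subst lborel_eq, subst integral_distr) (simp_all add: cis_conv_exp)
  also have "\<dots> = (\<integral>f. (\<Prod>b\<in>Basis. of_real (exp (- (pi * a * (f b)\<^sup>2))) * cis (2 * pi * (f b * (b \<bullet> x)))) \<partial>?P)"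
    by (simp add: gm prod.distrib prod_cis inner_sum_left sum_distrib_left)
  also have "\<dots> = (\<Prod>b\<in>Basis. \<integral>y. of_real (exp (- (pi * a * y\<^sup>2))) * cis (2 * pi * (y * (b \<bullet> x))) \<partial>lborel)"
    by (intro product_integral_prod i1) auto
  also have "\<dots> = (\<Prod>b\<in>Basis. complex_of_real (a powr (- (1/2)) * exp (- (pi * (b \<bullet> x)\<^sup>2 / a))))"
    by (simp only: gauss_fourier_real(2)[OF a])
  also have "\<dots> = of_real (\<Prod>b\<in>(Basis::'a set). a powr (- (1/2)) * exp (- (pi * (b \<bullet> x)\<^sup>2 / a)))"
    by simp
  also have "(\<Prod>b\<in>(Basis::'a set). a powr (- (1/2)) * exp (- (pi * (b \<bullet> x)\<^sup>2 / a))) = gauss_kernel a x"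
  proof -
    have "(norm x)\<^sup>2 = (\<Sum>b\<in>Basis. (b \<bullet> x)\<^sup>2)"
      by (subst euclidean_inner[of x x, folded power2_norm_eq_inner]) (simp add: power2_eq_square inner_commute)
    then show ?thesis
      using a by (simp add: gauss_kernel_def prod.distrib powr_power sum_distrib_left sum_divide_distrib sum_negf
          exp_sum[symmetric] mult_ac)
  qed
  finally show "(\<integral>\<xi>. of_real (gauss_mult a \<xi>) * cis (2 * pi * (\<xi> \<bullet> x)) \<partial>lborel)
          = complex_of_real (gauss_kernel a x)" .
qed

section \<open>Gaussian mollification of measures\<close>

lemma gauss_kernel_pos: "0 < a \<Longrightarrow> 0 < gauss_kernel a x"
  by (simp add: gauss_kernel_def)

lemma gauss_mult_pos: "0 < gauss_mult a x"
  by (simp add: gauss_mult_def)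

lemma gauss_mult_le_1: "0 \<le> a \<Longrightarrow> gauss_mult a x \<le> 1"
  by (simp add: gauss_mult_def)

lemma gauss_mult_add: "gauss_mult (a + b) x = gauss_mult a x * gauss_mult b x"
  by (simp add: gauss_mult_def exp_add[symmetric] ring_distribs)

lemma gauss_mult_power: "gauss_mult a x ^ k = gauss_mult (real k * a) x"
  by (simp add: gauss_mult_def exp_of_nat_mult[symmetric] mult_ac)

lemma gauss_kernel_commute: "gauss_kernel a (x - y) = gauss_kernel a (y - x)"
  by (simp add: gauss_kernel_def norm_minus_commute)

lemma gauss_kernel_le:
  fixes x :: "'a::euclidean_space"
  shows "0 < a \<Longrightarrow> gauss_kernel a x \<le> a powr (- (real DIM('a) / 2))"
  by (simp add: gauss_kernel_def mult_left_le)

lemma gauss_kernel_eq_mult: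
  fixes x :: "'a::euclidean_space"
  shows "gauss_kernel a x = a powr (- (real DIM('a) / 2)) * gauss_mult (1 / a) x"
  by (simp add: gauss_kernel_def gauss_mult_def)

lemma integrable_gauss_kernel: "0 < a \<Longrightarrow> integrable lborel (gauss_kernel a)"
  unfolding gauss_kernel_eq_mult[abs_def] by (intro integrable_mult_right integrable_gauss_mult) simp

text \<open>Up to a constant the kernel at scale a is the multiplier at scale 1 / a, so this
  direction follows from the other one.\<close>

lemma fourier_gauss_kernel:
  fixes \<xi> :: "'a::euclidean_space"
  assumes "0 < a"
  shows "(\<integral>x. of_real (gauss_kernel a x) * cis (2 * pi * (x \<bullet> \<xi>)) \<partial>lborel) = of_real (gauss_mult a \<xi>)"
proof -
  have "(\<integral>x. of_real (gauss_kernel a x) * cis (2 * pi * (x \<bullet> \<xi>)) \<partial>lborel)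
    = (\<integral>x. of_real (a powr (- (real DIM('a) / 2))) * (of_real (gauss_mult (1/a) x) * cis (2 * pi * (x \<bullet> \<xi>))) \<partial>lborel)"
    by (simp add: gauss_kernel_eq_mult mult_ac)
  also have "\<dots> = of_real (a powr (- (real DIM('a) / 2)) * gauss_kernel (1/a) \<xi>)"
    using assms by (subst integral_mult_right_zero, subst gauss_fourier(2)) simp_all
  also have "\<dots> = of_real (gauss_mult a \<xi>)"
    using assms by (simp add: gauss_kernel_def gauss_mult_def powr_divide powr_minus field_simps)
  finally show ?thesis .
qed

lemma integral_gauss_kernel:
  assumes "0 < a" shows "(\<integral>x. gauss_kernel a (x::'a::euclidean_space) \<partial>lborel) = 1"
proof -
  have "complex_of_real (\<integral>x. gauss_kernel a (x::'a) \<partial>lborel) = 1"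
    using fourier_gauss_kernel[OF assms, of "0::'a"] by (simp add: gauss_mult_def)
  then show ?thesis by (simp only: of_real_eq_1_iff)
qed

lemma lborel_integrable_shift:
  fixes f :: "'a::euclidean_space \<Rightarrow> 'b::{banach, second_countable_topology}"
  assumes "integrable lborel f"
  shows "integrable lborel (\<lambda>x. f (x - c))"
  using integrable_distr_eq[of "(+) (- c)" lborel borel f] assms by (simp add: lborel_distr_plus borel_measurable_integrable)

lemma lborel_integral_shift:
  fixes f :: "'a::euclidean_space \<Rightarrow> 'b::{banach, second_countable_topology}"
  assumes [measurable]: "f \<in> borel_measurable borel"
  shows "(\<integral>x. f (x - c) \<partial>lborel) = (\<integral>x. f x \<partial>lborel)"
  using integral_distr[of "(+) (- c)" lborel borel f] by (simp add: lborel_distr_plus)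

lemma lborel_nn_integral_shift:
  fixes f :: "'a::euclidean_space \<Rightarrow> ennreal"
  assumes [measurable]: "f \<in> borel_measurable borel"
  shows "(\<integral>\<^sup>+x. f (x - c) \<partial>lborel) = (\<integral>\<^sup>+x. f x \<partial>lborel)"
  using nn_integral_distr[of "(+) (- c)" lborel borel f] by (simp add: lborel_distr_plus)

lemma nn_integral_gauss_kernel:
  assumes "0 < a"
  shows "(\<integral>\<^sup>+x. ennreal (gauss_kernel a (x - y)) \<partial>lborel) = 1"
    and "(\<integral>\<^sup>+x. ennreal (gauss_kernel a (y - x)) \<partial>lborel) = 1"
proof -
  show "(\<integral>\<^sup>+x. ennreal (gauss_kernel a (x - y)) \<partial>lborel) = 1"
    using lborel_nn_integral_shift[of "\<lambda>x. ennreal (gauss_kernel a x)" y] assms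
    by (simp add: nn_integral_eq_integral integrable_gauss_kernel gauss_kernel_pos less_imp_le integral_gauss_kernel)
  then show "(\<integral>\<^sup>+x. ennreal (gauss_kernel a (y - x)) \<partial>lborel) = 1"
    by (simp add: gauss_kernel_commute)
qed

text \<open>The transform of the image of f dM under \<phi>. Keeping the map \<phi> apart from the
  measure lets mu * nu, and its weighted version (f dmu) * (g dnu), be handled as a weight on the
  product measure with \<phi> the addition map; no convolution of measures is ever formed.\<close>

definition ft :: "'w measure \<Rightarrow> ('w \<Rightarrow> 'a::euclidean_space) \<Rightarrow> ('w \<Rightarrow> complex) \<Rightarrow> 'a \<Rightarrow> complex" where
  "ft M \<phi> f \<xi> = (\<integral>\<omega>. f \<omega> * cis (- (2 * pi * (\<phi> \<omega> \<bullet> \<xi>))) \<partial>M)"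

text \<open>The Gaussian at scale a convolved with the image of f dM under \<phi>. This is a
  function on the whole space even where the image measure is singular.\<close>

definition smooth :: "'w measure \<Rightarrow> ('w \<Rightarrow> 'a::euclidean_space) \<Rightarrow> ('w \<Rightarrow> complex) \<Rightarrow> real \<Rightarrow> 'a \<Rightarrow> complex" where
  "smooth M \<phi> f a x = (\<integral>\<omega>. of_real (gauss_kernel a (x - \<phi> \<omega>)) * f \<omega> \<partial>M)"

lemma fourier_eq_ft: "fourier M f = ft M (\<lambda>x. x) f"
  by (simp add: fourier_def ft_def fun_eq_iff cis_conv_exp mult_ac)

lemma cis_measurable [measurable]: "cis \<in> borel_measurable borel"
  unfolding cis_conv_exp by measurable

lemma cnj_measurable [measurable]: "cnj \<in> borel_measurable borel"
  by (intro borel_measurable_continuous_onI continuous_intros)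

lemma integrable_mult_cis:
  fixes f :: "'w \<Rightarrow> complex"
  assumes "integrable M f" and [measurable]: "h \<in> borel_measurable M"
  shows "integrable M (\<lambda>x. f x * cis (h x))"
  by (rule Bochner_Integration.integrable_bound[OF assms(1)])
     (use assms(1) in \<open>auto simp: norm_mult borel_measurable_integrable\<close>)

lemma ft_measurable [measurable]:
  assumes "sigma_finite_measure M" and [measurable]: "\<phi> \<in> M \<rightarrow>\<^sub>M borel" "f \<in> borel_measurable M"
  shows "ft M \<phi> f \<in> borel_measurable borel"
proof -
  interpret sigma_finite_measure M by fact
  show ?thesis unfolding ft_def[abs_def] by measurable
qed

lemma norm_ft_le:
  assumes "integrable M f"
  shows "norm (ft M \<phi> f \<xi>) \<le> (\<integral>\<omega>. norm (f \<omega>) \<partial>M)"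
  unfolding ft_def by (rule order_trans[OF integral_norm_bound]) (simp add: norm_mult)

lemma integrable_product:
  fixes f :: "'w \<Rightarrow> complex" and g :: "'v \<Rightarrow> complex"
  assumes "sigma_finite_measure M" "sigma_finite_measure N" and f: "integrable M f" and g: "integrable N g"
  shows "integrable (M \<Otimes>\<^sub>M N) (\<lambda>z. f (fst z) * g (snd z))"
proof -
  interpret M: sigma_finite_measure M by fact
  interpret N: sigma_finite_measure N by fact
  interpret pair_sigma_finite M N ..
  note [measurable] = borel_measurable_integrable[OF f] borel_measurable_integrable[OF g]
  show ?thesis
    by (rule Fubini_integrable) (auto simp: norm_mult intro!: integrable_mult_left integrable_mult_right f g)
qed

text \<open>The multiplication formula, by Fubini. It stands in for Fourier inversion and Parseval
  wherever these would be used.\<close>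

lemma ft_exchange:
  fixes \<phi> :: "'w \<Rightarrow> 'a::euclidean_space"
  assumes sf: "sigma_finite_measure M" and [measurable]: "\<phi> \<in> M \<rightarrow>\<^sub>M borel"
    and f: "integrable M f" and w: "integrable lborel w"
  shows "(\<integral>\<xi>. ft M \<phi> f \<xi> * w \<xi> \<partial>lborel) = (\<integral>\<omega>. f \<omega> * ft lborel (\<lambda>x. x) w (\<phi> \<omega>) \<partial>M)"
proof -
  interpret M: sigma_finite_measure M by fact
  interpret pair_sigma_finite M "lborel :: 'a measure" ..
  note [measurable] = borel_measurable_integrable[OF f] borel_measurable_integrable[OF w]
  let ?k = "\<lambda>\<omega> \<xi>. f \<omega> * w \<xi> * cis (- (2 * pi * (\<phi> \<omega> \<bullet> \<xi>)))"
  have "integrable (M \<Otimes>\<^sub>M lborel) (\<lambda>z. f (fst z) * w (snd z) * cis (- (2 * pi * (\<phi> (fst z) \<bullet> snd z))))"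
    by (intro integrable_mult_cis integrable_product sf f w) (auto intro: lborel.sigma_finite_measure_axioms)
  then have int: "integrable (M \<Otimes>\<^sub>M lborel) (case_prod ?k)" by (simp add: case_prod_beta')
  have "(\<integral>\<xi>. ft M \<phi> f \<xi> * w \<xi> \<partial>lborel) = (\<integral>\<xi>. (\<integral>\<omega>. ?k \<omega> \<xi> \<partial>M) \<partial>lborel)"
    unfolding ft_def by (simp add: mult_ac flip: integral_mult_right_zero)
  also have "\<dots> = (\<integral>\<omega>. (\<integral>\<xi>. ?k \<omega> \<xi> \<partial>lborel) \<partial>M)"
    by (rule Fubini_integral[OF int])
  also have "\<dots> = (\<integral>\<omega>. f \<omega> * ft lborel (\<lambda>x. x) w (\<phi> \<omega>) \<partial>M)"
    unfolding ft_def by (simp add: mult_ac inner_commute flip: integral_mult_right_zero)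
  finally show ?thesis .
qed

lemma smooth_measurable [measurable]:
  assumes "sigma_finite_measure M" and [measurable]: "\<phi> \<in> M \<rightarrow>\<^sub>M borel" "f \<in> borel_measurable M"
  shows "smooth M \<phi> f a \<in> borel_measurable borel"
proof -
  interpret sigma_finite_measure M by fact
  show ?thesis unfolding smooth_def[abs_def] by measurable
qed

lemma integrable_gauss_mult_cis:
  fixes h :: "'a::euclidean_space \<Rightarrow> real"
  assumes "0 < a" and [measurable]: "h \<in> borel_measurable borel"
  shows "integrable lborel (\<lambda>\<xi>::'a. of_real (gauss_mult a \<xi>) * cis (h \<xi>))"
  by (intro integrable_mult_cis integrable_of_real integrable_gauss_mult assms) auto

text \<open>The one inversion formula that is needed: a Gaussian weight times a character has a
  translated Gaussian kernel as its transform, so the multiplication formula gives the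
  claim.\<close>

lemma smooth_eq_inverse_fourier:
  assumes a: "0 < a" and sf: "sigma_finite_measure M" and [measurable]: "\<phi> \<in> M \<rightarrow>\<^sub>M borel"
    and f: "integrable M f"
  shows "smooth M \<phi> f a x = (\<integral>\<xi>. of_real (gauss_mult a \<xi>) * ft M \<phi> f \<xi> * cis (2 * pi * (x \<bullet> \<xi>)) \<partial>lborel)"
proof -
  let ?w = "\<lambda>\<xi>. of_real (gauss_mult a \<xi>) * cis (2 * pi * (x \<bullet> \<xi>))"
  have w: "integrable lborel ?w" by (rule integrable_gauss_mult_cis[OF a]) simp
  have "ft lborel (\<lambda>x. x) ?w y = of_real (gauss_kernel a (x - y))" for y
    unfolding ft_def gauss_fourier(2)[OF a, symmetric]
    by (simp add: mult.assoc cis_mult inner_diff_left inner_diff_right inner_commute right_diff_distrib)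
  then show ?thesis
    using ft_exchange[OF sf _ f w, of \<phi>] by (simp add: smooth_def mult_ac)
qed

text \<open>Since the kernel has mass 1 in x for every \<omega>, absolute integrability reduces to
  that of f. This justifies the exchanges of integrals for mollifications.\<close>

lemma smooth_pair_integrable:
  fixes \<phi> :: "'w \<Rightarrow> 'a::euclidean_space" and f :: "'w \<Rightarrow> complex"
  assumes a: "0 < a" and sf: "sigma_finite_measure M" and [measurable]: "\<phi> \<in> M \<rightarrow>\<^sub>M borel"
    and f: "integrable M f"
  shows "integrable (M \<Otimes>\<^sub>M lborel) (\<lambda>(\<omega>, x). of_real (gauss_kernel a (x - \<phi> \<omega>)) * f \<omega>)"
proof -
  interpret M: sigma_finite_measure M by fact
  interpret pair_sigma_finite M "lborel :: 'a measure" ..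
  note [measurable] = borel_measurable_integrable[OF f]
  have 1: "(\<integral>x. gauss_kernel a (x - \<phi> \<omega>) \<partial>lborel) = 1" for \<omega>
    by (simp add: lborel_integral_shift integral_gauss_kernel a)
  show ?thesis
    by (rule Fubini_integrable)
       (auto simp: norm_mult gauss_kernel_pos[OF a] less_imp_le 1 f
             intro!: integrable_mult_left integrable_of_real integrable_norm lborel_integrable_shift integrable_gauss_kernel a)
qed

lemma integrable_smooth:
  fixes \<phi> :: "'w \<Rightarrow> 'a::euclidean_space"
  assumes a: "0 < a" and sf: "sigma_finite_measure M" and [measurable]: "\<phi> \<in> M \<rightarrow>\<^sub>M borel"
    and f: "integrable M f"
  shows "integrable lborel (smooth M \<phi> f a)"
proof -
  interpret M: sigma_finite_measure M by fact
  interpret pair_sigma_finite M "lborel :: 'a measure" ..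
  show ?thesis
    using integrable_snd[OF smooth_pair_integrable[OF assms]] by (simp add: smooth_def[abs_def])
qed

lemma ft_smooth:
  fixes \<phi> :: "'w \<Rightarrow> 'a::euclidean_space"
  assumes a: "0 < a" and sf: "sigma_finite_measure M" and [measurable]: "\<phi> \<in> M \<rightarrow>\<^sub>M borel"
    and f: "integrable M f"
  shows "ft lborel (\<lambda>x. x) (smooth M \<phi> f a) \<xi> = of_real (gauss_mult a \<xi>) * ft M \<phi> f \<xi>"
proof -
  interpret M: sigma_finite_measure M by fact
  interpret pair_sigma_finite M "lborel :: 'a measure" ..
  note [measurable] = borel_measurable_integrable[OF f]
  let ?k = "\<lambda>\<omega> x. of_real (gauss_kernel a (x - \<phi> \<omega>)) * f \<omega> * cis (- (2 * pi * (x \<bullet> \<xi>)))"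
  have "integrable (M \<Otimes>\<^sub>M lborel) (\<lambda>z. (case z of (\<omega>, x) \<Rightarrow> of_real (gauss_kernel a (x - \<phi> \<omega>)) * f \<omega>) * cis (- (2 * pi * (snd z \<bullet> \<xi>))))"
    by (intro integrable_mult_cis smooth_pair_integrable assms) auto
  then have int: "integrable (M \<Otimes>\<^sub>M lborel) (case_prod ?k)" by (simp add: case_prod_beta')
  have *: "(\<integral>x. ?k \<omega> x \<partial>lborel) = of_real (gauss_mult a \<xi>) * (f \<omega> * cis (- (2 * pi * (\<phi> \<omega> \<bullet> \<xi>))))" for \<omega>
  proof -
    let ?g = "\<lambda>x. of_real (gauss_kernel a x) * cis (2 * pi * (x \<bullet> (- \<xi>)))"
    have "(\<integral>x. ?k \<omega> x \<partial>lborel) = (\<integral>x. f \<omega> * cis (- (2 * pi * (\<phi> \<omega> \<bullet> \<xi>))) * ?g (x - \<phi> \<omega>) \<partial>lborel)"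
      by (intro Bochner_Integration.integral_cong refl)
         (simp add: mult_ac cis_mult inner_diff_left algebra_simps)
    also have "\<dots> = f \<omega> * cis (- (2 * pi * (\<phi> \<omega> \<bullet> \<xi>))) * (\<integral>x. ?g (x - \<phi> \<omega>) \<partial>lborel)"
      by (rule integral_mult_right_zero)
    also have "(\<integral>x. ?g (x - \<phi> \<omega>) \<partial>lborel) = of_real (gauss_mult a (- \<xi>))"
      by (subst lborel_integral_shift) (simp, rule fourier_gauss_kernel[OF a])
    finally show ?thesis by (simp add: gauss_mult_def mult_ac)
  qed
  have "ft lborel (\<lambda>x. x) (smooth M \<phi> f a) \<xi> = (\<integral>x. (\<integral>\<omega>. ?k \<omega> x \<partial>M) \<partial>lborel)"
    unfolding ft_def smooth_def by (simp add: mult_ac flip: integral_mult_right_zero)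
  also have "\<dots> = (\<integral>\<omega>. (\<integral>x. ?k \<omega> x \<partial>lborel) \<partial>M)"
    by (rule Fubini_integral[OF int])
  also have "\<dots> = of_real (gauss_mult a \<xi>) * ft M \<phi> f \<xi>"
    unfolding * ft_def by (rule integral_mult_right_zero)
  finally show ?thesis .
qed

text \<open>No integrability of f is assumed: where the defining integral does not exist, it has the
  value 0 and the bound is trivial.\<close>

lemma norm_smooth_le:
  assumes a: "0 < a" and [measurable]: "f \<in> borel_measurable M" "\<phi> \<in> M \<rightarrow>\<^sub>M borel"
  shows "ennreal (norm (smooth M \<phi> f a x)) \<le> (\<integral>\<^sup>+\<omega>. ennreal (gauss_kernel a (x - \<phi> \<omega>)) * ennreal (norm (f \<omega>)) \<partial>M)"
proof (cases "integrable M (\<lambda>\<omega>. complex_of_real (gauss_kernel a (x - \<phi> \<omega>)) * f \<omega>)")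
  case True
  show ?thesis unfolding smooth_def
    by (rule order_trans[OF integral_norm_bound_ennreal[OF True]])
       (auto simp: norm_mult ennreal_mult' gauss_kernel_pos[OF a] less_imp_le)
qed (simp add: smooth_def not_integrable_integral_eq)

section \<open>Plancherel and real interpolation\<close>

lemma norm_integral_le_nn_integral:
  fixes f :: "'w \<Rightarrow> 'b::{banach, second_countable_topology}"
  shows "ennreal (norm (integral\<^sup>L M f)) \<le> (\<integral>\<^sup>+x. ennreal (norm (f x)) \<partial>M)"
  by (cases "integrable M f") (auto intro: integral_norm_bound_ennreal simp: not_integrable_integral_eq)

text \<open>The Gaussian weights tend to 1 pointwise as the scale tends to 0, so Fatou's lemma
  removes them from any bound that is uniform in the scale.\<close>

lemma nn_integral_le_gauss_limit:
  fixes \<phi> :: "'a::euclidean_space \<Rightarrow> ennreal"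
  assumes [measurable]: "\<phi> \<in> borel_measurable borel"
    and a: "a \<longlonglongrightarrow> 0"
    and le: "\<And>n. (\<integral>\<^sup>+\<xi>. \<phi> \<xi> * ennreal (gauss_mult (a n) \<xi>) \<partial>lborel) \<le> C"
  shows "(\<integral>\<^sup>+\<xi>. \<phi> \<xi> \<partial>lborel) \<le> C"
proof -
  have "(\<lambda>n. \<phi> \<xi> * ennreal (gauss_mult (a n) \<xi>)) \<longlonglongrightarrow> \<phi> \<xi> * ennreal 1" for \<xi>
  proof (intro tendsto_mult_ennreal tendsto_const tendsto_ennrealI)
    have "(\<lambda>n. exp (- (pi * a n * (norm \<xi>)\<^sup>2))) \<longlonglongrightarrow> exp (- (pi * 0 * (norm \<xi>)\<^sup>2))"
      by (intro tendsto_intros a)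
    then show "(\<lambda>n. gauss_mult (a n) \<xi>) \<longlonglongrightarrow> 1" by (simp add: gauss_mult_def)
  qed auto
  then have "liminf (\<lambda>n. \<phi> \<xi> * ennreal (gauss_mult (a n) \<xi>)) = \<phi> \<xi>" for \<xi>
    by (intro lim_imp_Liminf) simp_all
  then have "(\<integral>\<^sup>+\<xi>. \<phi> \<xi> \<partial>lborel) = (\<integral>\<^sup>+\<xi>. liminf (\<lambda>n. \<phi> \<xi> * ennreal (gauss_mult (a n) \<xi>)) \<partial>lborel)"
    by simp
  also have "\<dots> \<le> liminf (\<lambda>n. \<integral>\<^sup>+\<xi>. \<phi> \<xi> * ennreal (gauss_mult (a n) \<xi>) \<partial>lborel)"
    by (rule nn_integral_liminf) measurable
  also have "\<dots> \<le> C"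
    using Liminf_mono[of "\<lambda>n. \<integral>\<^sup>+\<xi>. \<phi> \<xi> * ennreal (gauss_mult (a n) \<xi>) \<partial>lborel" "\<lambda>_. C" sequentially] le
    by (simp add: Liminf_const)
  finally show ?thesis .
qed

text \<open>With a Gaussian weight, the left side is the pairing of h with its own mollification.
  Since the kernel has mass 1, this pairing is at most the squared L^2 norm of h, for every scale;
  the right side may be infinite. Only the inequality is claimed, and no L^2 extension of the
  transform is constructed.\<close>

lemma Plancherel_le:
  fixes h :: "'a::euclidean_space \<Rightarrow> complex"
  assumes h: "integrable lborel h"
  shows "(\<integral>\<^sup>+\<xi>. ennreal ((norm (ft lborel (\<lambda>x. x) h \<xi>))\<^sup>2) \<partial>lborel) \<le> (\<integral>\<^sup>+x. ennreal ((norm (h x))\<^sup>2) \<partial>lborel)"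
    (is "_ \<le> ?I")
proof -
  note [measurable] = borel_measurable_integrable[OF h]
  let ?h = "ft lborel (\<lambda>x. x) h"
  have [measurable]: "?h \<in> borel_measurable borel"
    by (intro ft_measurable lborel.sigma_finite_measure_axioms) auto
  have main: "(\<integral>\<^sup>+\<xi>. ennreal ((norm (?h \<xi>))\<^sup>2) * ennreal (gauss_mult a \<xi>) \<partial>lborel) \<le> ?I" if a: "0 < a" for a
  proof -
    \<comment> \<open>The weighted conjugate of the transform of h; its own transform is the
      conjugate of the mollification of h, which turns the weighted square integral into a pairing
      in x.\<close>
    define w where "w \<xi> = cnj (?h \<xi>) * of_real (gauss_mult a \<xi>)" for \<xi>
    define B where "B = (\<integral>x. norm (h x) \<partial>lborel)"
    have hB: "norm (?h \<xi>) \<le> B" for \<xi> unfolding B_def by (rule norm_ft_le[OF h])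
    have w: "integrable lborel w"
    proof (rule Bochner_Integration.integrable_bound[OF integrable_mult_right[OF integrable_gauss_mult[OF a], of B]])
      have "w \<in> borel_measurable borel" unfolding w_def[abs_def] by measurable
      then show "w \<in> borel_measurable lborel" by simp
    qed (use hB order_trans[OF norm_ge_zero hB] in \<open>auto simp: w_def norm_mult gauss_mult_pos less_imp_le abs_mult intro!: mult_right_mono\<close>)
    have ftw: "ft lborel (\<lambda>x. x) w x = cnj (smooth lborel (\<lambda>x. x) h a x)" for x
    proof -
      have "ft lborel (\<lambda>x. x) w x = (\<integral>\<xi>. cnj (of_real (gauss_mult a \<xi>) * ?h \<xi> * cis (2 * pi * (x \<bullet> \<xi>))) \<partial>lborel)"
        unfolding ft_def[of _ _ w] by (simp add: w_def cis_cnj inner_commute mult_ac)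
      also have "\<dots> = cnj (smooth lborel (\<lambda>x. x) h a x)"
        unfolding smooth_eq_inverse_fourier[OF a lborel.sigma_finite_measure_axioms measurable_ident_sets[OF sets_lborel] h]
        by (rule Bochner_Integration.integral_cnj)
      finally show ?thesis .
    qed
    have int: "integrable lborel (\<lambda>\<xi>. (norm (?h \<xi>))\<^sup>2 * gauss_mult a \<xi>)"
    proof (rule Bochner_Integration.integrable_bound[OF integrable_mult_right[OF integrable_gauss_mult[OF a], of "B\<^sup>2"]])
    qed (use hB order_trans[OF norm_ge_zero hB] in \<open>auto simp: norm_mult gauss_mult_pos less_imp_le abs_mult intro!: mult_right_mono power_mono\<close>)
    have "(\<integral>\<^sup>+\<xi>. ennreal ((norm (?h \<xi>))\<^sup>2) * ennreal (gauss_mult a \<xi>) \<partial>lborel) = ennreal (\<integral>\<xi>. (norm (?h \<xi>))\<^sup>2 * gauss_mult a \<xi> \<partial>lborel)"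
      by (subst nn_integral_eq_integral[OF int, symmetric])
         (auto simp: gauss_mult_pos less_imp_le ennreal_mult')
    also have "(\<integral>\<xi>. (norm (?h \<xi>))\<^sup>2 * gauss_mult a \<xi> \<partial>lborel) \<le> norm (complex_of_real (\<integral>\<xi>. (norm (?h \<xi>))\<^sup>2 * gauss_mult a \<xi> \<partial>lborel))"
      by simp
    also have "complex_of_real (\<integral>\<xi>. (norm (?h \<xi>))\<^sup>2 * gauss_mult a \<xi> \<partial>lborel) = (\<integral>\<xi>. ?h \<xi> * w \<xi> \<partial>lborel)"
      by (simp add: w_def mult.assoc[symmetric] complex_norm_square[symmetric] flip: integral_complex_of_real)
    also have "\<dots> = (\<integral>x. h x * cnj (smooth lborel (\<lambda>x. x) h a x) \<partial>lborel)"
      by (subst ft_exchange[OF lborel.sigma_finite_measure_axioms _ h w]) (auto simp: ftw)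
    also have "ennreal (norm (\<integral>x. h x * cnj (smooth lborel (\<lambda>x. x) h a x) \<partial>lborel))
       \<le> (\<integral>\<^sup>+x. ennreal (norm (h x)) * ennreal (norm (smooth lborel (\<lambda>x. x) h a x)) \<partial>lborel)"
      by (rule order_trans[OF norm_integral_le_nn_integral]) (simp add: norm_mult ennreal_mult')
    also have "\<dots> \<le> (\<integral>\<^sup>+x. ennreal (norm (h x)) * (\<integral>\<^sup>+y. ennreal (gauss_kernel a (x - y)) * ennreal (norm (h y)) \<partial>lborel) \<partial>lborel)"
      by (intro nn_integral_mono mult_left_mono norm_smooth_le a) auto
    also have "\<dots> = (\<integral>\<^sup>+x. (\<integral>\<^sup>+y. ennreal (gauss_kernel a (x - y) * (norm (h x) * norm (h y))) \<partial>lborel) \<partial>lborel)"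
      using gauss_kernel_pos[OF a]
      by (simp add: less_imp_le ennreal_mult' mult_ac flip: nn_integral_cmult)
    \<comment> \<open>The arithmetic-geometric mean inequality separates the variables, so that the
      kernel can be integrated out in y in one term and in x in the other. Each term gives half of
      the squared L^2 norm.\<close>
    also have "\<dots> \<le> (\<integral>\<^sup>+x. (\<integral>\<^sup>+y. ennreal (gauss_kernel a (x - y)) * ennreal ((norm (h x))\<^sup>2 / 2) + ennreal (gauss_kernel a (x - y)) * ennreal ((norm (h y))\<^sup>2 / 2) \<partial>lborel) \<partial>lborel)"
    proof (intro nn_integral_mono)
      fix x y
      have "norm (h x) * norm (h y) \<le> (norm (h x))\<^sup>2 / 2 + (norm (h y))\<^sup>2 / 2"
        using sum_squares_bound[of "norm (h x)" "norm (h y)"] by simp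
      then show "ennreal (gauss_kernel a (x - y) * (norm (h x) * norm (h y))) \<le> ennreal (gauss_kernel a (x - y)) * ennreal ((norm (h x))\<^sup>2 / 2) + ennreal (gauss_kernel a (x - y)) * ennreal ((norm (h y))\<^sup>2 / 2)"
        using gauss_kernel_pos[OF a, of "x - y"] mult_left_mono[of _ _ "gauss_kernel a (x - y)"]
        by (fastforce simp: distrib_left simp flip: ennreal_mult' ennreal_plus)
    qed
    also have "\<dots> = (\<integral>\<^sup>+x. (\<integral>\<^sup>+y. ennreal (gauss_kernel a (x - y)) * ennreal ((norm (h x))\<^sup>2 / 2) \<partial>lborel) \<partial>lborel)
       + (\<integral>\<^sup>+x. (\<integral>\<^sup>+y. ennreal (gauss_kernel a (x - y)) * ennreal ((norm (h y))\<^sup>2 / 2) \<partial>lborel) \<partial>lborel)"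
      by (simp add: nn_integral_add)
    also have "(\<integral>\<^sup>+x. (\<integral>\<^sup>+y. ennreal (gauss_kernel a (x - y)) * ennreal ((norm (h y))\<^sup>2 / 2) \<partial>lborel) \<partial>lborel)
      = (\<integral>\<^sup>+y. (\<integral>\<^sup>+x. ennreal (gauss_kernel a (x - y)) * ennreal ((norm (h y))\<^sup>2 / 2) \<partial>lborel) \<partial>lborel)"
      by (rule lborel_pair.Fubini') simp
    also have "(\<integral>\<^sup>+x. (\<integral>\<^sup>+y. ennreal (gauss_kernel a (x - y)) * ennreal ((norm (h x))\<^sup>2 / 2) \<partial>lborel) \<partial>lborel)
       + (\<integral>\<^sup>+y. (\<integral>\<^sup>+x. ennreal (gauss_kernel a (x - y)) * ennreal ((norm (h y))\<^sup>2 / 2) \<partial>lborel) \<partial>lborel)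
       = (\<integral>\<^sup>+x. ennreal ((norm (h x))\<^sup>2 / 2) + ennreal ((norm (h x))\<^sup>2 / 2) \<partial>lborel)"
      by (simp add: nn_integral_multc nn_integral_gauss_kernel[OF a] nn_integral_add)
    also have "\<dots> = ?I" by (simp flip: ennreal_plus)
    finally show ?thesis by (simp add: ennreal_leI)
  qed
  have "(\<lambda>n. inverse (real (Suc n))) \<longlonglongrightarrow> 0" by (rule LIMSEQ_inverse_real_of_nat)
  then show ?thesis
    by (rule nn_integral_le_gauss_limit[rotated]) (auto intro!: main)
qed

section \<open>Integration over heights and interpolation\<close>

lemma nn_integral_powr_from_0:
  assumes "e > -1" "b \<ge> 0"
  shows "(\<integral>\<^sup>+l. ennreal (l powr e) * indicator {0..b} l \<partial>lborel) = ennreal (b powr (e + 1) / (e + 1))"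
  by (rule nn_integral_has_integral_lebesgue'[OF _ has_integral_powr_from_0[OF assms]]) simp

lemma nn_integral_powr_to_inf:
  assumes "e < -1" "b > 0"
  shows "(\<integral>\<^sup>+l. ennreal (l powr e) * indicator {b..} l \<partial>lborel) = ennreal (b powr (e + 1) / (- (e + 1)))"
  using nn_integral_has_integral_lebesgue'[OF _ has_integral_powr_to_inf[OF assms]] assms(1)
  by (simp add: field_simps)

text \<open>The heights between A / 2 and A alone contribute A^(q-1) times A / 2, half of A^q. This
  pointwise comparison replaces the layer-cake formula, and no distribution function
  appears.\<close>

lemma powr_le_layer_integral:
  fixes \<Phi> :: "real \<Rightarrow> ennreal"
  assumes A: "0 \<le> A" and [measurable]: "\<Phi> \<in> borel_measurable borel"
    and le: "\<And>l. 0 < l \<Longrightarrow> A / 2 \<le> l \<Longrightarrow> l \<le> A \<Longrightarrow> ennreal (A powr (q - 1)) \<le> \<Phi> l"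
  shows "ennreal (A powr q) \<le> 2 * (\<integral>\<^sup>+l. \<Phi> l * indicator {0<..} l \<partial>lborel)"
proof (cases "A = 0")
  case False
  with A have A: "0 < A" by simp
  have "ennreal (A powr q) = ennreal 2 * (ennreal (A powr (q - 1)) * ennreal (A / 2))"
    using A by (simp add: powr_diff flip: ennreal_mult ennreal_numeral)
  also have "ennreal (A powr (q - 1)) * ennreal (A / 2) = (\<integral>\<^sup>+l. ennreal (A powr (q - 1)) * indicator {A/2..A} l \<partial>lborel)"
    using A by (subst nn_integral_cmult_indicator) auto
  also have "\<dots> \<le> (\<integral>\<^sup>+l. \<Phi> l * indicator {0<..} l \<partial>lborel)"
    using A le by (intro nn_integral_mono) (auto simp: indicator_def)
  finally show ?thesis by (simp add: mult_left_mono)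
qed auto

text \<open>Real interpolation between \<open>L\<^sup>1 \<rightarrow> L\<^sup>\<infinity>\<close> and \<open>L\<^sup>2 \<rightarrow> L\<^sup>2\<close>: at height \<open>l\<close> the function is truncated
  where its large part has transform at most \<open>l / 2\<close>.\<close>
lemma Hausdorff_Young:
  fixes q N :: real
  assumes q: "2 < q" and N: "0 < N"
  shows "\<exists>K::real. \<forall>h :: 'a::euclidean_space \<Rightarrow> complex. integrable lborel h \<longrightarrow>
     (\<integral>\<^sup>+x. ennreal (norm (h x) powr (q / (q - 1))) \<partial>lborel) \<le> ennreal N \<longrightarrow>
     (\<integral>\<^sup>+\<xi>. ennreal (norm (ft lborel (\<lambda>x. x) h \<xi>) powr q) \<partial>lborel) \<le> ennreal K"
proof (intro exI allI impI)
  fix h :: "'a \<Rightarrow> complex"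
  assume h: "integrable lborel h"
    and hN: "(\<integral>\<^sup>+x. ennreal (norm (h x) powr (q / (q - 1))) \<partial>lborel) \<le> ennreal N"
  define s where "s = q / (q - 1)"
  have s: "s - 1 = 1 / (q - 1)" "1 < s" using q by (auto simp: s_def field_simps)
  \<comment> \<open>Chosen so that \<alpha>^(1-s) N = l / 2. On the part of h above \<alpha> one has
    |h| \<le> |h|^s \<alpha>^(1-s), hence that part has L^1 norm at most l / 2.\<close>
  define \<alpha> where "\<alpha> l = (2 * N / l) powr (q - 1)" for l
  define lo where "lo l x = (if norm (h x) \<le> \<alpha> l then h x else 0)" for l x
  define hi where "hi l x = (if norm (h x) \<le> \<alpha> l then 0 else h x)" for l x
  note [measurable] = borel_measurable_integrable[OF h]
  have [measurable]: "h \<in> borel_measurable borel" using borel_measurable_integrable[OF h] by simp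
  have [measurable]: "\<alpha> \<in> borel_measurable borel" unfolding \<alpha>_def[abs_def] by measurable
  have lo_meas [measurable (raw)]: "(\<lambda>z. lo (u z) (v z)) \<in> borel_measurable X"
    if [measurable]: "u \<in> borel_measurable X" "v \<in> borel_measurable X" for u v and X :: "'x measure"
    unfolding lo_def by measurable
  have [measurable]: "lo l \<in> borel_measurable borel" "hi l \<in> borel_measurable borel" for l
    unfolding lo_def[abs_def] hi_def[abs_def] by measurable
  have int: "integrable lborel (lo l)" "integrable lborel (hi l)" for l
    by (rule Bochner_Integration.integrable_bound[OF h]; auto simp: lo_def hi_def)+
  let ?F = "ft lborel (\<lambda>x::'a. x)"
  have add: "?F h \<xi> = ?F (lo l) \<xi> + ?F (hi l) \<xi>" for l \<xi>
  proof -
    have "?F h \<xi> = (\<integral>x. lo l x * cis (- (2 * pi * (x \<bullet> \<xi>))) + hi l x * cis (- (2 * pi * (x \<bullet> \<xi>))) \<partial>lborel)"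
      unfolding ft_def by (intro Bochner_Integration.integral_cong) (auto simp: lo_def hi_def)
    also have "\<dots> = ?F (lo l) \<xi> + ?F (hi l) \<xi>"
      unfolding ft_def by (intro Bochner_Integration.integral_add integrable_mult_cis int) auto
    finally show ?thesis .
  qed
  have \<alpha>_pos: "0 < \<alpha> l" if "0 < l" for l using that N by (simp add: \<alpha>_def)
  have hi: "norm (?F (hi l) \<xi>) \<le> l / 2" if l: "0 < l" for l \<xi>
  proof -
    have pw: "norm (hi l x) \<le> norm (h x) powr s * \<alpha> l powr (1 - s)" for x
    proof (cases "norm (h x) \<le> \<alpha> l")
      case False
      then have lt: "\<alpha> l < norm (h x)" by simp
      then have "norm (h x) = norm (h x) powr s * norm (h x) powr (1 - s)"
        using \<alpha>_pos[OF l] by (simp flip: powr_add)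
      also have "\<dots> \<le> norm (h x) powr s * \<alpha> l powr (1 - s)"
        using lt s(2) \<alpha>_pos[OF l] by (intro mult_left_mono powr_mono2') auto
      finally show ?thesis using False by (simp add: hi_def)
    qed (simp add: hi_def cong: if_cong)
    have "\<alpha> l powr (1 - s) = (2 * N / l) powr (- ((q - 1) * (s - 1)))"
      by (simp add: \<alpha>_def powr_powr algebra_simps)
    also have "\<dots> = l / (2 * N)"
      using q l N by (simp add: s(1) powr_minus)
    finally have \<alpha>s: "\<alpha> l powr (1 - s) = l / (2 * N)" .
    have "ennreal (norm (?F (hi l) \<xi>)) \<le> (\<integral>\<^sup>+x. ennreal (norm (hi l x)) \<partial>lborel)"
      using norm_integral_le_nn_integral[of lborel "\<lambda>x. hi l x * cis (- (2 * pi * (x \<bullet> \<xi>)))"]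
      by (simp add: ft_def norm_mult)
    also have "\<dots> \<le> (\<integral>\<^sup>+x. ennreal (norm (h x) powr s) * ennreal (l / (2 * N)) \<partial>lborel)"
      using pw l N by (intro nn_integral_mono) (simp add: \<alpha>s flip: ennreal_mult)
    also have "\<dots> \<le> ennreal N * ennreal (l / (2 * N))"
      using hN by (subst nn_integral_multc) (auto simp: s_def intro: mult_right_mono)
    also have "\<dots> = ennreal (l / 2)"
      using l N by (simp flip: ennreal_mult)
    finally show ?thesis using l by (simp add: ennreal_le_iff)
  qed
  \<comment> \<open>Only the small part enters: at heights l \<le> |Fh| the large part accounts for
    at most half of |Fh|. The factor 4 pays for squaring this half, and 2^q for replacing |Fh| by l
    in the remaining power.\<close>
  define \<Phi> where "\<Phi> \<xi> l = ennreal (2 powr q * 4 * l powr (q - 3)) * ennreal ((norm (?F (lo l) \<xi>))\<^sup>2)" for \<xi> l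
  have ftlo [measurable]: "(\<lambda>z. ?F (lo (snd z)) (fst z)) \<in> borel_measurable (borel \<Otimes>\<^sub>M borel)"
    unfolding ft_def by (measurable; simp)
  have \<Phi>_meas [measurable]: "(\<lambda>z. \<Phi> (fst z) (snd z)) \<in> borel_measurable (borel \<Otimes>\<^sub>M borel)"
    unfolding \<Phi>_def by measurable
  have layer: "ennreal (norm (?F h \<xi>) powr q) \<le> 2 * (\<integral>\<^sup>+l. \<Phi> \<xi> l * indicator {0<..} l \<partial>lborel)" for \<xi>
  proof (rule powr_le_layer_integral)
    show "\<Phi> \<xi> \<in> borel_measurable borel"
      using measurable_compose[OF _ \<Phi>_meas, of "\<lambda>l. (\<xi>, l)" borel] by simp
    fix l :: real assume l: "0 < l" "norm (?F h \<xi>) / 2 \<le> l" "l \<le> norm (?F h \<xi>)"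
    let ?A = "norm (?F h \<xi>)"
    have "?A \<le> norm (?F (lo l) \<xi>) + norm (?F (hi l) \<xi>)"
      unfolding add[of \<xi> l] by (rule norm_triangle_ineq)
    then have "?A / 2 \<le> norm (?F (lo l) \<xi>)" using hi[OF l(1), of \<xi>] l(3) by simp
    then have sq: "(?A / 2)\<^sup>2 \<le> (norm (?F (lo l) \<xi>))\<^sup>2" by (intro power_mono) auto
    have A: "0 < ?A" using l by linarith
    \<comment> \<open>The exponent q - 3 may have either sign, so the comparison uses |Fh| \<le> 2 l
      in one case and l \<le> |Fh| in the other.\<close>
    have "?A powr (q - 3) \<le> 2 powr q * l powr (q - 3)"
    proof (cases "3 \<le> q")
      case True
      have "?A powr (q - 3) \<le> (2 * l) powr (q - 3)" using l A True by (intro powr_mono2) auto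
      also have "\<dots> = 2 powr (q - 3) * l powr (q - 3)" using l by (simp add: powr_mult)
      also have "\<dots> \<le> 2 powr q * l powr (q - 3)" by (intro mult_right_mono powr_mono) auto
      finally show ?thesis .
    next
      case False
      then have "?A powr (q - 3) \<le> 1 * l powr (q - 3)" using l by (simp add: powr_mono2')
      also have "\<dots> \<le> 2 powr q * l powr (q - 3)" using q by (intro mult_right_mono) (auto intro: ge_one_powr_ge_zero)
      finally show ?thesis .
    qed
    then have "?A powr (q - 3) * ?A\<^sup>2 \<le> (2 powr q * l powr (q - 3)) * (4 * (norm (?F (lo l) \<xi>))\<^sup>2)"
      using sq by (intro mult_mono) (auto simp: power_divide)
    moreover have "?A powr (q - 1) = ?A powr (q - 3) * ?A\<^sup>2"
      using A by (simp flip: powr_add powr_numeral)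
    ultimately show "ennreal (?A powr (q - 1)) \<le> \<Phi> \<xi> l"
      unfolding \<Phi>_def by (simp add: mult_ac flip: ennreal_mult)
  qed simp
  have inner: "(\<integral>\<^sup>+l. ennreal (l powr (q - 3)) * ennreal ((norm (lo l x))\<^sup>2) * indicator {0<..} l \<partial>lborel)
      \<le> ennreal ((2 * N) powr (q - 2) / (q - 2)) * ennreal (norm (h x) powr s)" for x
  proof (cases "h x = 0")
    case False
    \<comment> \<open>The height at which \<alpha> falls to |h x|: since \<alpha> decreases in l,
      the point x belongs to the small part only for l \<le> b. The integral over (0, b] converges
      because q > 2.\<close>
    define b where "b = 2 * N * norm (h x) powr (- (1 / (q - 1)))"
    have b: "0 < b" using False N by (simp add: b_def)
    have "l \<le> b" if l: "0 < l" and le: "norm (h x) \<le> \<alpha> l" for l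
    proof -
      have "norm (h x) powr (1 / (q - 1)) \<le> \<alpha> l powr (1 / (q - 1))"
        using le q by (intro powr_mono2) auto
      also have "\<dots> = 2 * N / l" using q N l by (simp add: \<alpha>_def powr_powr)
      finally show ?thesis
        using False l N by (simp add: b_def powr_minus field_simps)
    qed
    then have "(\<integral>\<^sup>+l. ennreal (l powr (q - 3)) * ennreal ((norm (lo l x))\<^sup>2) * indicator {0<..} l \<partial>lborel)
      \<le> (\<integral>\<^sup>+l. ennreal ((norm (h x))\<^sup>2) * (ennreal (l powr (q - 3)) * indicator {0..b} l) \<partial>lborel)"
      by (intro nn_integral_mono) (auto simp: lo_def indicator_def mult_ac)
    also have "\<dots> = ennreal ((norm (h x))\<^sup>2) * ennreal (b powr (q - 3 + 1) / (q - 3 + 1))"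
      using q b by (subst nn_integral_cmult) (auto simp: nn_integral_powr_from_0)
    also have "\<dots> = ennreal ((norm (h x))\<^sup>2 * (b powr (q - 2) / (q - 2)))"
      using q by (simp flip: ennreal_mult)
    also have "(norm (h x))\<^sup>2 * (b powr (q - 2) / (q - 2)) = (2 * N) powr (q - 2) / (q - 2) * norm (h x) powr s"
    proof -
      have "b powr (q - 2) = (2 * N) powr (q - 2) * norm (h x) powr (- (1 / (q - 1)) * (q - 2))"
        unfolding b_def using N by (subst powr_mult) (auto simp: powr_powr)
      moreover have "(norm (h x))\<^sup>2 * norm (h x) powr (- (1 / (q - 1)) * (q - 2)) = norm (h x) powr (2 + - (1 / (q - 1)) * (q - 2))"
        using False by (subst powr_add) simp
      \<comment> \<open>The exponents recombine to s, so that the final integral in x is the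
        hypothesis on h itself.\<close>
      moreover have "2 + - (1 / (q - 1)) * (q - 2) = s" using q by (simp add: s_def field_simps)
      ultimately show ?thesis by (simp add: mult_ac)
    qed
    finally show ?thesis using q by (simp flip: ennreal_mult)
  next
    case True
    then have "lo l x = 0" for l by (simp add: lo_def)
    then show ?thesis by simp
  qed
  have "(\<integral>\<^sup>+\<xi>. ennreal (norm (?F h \<xi>) powr q) \<partial>lborel) \<le> (\<integral>\<^sup>+\<xi>. 2 * (\<integral>\<^sup>+l. \<Phi> \<xi> l * indicator {0<..} l \<partial>lborel) \<partial>lborel)"
    by (intro nn_integral_mono layer)
  also have "\<dots> = 2 * (\<integral>\<^sup>+\<xi>. (\<integral>\<^sup>+l. \<Phi> \<xi> l * indicator {0<..} l \<partial>lborel) \<partial>lborel)"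
    by (subst nn_integral_cmult) auto
  also have "(\<integral>\<^sup>+\<xi>. (\<integral>\<^sup>+l. \<Phi> \<xi> l * indicator {0<..} l \<partial>lborel) \<partial>lborel) = (\<integral>\<^sup>+l. (\<integral>\<^sup>+\<xi>. \<Phi> \<xi> l * indicator {0<..} l \<partial>lborel) \<partial>lborel)"
    by (rule lborel_pair.Fubini'[symmetric]) simp
  also have "\<dots> = (\<integral>\<^sup>+l. ennreal (2 powr q * 4 * l powr (q - 3)) * (\<integral>\<^sup>+\<xi>. ennreal ((norm (?F (lo l) \<xi>))\<^sup>2) \<partial>lborel) * indicator {0<..} l \<partial>lborel)"
  proof (intro nn_integral_cong)
    fix l :: real
    have m: "(\<lambda>\<xi>. ennreal ((norm (?F (lo l) \<xi>))\<^sup>2)) \<in> borel_measurable lborel"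
      using measurable_compose[OF _ ftlo, of "\<lambda>\<xi>. (\<xi>, l)" borel] by simp
    show "(\<integral>\<^sup>+\<xi>. \<Phi> \<xi> l * indicator {0<..} l \<partial>lborel)
      = ennreal (2 powr q * 4 * l powr (q - 3)) * (\<integral>\<^sup>+\<xi>. ennreal ((norm (?F (lo l) \<xi>))\<^sup>2) \<partial>lborel) * indicator {0<..} l"
      unfolding \<Phi>_def by (subst nn_integral_multc, intro m borel_measurable_times_ennreal borel_measurable_const)
        (subst nn_integral_cmult[OF m], rule refl)
  qed
  also have "\<dots> \<le> (\<integral>\<^sup>+l. ennreal (2 powr q * 4 * l powr (q - 3)) * (\<integral>\<^sup>+x. ennreal ((norm (lo l x))\<^sup>2) \<partial>lborel) * indicator {0<..} l \<partial>lborel)"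
    by (intro nn_integral_mono mult_right_mono mult_left_mono Plancherel_le int) auto
  also have "\<dots> = (\<integral>\<^sup>+l. (\<integral>\<^sup>+x. ennreal (2 powr q * 4 * l powr (q - 3)) * ennreal ((norm (lo l x))\<^sup>2) * indicator {0<..} l \<partial>lborel) \<partial>lborel)"
    by (simp add: nn_integral_cmult nn_integral_multc)
  also have "\<dots> = (\<integral>\<^sup>+x. (\<integral>\<^sup>+l. ennreal (2 powr q * 4 * l powr (q - 3)) * ennreal ((norm (lo l x))\<^sup>2) * indicator {0<..} l \<partial>lborel) \<partial>lborel)"
    by (rule lborel_pair.Fubini') simp
  also have "\<dots> = (\<integral>\<^sup>+x. (\<integral>\<^sup>+l. ennreal (2 powr q * 4) * (ennreal (l powr (q - 3)) * ennreal ((norm (lo l x))\<^sup>2) * indicator {0<..} l) \<partial>lborel) \<partial>lborel)"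
    unfolding ennreal_mult''[OF powr_ge_zero, of "2 powr q * 4"] by (simp only: mult.assoc)
  also have "\<dots> \<le> (\<integral>\<^sup>+x. ennreal (2 powr q * 4) * (ennreal ((2 * N) powr (q - 2) / (q - 2)) * ennreal (norm (h x) powr s)) \<partial>lborel)"
    by (subst nn_integral_cmult) (auto intro!: nn_integral_mono mult_left_mono inner)
  also have "\<dots> = ennreal (2 powr q * 4) * (ennreal ((2 * N) powr (q - 2) / (q - 2)) * (\<integral>\<^sup>+x. ennreal (norm (h x) powr s) \<partial>lborel))"
    by (simp add: nn_integral_cmult)
  also have "\<dots> \<le> ennreal (2 powr q * 4) * (ennreal ((2 * N) powr (q - 2) / (q - 2)) * ennreal N)"
    using hN by (intro mult_left_mono) (auto simp: s_def)
  finally have "(\<integral>\<^sup>+\<xi>. ennreal (norm (?F h \<xi>) powr q) \<partial>lborel) \<le> ennreal 2 * (ennreal (2 powr q * 4) * (ennreal ((2 * N) powr (q - 2) / (q - 2)) * ennreal N))"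
    by (simp add: mult_left_mono)
  also have "\<dots> = ennreal (2 * (2 powr q * 4 * ((2 * N) powr (q - 2) / (q - 2) * N)))"
    using q N by (subst ennreal_mult[symmetric], simp, simp)+ simp
  finally show "(\<integral>\<^sup>+\<xi>. ennreal (norm (?F h \<xi>) powr q) \<partial>lborel) \<le> ennreal (2 * (2 powr q * 4 * ((2 * N) powr (q - 2) / (q - 2) * N)))" .
qed

text \<open>The exact power of B is the point: it is p times the interpolation parameter 2 (1 -
  1/p), and later it carries the gain from Fourier decay. The measurability hypothesis concerns
  families of functions because the truncation depends on the height, over which Tonelli is
  applied.\<close>

lemma Marcinkiewicz:
  fixes T :: "('a::euclidean_space \<Rightarrow> complex) \<Rightarrow> 'a \<Rightarrow> complex" and p B K :: real
  assumes p: "1 < p" "p < 2" and B: "0 < B" and K: "0 \<le> K"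
    and add: "\<And>f g x. integrable lborel f \<Longrightarrow> integrable lborel g \<Longrightarrow> T (\<lambda>x. f x + g x) x = T f x + T g x"
    and meas: "\<And>g :: real \<Rightarrow> 'a \<Rightarrow> complex. (\<lambda>z. g (fst z) (snd z)) \<in> borel_measurable (borel \<Otimes>\<^sub>M borel) \<Longrightarrow>
        (\<lambda>z. T (g (fst z)) (snd z)) \<in> borel_measurable (borel \<Otimes>\<^sub>M borel)"
    and L1: "\<And>f. integrable lborel f \<Longrightarrow> (\<integral>\<^sup>+x. ennreal (norm (T f x)) \<partial>lborel) \<le> ennreal K * (\<integral>\<^sup>+x. ennreal (norm (f x)) \<partial>lborel)"
    and L2: "\<And>f. integrable lborel f \<Longrightarrow> (\<integral>\<^sup>+x. ennreal ((norm (T f x))\<^sup>2) \<partial>lborel) \<le> ennreal (B\<^sup>2) * (\<integral>\<^sup>+x. ennreal ((norm (f x))\<^sup>2) \<partial>lborel)"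
    and h: "integrable lborel h"
  shows "(\<integral>\<^sup>+x. ennreal (norm (T h x) powr p) \<partial>lborel)
     \<le> ennreal ((4 * K / (p - 1) + 8 / (2 - p)) * B powr (2 * (p - 1))) * (\<integral>\<^sup>+x. ennreal (norm (h x) powr p) \<partial>lborel)"
proof -
  \<comment> \<open>Truncating at l / B^2 rather than at l balances the two hypotheses: both the L^1
    and the L^2 contribution then carry B^(2(p-1)).\<close>
  define lo where "lo l x = (if norm (h x) \<le> l / B\<^sup>2 then h x else 0)" for l x
  define hi where "hi l x = (if norm (h x) \<le> l / B\<^sup>2 then 0 else h x)" for l x
  have [measurable]: "h \<in> borel_measurable borel" using borel_measurable_integrable[OF h] by simp
  have lo_meas [measurable (raw)]: "(\<lambda>z. lo (u z) (v z)) \<in> borel_measurable X"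
    if [measurable]: "u \<in> borel_measurable X" "v \<in> borel_measurable X" for u v and X :: "'x measure"
    unfolding lo_def by measurable
  have hi_meas [measurable (raw)]: "(\<lambda>z. hi (u z) (v z)) \<in> borel_measurable X"
    if [measurable]: "u \<in> borel_measurable X" "v \<in> borel_measurable X" for u v and X :: "'x measure"
    unfolding hi_def by measurable
  have int: "integrable lborel (lo l)" "integrable lborel (hi l)" for l
    by (rule Bochner_Integration.integrable_bound[OF h]; auto simp: lo_def hi_def)+
  have Tadd: "T h x = T (lo l) x + T (hi l) x" for l x
  proof -
    have "h = (\<lambda>x. lo l x + hi l x)" by (auto simp: lo_def hi_def)
    then show ?thesis using add[OF int(1)[of l] int(2)[of l]] by simp
  qed
  have Tlo [measurable]: "(\<lambda>z. T (lo (fst z)) (snd z)) \<in> borel_measurable (borel \<Otimes>\<^sub>M borel)"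
    by (rule meas) simp
  have Thi [measurable]: "(\<lambda>z. T (hi (fst z)) (snd z)) \<in> borel_measurable (borel \<Otimes>\<^sub>M borel)"
    by (rule meas) simp
  have [measurable]: "T (lo l) \<in> borel_measurable borel" "T (hi l) \<in> borel_measurable borel" for l
    using measurable_compose[OF _ Tlo, of "\<lambda>x. (l, x)" borel] measurable_compose[OF _ Thi, of "\<lambda>x. (l, x)" borel]
    by simp_all
  \<comment> \<open>One summand for each alternative: the transform of the large part or that of the
    small part is at least half of |T h|. The powers p - 2 and p - 3 are negative, so |T h| may be
    replaced by l \<le> |T h| in them.\<close>
  define \<Phi> where "\<Phi> x l = ennreal (2 * l powr (p - 2)) * ennreal (norm (T (hi l) x))
       + ennreal (4 * l powr (p - 3)) * ennreal ((norm (T (lo l) x))\<^sup>2)" for x l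
  have \<Phi>_meas [measurable]: "(\<lambda>z. \<Phi> (snd z) (fst z)) \<in> borel_measurable (borel \<Otimes>\<^sub>M borel)"
    unfolding \<Phi>_def by measurable
  have [measurable]: "(\<lambda>z. \<Phi> (fst z) (snd z)) \<in> borel_measurable (borel \<Otimes>\<^sub>M borel)"
    using measurable_compose[OF measurable_Pair[OF measurable_snd measurable_fst] \<Phi>_meas] by simp
  have layer: "ennreal (norm (T h x) powr p) \<le> 2 * (\<integral>\<^sup>+l. \<Phi> x l * indicator {0<..} l \<partial>lborel)" for x
  proof (rule powr_le_layer_integral)
    show "\<Phi> x \<in> borel_measurable borel"
      using measurable_compose[OF _ \<Phi>_meas, of "\<lambda>l. (l, x)" borel] by simp
    fix l :: real assume l: "0 < l" "norm (T h x) / 2 \<le> l" "l \<le> norm (T h x)"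
    let ?A = "norm (T h x)"
    have A: "0 < ?A" using l by linarith
    have "?A \<le> norm (T (lo l) x) + norm (T (hi l) x)"
      unfolding Tadd[of x l] by (rule norm_triangle_ineq)
    then consider "?A / 2 \<le> norm (T (hi l) x)" | "?A / 2 \<le> norm (T (lo l) x)" by linarith
    then show "ennreal (?A powr (p - 1)) \<le> \<Phi> x l"
    proof cases
      case 1
      have "?A powr (p - 1) = ?A powr (p - 2) * ?A" using A by (simp add: powr_mult_base mult.commute)
      also have "\<dots> \<le> l powr (p - 2) * (2 * norm (T (hi l) x))"
        using 1 l p by (intro mult_mono powr_mono2') auto
      finally have "ennreal (?A powr (p - 1)) \<le> ennreal (2 * l powr (p - 2)) * ennreal (norm (T (hi l) x))"
        by (simp add: mult_ac flip: ennreal_mult)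
      then show ?thesis unfolding \<Phi>_def by (rule add_increasing2[rotated]) simp
    next
      case 2
      then have sq: "(?A / 2)\<^sup>2 \<le> (norm (T (lo l) x))\<^sup>2" by (intro power_mono) auto
      have "?A powr (p - 1) = ?A powr (p - 3) * ?A\<^sup>2"
        using A by (simp flip: powr_add powr_numeral)
      also have "\<dots> \<le> l powr (p - 3) * (4 * (norm (T (lo l) x))\<^sup>2)"
        using sq l p by (intro mult_mono powr_mono2') (auto simp: power_divide)
      finally have "ennreal (?A powr (p - 1)) \<le> ennreal (4 * l powr (p - 3)) * ennreal ((norm (T (lo l) x))\<^sup>2)"
        by (simp add: mult_ac flip: ennreal_mult)
      then show ?thesis unfolding \<Phi>_def by (rule add_increasing[rotated]) simp
    qed
  qed simp
  have Bp: "B\<^sup>2 powr e = B powr (2 * e)" for e using B by (simp add: powr_powr flip: powr_numeral)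
  have inner1: "(\<integral>\<^sup>+l. ennreal (2 * l powr (p - 2)) * ennreal (norm (hi l x)) * indicator {0<..} l \<partial>lborel)
      \<le> ennreal (2 / (p - 1) * B powr (2 * (p - 1))) * ennreal (norm (h x) powr p)" for x
  proof (cases "h x = 0")
    case False
    \<comment> \<open>The height at which x passes from the large to the small part. The large part
      lives below b, where convergence of the integral at 0 needs p > 1.\<close>
    define b where "b = norm (h x) * B\<^sup>2"
    have b: "0 < b" using False B by (simp add: b_def)
    have "l \<le> b" if "\<not> norm (h x) \<le> l / B\<^sup>2" for l
      using that B by (simp add: b_def field_simps)
    then have "(\<integral>\<^sup>+l. ennreal (2 * l powr (p - 2)) * ennreal (norm (hi l x)) * indicator {0<..} l \<partial>lborel)
      \<le> (\<integral>\<^sup>+l. ennreal (2 * norm (h x)) * (ennreal (l powr (p - 2)) * indicator {0..b} l) \<partial>lborel)"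
      by (intro nn_integral_mono) (auto simp: hi_def indicator_def mult_ac simp flip: ennreal_mult)
    also have "\<dots> = ennreal (2 * norm (h x)) * ennreal (b powr (p - 2 + 1) / (p - 2 + 1))"
      using p b by (subst nn_integral_cmult) (auto simp: nn_integral_powr_from_0)
    also have "\<dots> = ennreal (2 * norm (h x) * (b powr (p - 1) / (p - 1)))"
      using p by (simp flip: ennreal_mult)
    also have "2 * norm (h x) * (b powr (p - 1) / (p - 1)) = 2 / (p - 1) * B powr (2 * (p - 1)) * norm (h x) powr p"
    proof -
      have "b powr (p - 1) = norm (h x) powr (p - 1) * B powr (2 * (p - 1))"
        unfolding b_def using B by (subst powr_mult) (auto simp: Bp)
      moreover have "norm (h x) * norm (h x) powr (p - 1) = norm (h x) powr p"
        using False by (simp add: powr_mult_base)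
      ultimately show ?thesis by (simp add: mult_ac)
    qed
    finally show ?thesis using p by (simp flip: ennreal_mult)
  next
    case True
    then have "hi l x = 0" for l by (simp add: hi_def)
    then show ?thesis by simp
  qed
  have inner2: "(\<integral>\<^sup>+l. ennreal (4 * l powr (p - 3)) * (ennreal (B\<^sup>2) * ennreal ((norm (lo l x))\<^sup>2)) * indicator {0<..} l \<partial>lborel)
      \<le> ennreal (4 / (2 - p) * B powr (2 * (p - 1))) * ennreal (norm (h x) powr p)" for x
  proof (cases "h x = 0")
    case False
    \<comment> \<open>The same threshold seen from the other side: the small part lives above b,
      where convergence at infinity needs p < 2.\<close>
    define b where "b = norm (h x) * B\<^sup>2"
    have b: "0 < b" using False B by (simp add: b_def)
    have "b \<le> l" if "norm (h x) \<le> l / B\<^sup>2" for l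
      using that B by (simp add: b_def field_simps)
    then have "(\<integral>\<^sup>+l. ennreal (4 * l powr (p - 3)) * (ennreal (B\<^sup>2) * ennreal ((norm (lo l x))\<^sup>2)) * indicator {0<..} l \<partial>lborel)
      \<le> (\<integral>\<^sup>+l. ennreal (4 * B\<^sup>2 * (norm (h x))\<^sup>2) * (ennreal (l powr (p - 3)) * indicator {b..} l) \<partial>lborel)"
      by (intro nn_integral_mono) (auto simp: lo_def indicator_def mult_ac simp flip: ennreal_mult)
    also have "\<dots> = ennreal (4 * B\<^sup>2 * (norm (h x))\<^sup>2) * ennreal (b powr (p - 3 + 1) / (- (p - 3 + 1)))"
      using p b by (subst nn_integral_cmult) (auto simp: nn_integral_powr_to_inf)
    also have "\<dots> = ennreal (4 * B\<^sup>2 * (norm (h x))\<^sup>2 * (b powr (p - 2) / (2 - p)))"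
      using p by (simp flip: ennreal_mult)
    also have "4 * B\<^sup>2 * (norm (h x))\<^sup>2 * (b powr (p - 2) / (2 - p)) = 4 / (2 - p) * B powr (2 * (p - 1)) * norm (h x) powr p"
    proof -
      have e1: "b powr (p - 2) = norm (h x) powr (p - 2) * B powr (2 * (p - 2))"
        unfolding b_def using B by (subst powr_mult) (auto simp: Bp)
      have e2: "(norm (h x))\<^sup>2 * norm (h x) powr (p - 2) = norm (h x) powr p"
        using False by (simp flip: powr_add powr_numeral)
      have e3: "B\<^sup>2 * B powr (2 * (p - 2)) = B powr (2 * (p - 1))"
        using B by (simp add: algebra_simps flip: powr_add powr_numeral)
      show ?thesis unfolding e2[symmetric] e3[symmetric] e1 by (simp add: mult_ac)
    qed
    finally show ?thesis using p by (simp flip: ennreal_mult)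
  next
    case True
    then have "lo l x = 0" for l by (simp add: lo_def)
    then show ?thesis by simp
  qed
  have "(\<integral>\<^sup>+x. ennreal (norm (T h x) powr p) \<partial>lborel) \<le> (\<integral>\<^sup>+x. 2 * (\<integral>\<^sup>+l. \<Phi> x l * indicator {0<..} l \<partial>lborel) \<partial>lborel)"
    by (intro nn_integral_mono layer)
  also have "\<dots> = 2 * (\<integral>\<^sup>+x. (\<integral>\<^sup>+l. \<Phi> x l * indicator {0<..} l \<partial>lborel) \<partial>lborel)"
    by (subst nn_integral_cmult) auto
  also have "(\<integral>\<^sup>+x. (\<integral>\<^sup>+l. \<Phi> x l * indicator {0<..} l \<partial>lborel) \<partial>lborel) = (\<integral>\<^sup>+l. (\<integral>\<^sup>+x. \<Phi> x l * indicator {0<..} l \<partial>lborel) \<partial>lborel)"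
    by (rule lborel_pair.Fubini'[symmetric]) simp
  also have "\<dots> = (\<integral>\<^sup>+l. (ennreal (2 * l powr (p - 2)) * (\<integral>\<^sup>+x. ennreal (norm (T (hi l) x)) \<partial>lborel)
      + ennreal (4 * l powr (p - 3)) * (\<integral>\<^sup>+x. ennreal ((norm (T (lo l) x))\<^sup>2) \<partial>lborel)) * indicator {0<..} l \<partial>lborel)"
  proof (intro nn_integral_cong)
    fix l :: real
    have m1: "(\<lambda>x. ennreal (norm (T (hi l) x))) \<in> borel_measurable lborel" by simp
    have m2: "(\<lambda>x. ennreal ((norm (T (lo l) x))\<^sup>2)) \<in> borel_measurable lborel" by simp
    show "(\<integral>\<^sup>+x. \<Phi> x l * indicator {0<..} l \<partial>lborel) = (ennreal (2 * l powr (p - 2)) * (\<integral>\<^sup>+x. ennreal (norm (T (hi l) x)) \<partial>lborel)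
      + ennreal (4 * l powr (p - 3)) * (\<integral>\<^sup>+x. ennreal ((norm (T (lo l) x))\<^sup>2) \<partial>lborel)) * indicator {0<..} l"
      unfolding \<Phi>_def
      apply (subst nn_integral_multc, intro m1 m2 borel_measurable_times_ennreal borel_measurable_add borel_measurable_const)
      apply (subst nn_integral_add, intro m1 borel_measurable_times_ennreal borel_measurable_const, intro m2 borel_measurable_times_ennreal borel_measurable_const)
      apply (subst nn_integral_cmult[OF m1], subst nn_integral_cmult[OF m2], rule refl)
      done
  qed
  also have "\<dots> \<le> (\<integral>\<^sup>+l. (ennreal (2 * l powr (p - 2)) * (ennreal K * (\<integral>\<^sup>+x. ennreal (norm (hi l x)) \<partial>lborel))
      + ennreal (4 * l powr (p - 3)) * (ennreal (B\<^sup>2) * (\<integral>\<^sup>+x. ennreal ((norm (lo l x))\<^sup>2) \<partial>lborel))) * indicator {0<..} l \<partial>lborel)"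
    by (intro nn_integral_mono mult_right_mono add_mono mult_left_mono L1 L2 int) auto
  also have "\<dots> = (\<integral>\<^sup>+l. (\<integral>\<^sup>+x. ennreal K * (ennreal (2 * l powr (p - 2)) * ennreal (norm (hi l x)) * indicator {0<..} l)
      + ennreal (4 * l powr (p - 3)) * (ennreal (B\<^sup>2) * ennreal ((norm (lo l x))\<^sup>2)) * indicator {0<..} l \<partial>lborel) \<partial>lborel)"
  proof (intro nn_integral_cong)
    fix l :: real
    have "(\<integral>\<^sup>+x. ennreal K * (ennreal (2 * l powr (p - 2)) * ennreal (norm (hi l x)) * indicator {0<..} l)
      + ennreal (4 * l powr (p - 3)) * (ennreal (B\<^sup>2) * ennreal ((norm (lo l x))\<^sup>2)) * indicator {0<..} l \<partial>lborel)
      = ennreal K * (ennreal (2 * l powr (p - 2)) * (\<integral>\<^sup>+x. ennreal (norm (hi l x)) \<partial>lborel) * indicator {0<..} l)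
      + ennreal (4 * l powr (p - 3)) * (ennreal (B\<^sup>2) * (\<integral>\<^sup>+x. ennreal ((norm (lo l x))\<^sup>2) \<partial>lborel)) * indicator {0<..} l"
      by (simp add: nn_integral_add nn_integral_cmult nn_integral_multc)
    then show "(ennreal (2 * l powr (p - 2)) * (ennreal K * (\<integral>\<^sup>+x. ennreal (norm (hi l x)) \<partial>lborel))
      + ennreal (4 * l powr (p - 3)) * (ennreal (B\<^sup>2) * (\<integral>\<^sup>+x. ennreal ((norm (lo l x))\<^sup>2) \<partial>lborel))) * indicator {0<..} l
      = (\<integral>\<^sup>+x. ennreal K * (ennreal (2 * l powr (p - 2)) * ennreal (norm (hi l x)) * indicator {0<..} l)
      + ennreal (4 * l powr (p - 3)) * (ennreal (B\<^sup>2) * ennreal ((norm (lo l x))\<^sup>2)) * indicator {0<..} l \<partial>lborel)"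
      by (simp only: distrib_left distrib_right mult_ac)
  qed
  also have "\<dots> = (\<integral>\<^sup>+x. (\<integral>\<^sup>+l. ennreal K * (ennreal (2 * l powr (p - 2)) * ennreal (norm (hi l x)) * indicator {0<..} l)
      + ennreal (4 * l powr (p - 3)) * (ennreal (B\<^sup>2) * ennreal ((norm (lo l x))\<^sup>2)) * indicator {0<..} l \<partial>lborel) \<partial>lborel)"
    by (rule lborel_pair.Fubini') simp
  also have "\<dots> = (\<integral>\<^sup>+x. ennreal K * (\<integral>\<^sup>+l. (ennreal (2 * l powr (p - 2)) * ennreal (norm (hi l x)) * indicator {0<..} l) \<partial>lborel)
      + (\<integral>\<^sup>+l. ennreal (4 * l powr (p - 3)) * (ennreal (B\<^sup>2) * ennreal ((norm (lo l x))\<^sup>2)) * indicator {0<..} l \<partial>lborel) \<partial>lborel)"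
    by (subst nn_integral_add) (auto simp: nn_integral_cmult)
  also have "\<dots> \<le> (\<integral>\<^sup>+x. ennreal K * (ennreal (2 / (p - 1) * B powr (2 * (p - 1))) * ennreal (norm (h x) powr p))
      + ennreal (4 / (2 - p) * B powr (2 * (p - 1))) * ennreal (norm (h x) powr p) \<partial>lborel)"
    by (intro nn_integral_mono add_mono mult_left_mono inner1 inner2) auto
  also have "\<dots> = (\<integral>\<^sup>+x. ennreal ((2 * K / (p - 1) + 4 / (2 - p)) * B powr (2 * (p - 1))) * ennreal (norm (h x) powr p) \<partial>lborel)"
  proof (intro nn_integral_cong)
    fix x
    define c1 c2 Y where "c1 = 2 / (p - 1) * B powr (2 * (p - 1))" and "c2 = 4 / (2 - p) * B powr (2 * (p - 1))"
      and "Y = ennreal (norm (h x) powr p)"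
    have "0 \<le> c1" "0 \<le> c2" using p by (auto simp: c1_def c2_def)
    then have "ennreal K * (ennreal c1 * Y) + ennreal c2 * Y = ennreal (K * c1 + c2) * Y"
      using K by (simp add: ennreal_plus ennreal_mult distrib_left mult_ac)
    also have "K * c1 + c2 = (2 * K / (p - 1) + 4 / (2 - p)) * B powr (2 * (p - 1))"
      by (simp add: c1_def c2_def distrib_right distrib_left mult_ac)
    finally show "ennreal K * (ennreal (2 / (p - 1) * B powr (2 * (p - 1))) * ennreal (norm (h x) powr p))
      + ennreal (4 / (2 - p) * B powr (2 * (p - 1))) * ennreal (norm (h x) powr p)
      = ennreal ((2 * K / (p - 1) + 4 / (2 - p)) * B powr (2 * (p - 1))) * ennreal (norm (h x) powr p)"
      by (simp add: c1_def c2_def Y_def)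
  qed
  also have "\<dots> = ennreal ((2 * K / (p - 1) + 4 / (2 - p)) * B powr (2 * (p - 1))) * (\<integral>\<^sup>+x. ennreal (norm (h x) powr p) \<partial>lborel)"
    by (simp add: nn_integral_cmult)
  finally have "(\<integral>\<^sup>+x. ennreal (norm (T h x) powr p) \<partial>lborel) \<le> 2 * (ennreal ((2 * K / (p - 1) + 4 / (2 - p)) * B powr (2 * (p - 1))) * (\<integral>\<^sup>+x. ennreal (norm (h x) powr p) \<partial>lborel))"
    by (simp add: mult_left_mono)
  also have "\<dots> = ennreal ((4 * K / (p - 1) + 8 / (2 - p)) * B powr (2 * (p - 1))) * (\<integral>\<^sup>+x. ennreal (norm (h x) powr p) \<partial>lborel)"
  proof -
    have "ennreal ((4 * K / (p - 1) + 8 / (2 - p)) * B powr (2 * (p - 1))) = ennreal 2 * ennreal ((2 * K / (p - 1) + 4 / (2 - p)) * B powr (2 * (p - 1)))"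
      using p K by (subst ennreal_mult[symmetric]) (auto simp: algebra_simps)
    then show ?thesis by (simp add: mult_ac)
  qed
  finally show ?thesis .
qed

section \<open>Frequency-localised convolution operators\<close>

text \<open>The convolution theorem for (f dM) * (g dN), with the convolution represented by the
  addition map on the product space.\<close>

lemma ft_pair:
  fixes \<phi> :: "'v \<Rightarrow> 'a::euclidean_space" and \<psi> :: "'w \<Rightarrow> 'a"
  assumes sf: "sigma_finite_measure M" "sigma_finite_measure N"
    and [measurable]: "\<phi> \<in> M \<rightarrow>\<^sub>M borel" "\<psi> \<in> N \<rightarrow>\<^sub>M borel"
    and f: "integrable M f" and g: "integrable N g"
  shows "ft (M \<Otimes>\<^sub>M N) (\<lambda>z. \<phi> (fst z) + \<psi> (snd z)) (\<lambda>z. f (fst z) * g (snd z)) \<xi> = ft M \<phi> f \<xi> * ft N \<psi> g \<xi>"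
proof -
  interpret M: sigma_finite_measure M by fact
  interpret N: sigma_finite_measure N by fact
  interpret pair_sigma_finite M N ..
  note [measurable] = borel_measurable_integrable[OF f] borel_measurable_integrable[OF g]
  let ?k = "\<lambda>y z. (f y * cis (- (2 * pi * (\<phi> y \<bullet> \<xi>)))) * (g z * cis (- (2 * pi * (\<psi> z \<bullet> \<xi>))))"
  have "integrable (M \<Otimes>\<^sub>M N) (\<lambda>z. ?k (fst z) (snd z))"
    by (intro integrable_product integrable_mult_cis sf f g) auto
  then have int: "integrable (M \<Otimes>\<^sub>M N) (case_prod ?k)" by (simp add: case_prod_beta')
  have cis_add: "cis (- (2 * pi * ((y + z) \<bullet> \<xi>))) = cis (- (2 * pi * (y \<bullet> \<xi>))) * cis (- (2 * pi * (z \<bullet> \<xi>)))" for y z :: 'a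
    by (simp add: cis_mult inner_add_left distrib_left)
  have "ft (M \<Otimes>\<^sub>M N) (\<lambda>z. \<phi> (fst z) + \<psi> (snd z)) (\<lambda>z. f (fst z) * g (snd z)) \<xi> = (\<integral>z. ?k (fst z) (snd z) \<partial>(M \<Otimes>\<^sub>M N))"
    unfolding ft_def
    by (intro Bochner_Integration.integral_cong refl)
       (simp only: cis_add, simp only: mult_ac)
  also have "\<dots> = (\<integral>y. (\<integral>z. ?k y z \<partial>N) \<partial>M)"
    using integral_fst'[OF int[unfolded case_prod_beta']] by simp
  also have "\<dots> = ft M \<phi> f \<xi> * ft N \<psi> g \<xi>"
    unfolding ft_def by simp
  finally show ?thesis .
qed

lemma nn_integral_smooth_le:
  fixes \<phi> :: "'w \<Rightarrow> 'a::euclidean_space"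
  assumes a: "0 < a" and sf: "sigma_finite_measure M" and [measurable]: "\<phi> \<in> M \<rightarrow>\<^sub>M borel" "f \<in> borel_measurable M"
  shows "(\<integral>\<^sup>+x. ennreal (norm (smooth M \<phi> f a x)) \<partial>lborel) \<le> (\<integral>\<^sup>+\<omega>. ennreal (norm (f \<omega>)) \<partial>M)"
proof -
  interpret sigma_finite_measure M by fact
  interpret pair_sigma_finite M "lborel :: 'a measure" ..
  have "(\<integral>\<^sup>+x. ennreal (norm (smooth M \<phi> f a x)) \<partial>lborel) \<le>
     (\<integral>\<^sup>+x. (\<integral>\<^sup>+\<omega>. ennreal (gauss_kernel a (x - \<phi> \<omega>)) * ennreal (norm (f \<omega>)) \<partial>M) \<partial>lborel)"
    by (intro nn_integral_mono norm_smooth_le a) auto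
  also have "\<dots> = (\<integral>\<^sup>+\<omega>. (\<integral>\<^sup>+x. ennreal (gauss_kernel a (x - \<phi> \<omega>)) * ennreal (norm (f \<omega>)) \<partial>lborel) \<partial>M)"
    by (rule Fubini') simp
  also have "\<dots> = (\<integral>\<^sup>+\<omega>. ennreal (norm (f \<omega>)) \<partial>M)"
    by (simp add: nn_integral_multc nn_integral_gauss_kernel[OF a])
  finally show ?thesis .
qed

text \<open>The multiplier operator with symbol A(P) times the transform of \<nu>, where P is the
  Gaussian at scale a. The factor with parameter c makes the frequency integral converge absolutely;
  the norm bounds do not depend on c. A polynomial in P is a combination of Gaussians, which makes
  the operator a combination of honest convolutions.\<close>

definition mult_op :: "'a::euclidean_space measure \<Rightarrow> real \<Rightarrow> real poly \<Rightarrow> real \<Rightarrow> ('a \<Rightarrow> complex) \<Rightarrow> 'a \<Rightarrow> complex" where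
  "mult_op \<nu> c A a h x = (\<integral>\<xi>. of_real (gauss_mult c \<xi> * poly A (gauss_mult a \<xi>)) * ft \<nu> (\<lambda>x. x) (\<lambda>_. 1) \<xi>
      * ft lborel (\<lambda>x. x) h \<xi> * cis (2 * pi * (x \<bullet> \<xi>)) \<partial>lborel)"

lemma poly_measurable [measurable]: "poly (A :: real poly) \<in> borel_measurable borel"
  by (intro borel_measurable_continuous_onI continuous_intros)

lemma norm_poly_le:
  assumes "\<bar>s\<bar> \<le> 1" shows "\<bar>poly A s\<bar> \<le> (\<Sum>k\<le>degree A. \<bar>coeff A k\<bar> :: real)"
proof -
  have "\<bar>poly A s\<bar> \<le> (\<Sum>k\<le>degree A. \<bar>coeff A k * s ^ k\<bar>)"
    unfolding poly_altdef by (rule sum_abs)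
  also have "\<dots> \<le> (\<Sum>k\<le>degree A. \<bar>coeff A k\<bar>)"
    using assms by (intro sum_mono) (auto simp: abs_mult power_abs intro!: mult_left_le power_le_one)
  finally show ?thesis .
qed

section \<open>Norm bounds for the multiplier operator\<close>

context
  fixes \<nu> :: "'a::euclidean_space measure" and c a :: real and A :: "real poly"
  assumes sets_\<nu> [measurable_cong]: "sets \<nu> = sets borel" and fin_\<nu>: "finite_measure \<nu>" and c: "0 < c" and a: "0 < a"
begin

interpretation nu: finite_measure \<nu> by (rule fin_\<nu>)

lemma id_\<nu> [measurable]: "(\<lambda>x. x) \<in> \<nu> \<rightarrow>\<^sub>M borel"
  using measurable_ident_sets[OF sets_\<nu>] .

lemma ft_\<nu>_measurable [measurable]: "ft \<nu> (\<lambda>x. x) (\<lambda>_. 1) \<in> borel_measurable borel"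
  by (intro ft_measurable nu.sigma_finite_measure_axioms) auto

text \<open>Joint measurability for a parametrised family of functions, as interpolation asks for
  it.\<close>

lemma ft_lborel_measurable:
  fixes g :: "'z \<Rightarrow> 'a \<Rightarrow> complex"
  assumes g: "(\<lambda>z. g (fst z) (snd z)) \<in> borel_measurable (Z \<Otimes>\<^sub>M borel)"
    and u: "u \<in> X \<rightarrow>\<^sub>M Z" and v: "v \<in> borel_measurable X"
  shows "(\<lambda>z. ft lborel (\<lambda>x. x) (g (u z)) (v z)) \<in> borel_measurable X"
proof -
  have "(\<lambda>z. (u (fst z), snd z)) \<in> X \<Otimes>\<^sub>M lborel \<rightarrow>\<^sub>M Z \<Otimes>\<^sub>M borel"
    using u by measurable
  from measurable_compose[OF this g]
  have m: "(\<lambda>z. g (u (fst z)) (snd z)) \<in> borel_measurable (X \<Otimes>\<^sub>M lborel)" by simp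
  have m2: "(\<lambda>z. cis (- (2 * pi * (snd z \<bullet> v (fst z))))) \<in> borel_measurable (X \<Otimes>\<^sub>M lborel)"
    using v by measurable
  show ?thesis unfolding ft_def
    by (intro lborel.borel_measurable_lebesgue_integral)
       (simp add: case_prod_beta', intro borel_measurable_times m m2)
qed

lemma integrable_mult_op:
  assumes h: "integrable lborel h"
  shows "integrable lborel (\<lambda>\<xi>. of_real (gauss_mult c \<xi> * poly A (gauss_mult a \<xi>)) * ft \<nu> (\<lambda>x. x) (\<lambda>_. 1) \<xi> * ft lborel (\<lambda>x. x) h \<xi>)"
proof -
  have [measurable]: "h \<in> borel_measurable borel" using borel_measurable_integrable[OF h] by simp
  have [measurable]: "ft lborel (\<lambda>x. x) h \<in> borel_measurable borel"
    by (intro ft_measurable lborel.sigma_finite_measure_axioms) auto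
  let ?S = "\<Sum>k\<le>degree A. \<bar>coeff A k\<bar>" and ?V = "\<integral>x. norm (1::complex) \<partial>\<nu>" and ?H = "\<integral>x. norm (h x) \<partial>lborel"
  show ?thesis
  proof (rule Bochner_Integration.integrable_bound[OF integrable_mult_right[OF integrable_gauss_mult[OF c], of "?S * ?V * ?H"]])
    show "AE \<xi> in lborel. norm (of_real (gauss_mult c \<xi> * poly A (gauss_mult a \<xi>)) * ft \<nu> (\<lambda>x. x) (\<lambda>_. 1) \<xi> * ft lborel (\<lambda>x. x) h \<xi>)
       \<le> norm (?S * ?V * ?H * gauss_mult c \<xi>)"
    proof (rule AE_I2)
      fix \<xi> :: 'a
      have "\<bar>poly A (gauss_mult a \<xi>)\<bar> \<le> ?S"
        using a gauss_mult_pos[of a \<xi>] gauss_mult_le_1[of a \<xi>] by (intro norm_poly_le) auto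
      then have "\<bar>poly A (gauss_mult a \<xi>)\<bar> * norm (ft \<nu> (\<lambda>x. x) (\<lambda>_. 1) \<xi>) * norm (ft lborel (\<lambda>x. x) h \<xi>) \<le> ?S * ?V * ?H"
        by (intro mult_mono norm_ft_le h) auto
      then have "\<bar>poly A (gauss_mult a \<xi>)\<bar> * norm (ft \<nu> (\<lambda>x. x) (\<lambda>_. 1) \<xi>) * norm (ft lborel (\<lambda>x. x) h \<xi>) * gauss_mult c \<xi> \<le> \<bar>?S * ?V * ?H\<bar> * gauss_mult c \<xi>"
        using gauss_mult_pos[of c \<xi>] by (intro mult_right_mono) auto
      then show "norm (of_real (gauss_mult c \<xi> * poly A (gauss_mult a \<xi>)) * ft \<nu> (\<lambda>x. x) (\<lambda>_. 1) \<xi> * ft lborel (\<lambda>x. x) h \<xi>)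
       \<le> norm (?S * ?V * ?H * gauss_mult c \<xi>)"
        using gauss_mult_pos[of c \<xi>] by (simp add: norm_mult abs_mult mult_ac)
    qed
  qed simp
qed

lemma mult_op_add:
  assumes f: "integrable lborel f" and g: "integrable lborel g"
  shows "mult_op \<nu> c A a (\<lambda>x. f x + g x) x = mult_op \<nu> c A a f x + mult_op \<nu> c A a g x"
proof -
  have "ft lborel (\<lambda>x. x) (\<lambda>x. f x + g x) \<xi> = ft lborel (\<lambda>x. x) f \<xi> + ft lborel (\<lambda>x. x) g \<xi>" for \<xi> :: 'a
    unfolding ft_def distrib_right
    by (intro Bochner_Integration.integral_add integrable_mult_cis f g) auto
  then show ?thesis
    unfolding mult_op_def distrib_left distrib_right
    by (simp only: distrib_left distrib_right)
       (intro Bochner_Integration.integral_add integrable_mult_cis integrable_mult_op f g; simp)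
qed

lemma mult_op_measurable:
  fixes g :: "real \<Rightarrow> 'a \<Rightarrow> complex"
  assumes [measurable]: "(\<lambda>z. g (fst z) (snd z)) \<in> borel_measurable (borel \<Otimes>\<^sub>M borel)"
  shows "(\<lambda>z. mult_op \<nu> c A a (g (fst z)) (snd z)) \<in> borel_measurable (borel \<Otimes>\<^sub>M borel)"
proof -
  have [measurable]: "(\<lambda>z. ft lborel (\<lambda>x. x) (g (fst (fst z))) (snd z)) \<in> borel_measurable ((borel \<Otimes>\<^sub>M borel) \<Otimes>\<^sub>M lborel)"
    by (rule ft_lborel_measurable[OF assms]) auto
  show ?thesis unfolding mult_op_def by measurable
qed

text \<open>Up to conjugation the operator is itself a Fourier transform, so the Plancherel
  inequality is applied twice: once to return to frequency space, once to the transform of h. In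
  between the symbol is bounded pointwise.\<close>

lemma mult_op_L2:
  assumes B: "\<And>\<xi>. \<bar>poly A (gauss_mult a \<xi>)\<bar> * norm (ft \<nu> (\<lambda>x. x) (\<lambda>_. 1) \<xi>) \<le> B"
    and h: "integrable lborel h"
  shows "(\<integral>\<^sup>+x. ennreal ((norm (mult_op \<nu> c A a h x))\<^sup>2) \<partial>lborel) \<le> ennreal (B\<^sup>2) * (\<integral>\<^sup>+x. ennreal ((norm (h x))\<^sup>2) \<partial>lborel)"
proof -
  have [measurable]: "h \<in> borel_measurable borel" using borel_measurable_integrable[OF h] by simp
  have [measurable]: "ft lborel (\<lambda>x. x) h \<in> borel_measurable borel"
    by (intro ft_measurable lborel.sigma_finite_measure_axioms) auto
  define w where "w \<xi> = cnj (of_real (gauss_mult c \<xi> * poly A (gauss_mult a \<xi>)) * ft \<nu> (\<lambda>x. x) (\<lambda>_. 1) \<xi> * ft lborel (\<lambda>x. x) h \<xi>)" for \<xi>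
  have w: "integrable lborel w"
    unfolding w_def by (intro Bochner_Integration.integrable_cnj integrable_mult_op h)
  have "mult_op \<nu> c A a h x = cnj (ft lborel (\<lambda>x. x) w x)" for x
  proof -
    have "cnj (ft lborel (\<lambda>x. x) w x) = (\<integral>\<xi>. cnj (w \<xi> * cis (- (2 * pi * (\<xi> \<bullet> x)))) \<partial>lborel)"
      unfolding ft_def by (rule Bochner_Integration.integral_cnj[symmetric])
    then show ?thesis
      unfolding mult_op_def by (simp add: w_def cis_cnj inner_commute)
  qed
  then have "(\<integral>\<^sup>+x. ennreal ((norm (mult_op \<nu> c A a h x))\<^sup>2) \<partial>lborel) = (\<integral>\<^sup>+x. ennreal ((norm (ft lborel (\<lambda>x. x) w x))\<^sup>2) \<partial>lborel)"
    by simp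
  also have "\<dots> \<le> (\<integral>\<^sup>+\<xi>. ennreal ((norm (w \<xi>))\<^sup>2) \<partial>lborel)"
    by (rule Plancherel_le[OF w])
  also have "\<dots> \<le> (\<integral>\<^sup>+\<xi>. ennreal (B\<^sup>2) * ennreal ((norm (ft lborel (\<lambda>x. x) h \<xi>))\<^sup>2) \<partial>lborel)"
  proof (intro nn_integral_mono)
    fix \<xi> :: 'a
    have "gauss_mult c \<xi> * (\<bar>poly A (gauss_mult a \<xi>)\<bar> * norm (ft \<nu> (\<lambda>x. x) (\<lambda>_. 1) \<xi>)) \<le> 1 * B"
      using c gauss_mult_pos[of c \<xi>] gauss_mult_le_1[of c \<xi>] by (intro mult_mono B) auto
    then have "norm (w \<xi>) \<le> B * norm (ft lborel (\<lambda>x. x) h \<xi>)"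
      using gauss_mult_pos[of c \<xi>] unfolding w_def complex_mod_cnj
      by (simp add: norm_mult abs_mult mult_right_mono mult.assoc[symmetric] del: of_real_mult)
    then have "(norm (w \<xi>))\<^sup>2 \<le> (B * norm (ft lborel (\<lambda>x. x) h \<xi>))\<^sup>2"
      by (intro power_mono) auto
    then show "ennreal ((norm (w \<xi>))\<^sup>2) \<le> ennreal (B\<^sup>2) * ennreal ((norm (ft lborel (\<lambda>x. x) h \<xi>))\<^sup>2)"
      by (simp add: power_mult_distrib flip: ennreal_mult)
  qed
  also have "\<dots> = ennreal (B\<^sup>2) * (\<integral>\<^sup>+\<xi>. ennreal ((norm (ft lborel (\<lambda>x. x) h \<xi>))\<^sup>2) \<partial>lborel)"
    by (rule nn_integral_cmult) simp
  also have "\<dots> \<le> ennreal (B\<^sup>2) * (\<integral>\<^sup>+x. ennreal ((norm (h x))\<^sup>2) \<partial>lborel)"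
    by (intro mult_left_mono Plancherel_le h) simp
  finally show ?thesis .
qed

text \<open>The monomial of degree k in A turns the symbol into a Gaussian with parameter c + k a,
  so the operator becomes a finite combination of convolutions of h with \<nu> and probability
  densities.\<close>

lemma mult_op_L1:
  assumes h: "integrable lborel h"
  shows "(\<integral>\<^sup>+x. ennreal (norm (mult_op \<nu> c A a h x)) \<partial>lborel)
    \<le> ennreal ((\<Sum>k\<le>degree A. \<bar>coeff A k\<bar>) * measure \<nu> (space \<nu>)) * (\<integral>\<^sup>+x. ennreal (norm (h x)) \<partial>lborel)"
proof -
  note sf = nu.sigma_finite_measure_axioms lborel.sigma_finite_measure_axioms
  interpret P: pair_sigma_finite \<nu> "lborel :: 'a measure" ..
  let ?P = "\<nu> \<Otimes>\<^sub>M (lborel :: 'a measure)"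
  \<comment> \<open>The convolution of a Gaussian, \<nu> and h as one mollification on the product
    of \<nu> with Lebesgue measure. The factor 1 keeps the weight in the product shape required by
    \<open>ft_pair\<close>.\<close>
  let ?s = "\<lambda>k. smooth ?P (\<lambda>z. fst z + snd z) (\<lambda>z. 1 * h (snd z)) (c + real k * a)"
  have sfP: "sigma_finite_measure ?P" by (rule P.sigma_finite_measure_axioms)
  have [measurable]: "h \<in> borel_measurable borel" using borel_measurable_integrable[OF h] by simp
  have [measurable]: "(\<lambda>z. fst z + snd z) \<in> ?P \<rightarrow>\<^sub>M borel" by measurable
  have one: "integrable \<nu> (\<lambda>_. 1 :: complex)" by simp
  have hP: "integrable ?P (\<lambda>z. 1 * h (snd z))"
    using integrable_product[OF sf one h] by simp
  have pos: "0 < c + real k * a" for k using c a by (simp add: add_pos_nonneg)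
  have eq: "mult_op \<nu> c A a h x = (\<Sum>k\<le>degree A. of_real (coeff A k) * ?s k x)" for x
  proof -
    let ?F = "\<lambda>\<xi>. ft \<nu> (\<lambda>x. x) (\<lambda>_. 1) \<xi> * ft lborel (\<lambda>x. x) h \<xi>"
    have s: "?s k x = (\<integral>\<xi>. of_real (gauss_mult (c + real k * a) \<xi>) * ?F \<xi> * cis (2 * pi * (x \<bullet> \<xi>)) \<partial>lborel)" for k
      by (subst smooth_eq_inverse_fourier[OF pos sfP _ hP])
         (simp, subst ft_pair[OF sf _ _ one h], auto simp: mult_ac)
    have bd: "norm (?F \<xi>) \<le> (\<integral>x. norm (1::complex) \<partial>\<nu>) * (\<integral>x. norm (h x) \<partial>lborel)" for \<xi>
      unfolding norm_mult by (intro mult_mono norm_ft_le h one) auto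
    have [measurable]: "ft lborel (\<lambda>x. x) h \<in> borel_measurable borel"
      by (intro ft_measurable sf) auto
    have int: "integrable lborel (\<lambda>\<xi>. of_real (gauss_mult (c + real k * a) \<xi>) * ?F \<xi>)" for k
    proof (rule Bochner_Integration.integrable_bound[OF integrable_mult_right[OF integrable_gauss_mult[OF pos]]])
      show "AE \<xi> in lborel. norm (of_real (gauss_mult (c + real k * a) \<xi>) * ?F \<xi>)
         \<le> norm ((\<integral>x. norm (1::complex) \<partial>\<nu>) * (\<integral>x. norm (h x) \<partial>lborel) * gauss_mult (c + real k * a) \<xi>)"
      proof (rule AE_I2)
        fix \<xi> :: 'a
        have "norm (of_real (gauss_mult (c + real k * a) \<xi>) * ?F \<xi>) = norm (?F \<xi>) * gauss_mult (c + real k * a) \<xi>"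
          using gauss_mult_pos[of "c + real k * a" \<xi>] by (simp add: norm_mult)
        also have "\<dots> \<le> ((\<integral>x. norm (1::complex) \<partial>\<nu>) * (\<integral>x. norm (h x) \<partial>lborel)) * gauss_mult (c + real k * a) \<xi>"
          using gauss_mult_pos[of "c + real k * a" \<xi>] by (intro mult_right_mono bd) auto
        finally show "norm (of_real (gauss_mult (c + real k * a) \<xi>) * ?F \<xi>)
         \<le> norm ((\<integral>x. norm (1::complex) \<partial>\<nu>) * (\<integral>x. norm (h x) \<partial>lborel) * gauss_mult (c + real k * a) \<xi>)"
          by (rule order_trans) simp
      qed
    qed simp
    have "(\<Sum>k\<le>degree A. of_real (coeff A k) * ?s k x) = (\<Sum>k\<le>degree A. (\<integral>\<xi>. of_real (coeff A k) * (of_real (gauss_mult (c + real k * a) \<xi>) * ?F \<xi> * cis (2 * pi * (x \<bullet> \<xi>))) \<partial>lborel))"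
      unfolding s by simp
    also have "\<dots> = (\<integral>\<xi>. (\<Sum>k\<le>degree A. of_real (coeff A k) * (of_real (gauss_mult (c + real k * a) \<xi>) * ?F \<xi> * cis (2 * pi * (x \<bullet> \<xi>)))) \<partial>lborel)"
      by (intro Bochner_Integration.integral_sum[symmetric] integrable_mult_right integrable_mult_cis int) simp
    also have "\<dots> = mult_op \<nu> c A a h x"
      unfolding mult_op_def
    proof (intro Bochner_Integration.integral_cong refl)
      fix \<xi> :: 'a
      have eqp: "complex_of_real (gauss_mult c \<xi> * poly A (gauss_mult a \<xi>)) = (\<Sum>k\<le>degree A. of_real (coeff A k) * of_real (gauss_mult (c + real k * a) \<xi>))"
      proof -
        have "gauss_mult c \<xi> * (coeff A k * gauss_mult a \<xi> ^ k) = coeff A k * gauss_mult (c + real k * a) \<xi>" for k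
          by (simp add: gauss_mult_add gauss_mult_power)
        then show ?thesis unfolding poly_altdef sum_distrib_left by (simp only: flip: of_real_mult of_real_sum)
      qed
      show "(\<Sum>k\<le>degree A. of_real (coeff A k) * (of_real (gauss_mult (c + real k * a) \<xi>) * ?F \<xi> * cis (2 * pi * (x \<bullet> \<xi>))))
        = of_real (gauss_mult c \<xi> * poly A (gauss_mult a \<xi>)) * ft \<nu> (\<lambda>x. x) (\<lambda>_. 1) \<xi> * ft lborel (\<lambda>x. x) h \<xi> * cis (2 * pi * (x \<bullet> \<xi>))"
        unfolding eqp sum_distrib_right by (simp only: mult_ac)
    qed
    finally show ?thesis ..
  qed
  have sm: "?s k \<in> borel_measurable borel" for k
    by (intro smooth_measurable sfP) auto
  have "(\<integral>\<^sup>+x. ennreal (norm (mult_op \<nu> c A a h x)) \<partial>lborel) \<le> (\<integral>\<^sup>+x. (\<Sum>k\<le>degree A. ennreal \<bar>coeff A k\<bar> * ennreal (norm (?s k x))) \<partial>lborel)"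
  proof (intro nn_integral_mono)
    fix x
    have "norm (mult_op \<nu> c A a h x) \<le> (\<Sum>k\<le>degree A. \<bar>coeff A k\<bar> * norm (?s k x))"
      unfolding eq by (rule order_trans[OF norm_sum]) (simp add: norm_mult)
    then show "ennreal (norm (mult_op \<nu> c A a h x)) \<le> (\<Sum>k\<le>degree A. ennreal \<bar>coeff A k\<bar> * ennreal (norm (?s k x)))"
      by (subst ennreal_mult'[symmetric], simp)+ (subst sum_ennreal, auto intro: ennreal_leI)
  qed
  also have "\<dots> = (\<Sum>k\<le>degree A. ennreal \<bar>coeff A k\<bar> * (\<integral>\<^sup>+x. ennreal (norm (?s k x)) \<partial>lborel))"
    using sm by (subst nn_integral_sum) (auto simp: nn_integral_cmult)
  also have "\<dots> \<le> (\<Sum>k\<le>degree A. ennreal \<bar>coeff A k\<bar> * (\<integral>\<^sup>+z. ennreal (norm (1 * h (snd z))) \<partial>?P))"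
    by (intro sum_mono mult_left_mono nn_integral_smooth_le pos sfP) auto
  also have "(\<integral>\<^sup>+z. ennreal (norm (1 * h (snd z))) \<partial>?P) = ennreal (measure \<nu> (space \<nu>)) * (\<integral>\<^sup>+x. ennreal (norm (h x)) \<partial>lborel)"
    by (subst P.nn_integral_snd[symmetric], simp)
       (simp add: nu.emeasure_eq_measure nn_integral_multc mult.commute nn_integral_cmult)
  also have "(\<Sum>k\<le>degree A. ennreal \<bar>coeff A k\<bar> * (ennreal (measure \<nu> (space \<nu>)) * (\<integral>\<^sup>+x. ennreal (norm (h x)) \<partial>lborel)))
    = ennreal ((\<Sum>k\<le>degree A. \<bar>coeff A k\<bar>) * measure \<nu> (space \<nu>)) * (\<integral>\<^sup>+x. ennreal (norm (h x)) \<partial>lborel)"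
    by (simp add: ennreal_mult sum_nonneg sum_ennreal mult.assoc flip: sum_distrib_right)
  finally show ?thesis .
qed

lemma mult_op_Lp:
  assumes p: "1 < p" "p \<le> 2" and B: "\<And>\<xi>. \<bar>poly A (gauss_mult a \<xi>)\<bar> * norm (ft \<nu> (\<lambda>x. x) (\<lambda>_. 1) \<xi>) \<le> B" and "0 < B"
    and h: "integrable lborel h"
  shows "(\<integral>\<^sup>+x. ennreal (norm (mult_op \<nu> c A a h x) powr p) \<partial>lborel)
    \<le> ennreal ((4 * ((\<Sum>k\<le>degree A. \<bar>coeff A k\<bar>) * measure \<nu> (space \<nu>)) / (p - 1) + 8 / (2 - p) + 1) * B powr (2 * (p - 1)))
        * (\<integral>\<^sup>+x. ennreal (norm (h x) powr p) \<partial>lborel)"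
    (is "_ \<le> ennreal ((4 * ?K / _ + _ + 1) * _) * _")
proof -
  have K: "0 \<le> ?K" by (intro mult_nonneg_nonneg sum_nonneg) auto
  have "\<exists>D. D \<le> 4 * ?K / (p - 1) + 8 / (2 - p) + 1 \<and> (\<integral>\<^sup>+x. ennreal (norm (mult_op \<nu> c A a h x) powr p) \<partial>lborel)
      \<le> ennreal (D * B powr (2 * (p - 1))) * (\<integral>\<^sup>+x. ennreal (norm (h x) powr p) \<partial>lborel)"
  proof (cases "p = 2")
    \<comment> \<open>Here 8 / (2 - p) is a division by zero with value 0; the summand 1 in the
      constant provides for this endpoint, where the L^2 bound is used directly.\<close>
    case True
    then show ?thesis
      using mult_op_L2[OF B h] K \<open>0 < B\<close> by (intro exI[of _ 1]) simp
  next
    case False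
    then have p2: "p < 2" using p by simp
    have "(\<integral>\<^sup>+x. ennreal (norm (mult_op \<nu> c A a h x) powr p) \<partial>lborel)
      \<le> ennreal ((4 * ?K / (p - 1) + 8 / (2 - p)) * B powr (2 * (p - 1))) * (\<integral>\<^sup>+x. ennreal (norm (h x) powr p) \<partial>lborel)"
      by (rule Marcinkiewicz[OF p(1) p2 \<open>0 < B\<close> K mult_op_add mult_op_measurable mult_op_L1 mult_op_L2[OF B] h])
    then show ?thesis
      by (intro exI[of _ "4 * ?K / (p - 1) + 8 / (2 - p)"] conjI) simp_all
  qed
  then obtain D where D: "D \<le> 4 * ?K / (p - 1) + 8 / (2 - p) + 1" "(\<integral>\<^sup>+x. ennreal (norm (mult_op \<nu> c A a h x) powr p) \<partial>lborel)
      \<le> ennreal (D * B powr (2 * (p - 1))) * (\<integral>\<^sup>+x. ennreal (norm (h x) powr p) \<partial>lborel)" by blast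
  show ?thesis
    by (rule order_trans[OF D(2)]) (intro mult_right_mono ennreal_leI D(1), auto)
qed

end

section \<open>Energy bounds for mollified measures\<close>

text \<open>Completing the square around the midpoint of y and z, that is, the parallelogram
  law.\<close>

lemma gauss_kernel_mult:
  fixes x y z :: "'a::euclidean_space"
  assumes a: "0 < a"
  shows "gauss_kernel a (x - y) * gauss_kernel a (x - z) = gauss_kernel (a / 2) (x - (1/2) *\<^sub>R (y + z)) * gauss_kernel (2 * a) (y - z)"
proof -
  define u v where "u = x - (1/2) *\<^sub>R (y + z)" and "v = (1/2) *\<^sub>R (y - z)"
  have "y = (1/2) *\<^sub>R y + (1/2) *\<^sub>R y" "z = (1/2) *\<^sub>R z + (1/2) *\<^sub>R z" by (simp_all flip: scaleR_left.add)
  then have xy: "x - y = u - v" and xz: "x - z = u + v" and yz: "y - z = 2 *\<^sub>R v"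
    unfolding u_def v_def by (simp_all add: algebra_simps)
  have sq: "(norm (x - y))\<^sup>2 + (norm (x - z))\<^sup>2 = 2 * (norm u)\<^sup>2 + (norm (y - z))\<^sup>2 / 2"
    unfolding xy xz yz by (simp add: power2_norm_eq_inner algebra_simps inner_commute)
  have "a powr (- (real DIM('a) / 2)) * a powr (- (real DIM('a) / 2)) = (a / 2) powr (- (real DIM('a) / 2)) * (2 * a) powr (- (real DIM('a) / 2))"
    using a by (subst (1 2) powr_mult[symmetric]) (auto simp: powr_mult)
  moreover have "exp (- (pi * (norm (x - y))\<^sup>2 / a)) * exp (- (pi * (norm (x - z))\<^sup>2 / a))
      = exp (- (pi * (norm u)\<^sup>2 / (a / 2))) * exp (- (pi * (norm (y - z))\<^sup>2 / (2 * a)))"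
  proof -
    have "- (pi * (norm (x - y))\<^sup>2 / a) + - (pi * (norm (x - z))\<^sup>2 / a) = - (pi * ((norm (x - y))\<^sup>2 + (norm (x - z))\<^sup>2) / a)"
      by (simp add: distrib_left add_divide_distrib)
    also have "\<dots> = - (pi * (norm u)\<^sup>2 / (a / 2)) + - (pi * (norm (y - z))\<^sup>2 / (2 * a))"
      unfolding sq using a by (simp add: field_simps)
    finally show ?thesis unfolding exp_add[symmetric] by simp
  qed
  ultimately have "(a powr (- (real DIM('a) / 2)) * a powr (- (real DIM('a) / 2))) * (exp (- (pi * (norm (x - y))\<^sup>2 / a)) * exp (- (pi * (norm (x - z))\<^sup>2 / a)))
    = ((a / 2) powr (- (real DIM('a) / 2)) * (2 * a) powr (- (real DIM('a) / 2))) * (exp (- (pi * (norm u)\<^sup>2 / (a / 2))) * exp (- (pi * (norm (y - z))\<^sup>2 / (2 * a))))"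
    by (rule arg_cong2)
  then show ?thesis
    unfolding gauss_kernel_def u_def[symmetric] by (simp only: mult_ac)
qed

lemma nn_integral_gauss_kernel_mult:
  fixes y z :: "'a::euclidean_space"
  assumes a: "0 < a"
  shows "(\<integral>\<^sup>+x. ennreal (gauss_kernel a (x - y)) * ennreal (gauss_kernel a (x - z)) \<partial>lborel) = ennreal (gauss_kernel (2 * a) (y - z))"
proof -
  have "(\<integral>\<^sup>+x. ennreal (gauss_kernel a (x - y)) * ennreal (gauss_kernel a (x - z)) \<partial>lborel)
    = (\<integral>\<^sup>+x. ennreal (gauss_kernel (a / 2) (x - (1/2) *\<^sub>R (y + z))) * ennreal (gauss_kernel (2 * a) (y - z)) \<partial>lborel)"
    using a by (intro nn_integral_cong)
      (simp add: gauss_kernel_pos less_imp_le gauss_kernel_mult[OF a] flip: ennreal_mult)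
  also have "\<dots> = ennreal (gauss_kernel (2 * a) (y - z))"
    using a by (subst nn_integral_multc) (auto simp: nn_integral_gauss_kernel)
  finally show ?thesis .
qed

text \<open>A Gaussian decays faster than any power, and the scale factor is forced by homogeneity.
  On the diagonal the right side is infinite because t > 0.\<close>

lemma gauss_kernel_le_Riesz:
  fixes z :: "'a::euclidean_space"
  assumes a: "0 < a" and t: "0 < t"
  shows "ennreal (gauss_kernel (2 * a) z)
    \<le> ennreal ((t / pi) powr (t / 2) * a powr (- ((real DIM('a) - t) / 2))) * (1 / epow (ennreal (norm z)) t)"
proof (cases "z = 0")
  case True
  then have "epow (ennreal (norm z)) t = 0" using t by (simp add: epow_def)
  then have "(1::ennreal) / epow (ennreal (norm z)) t = \<infinity>" by simp
  then show ?thesis using a t by (simp add: ennreal_mult_top)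
next
  case False
  define d where "d = real DIM('a)"
  define y where "y = (norm z)\<^sup>2 / a"
  have y: "0 < y" using False a by (simp add: y_def)
  \<comment> \<open>With u = \<pi> y / t, the bound ln u \<le> u - 1 gives u^(t/2) \<le> exp (\<pi>
    y / 2), the domination of the power by the exponential.\<close>
  have ln: "ln (pi * y / t) \<le> pi * y / t - 1"
    using y t by (intro ln_le_minus_one) simp
  then have "t / 2 * ln (pi * y / t) \<le> t / 2 * (pi * y / t)" using t by (intro mult_left_mono) auto
  then have "t / 2 * ln (pi * y / t) \<le> pi * y / 2" using t by simp
  then have "(pi * y / t) powr (t / 2) \<le> exp (pi * y / 2)"
    using y t by (simp add: powr_def)
  then have "exp (- (pi * y / 2)) \<le> (pi * y / t) powr (- (t / 2))"
    using y t by (simp add: powr_minus exp_minus le_imp_inverse_le)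
  also have "(pi * y / t) powr (- (t / 2)) = (t / pi) powr (t / 2) * y powr (- (t / 2))"
  proof -
    have "(pi * y / t) powr (- (t / 2)) = (pi / t) powr (- (t / 2)) * y powr (- (t / 2))"
      using y t by (simp flip: powr_mult)
    also have "(pi / t) powr (- (t / 2)) = (t / pi) powr (t / 2)"
      using t by (simp add: powr_minus powr_divide)
    finally show ?thesis .
  qed
  also have "y powr (- (t / 2)) = a powr (t / 2) * norm z powr (- t)"
    using False a by (simp add: y_def powr_divide powr_minus powr_powr field_simps flip: powr_numeral)
  finally have e: "exp (- (pi * y / 2)) \<le> (t / pi) powr (t / 2) * (a powr (t / 2) * norm z powr (- t))" .
  have "gauss_kernel (2 * a) z = (2 * a) powr (- (d / 2)) * exp (- (pi * y / 2))"
    using a by (simp add: gauss_kernel_def d_def y_def field_simps)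
  also have "\<dots> \<le> a powr (- (d / 2)) * ((t / pi) powr (t / 2) * (a powr (t / 2) * norm z powr (- t)))"
    using a e by (intro mult_mono powr_mono2') (auto simp: d_def)
  also have "\<dots> = (t / pi) powr (t / 2) * (a powr (- (d / 2)) * a powr (t / 2)) * norm z powr (- t)"
    by (simp add: mult_ac)
  also have "a powr (- (d / 2)) * a powr (t / 2) = a powr (- ((d - t) / 2))"
    by (simp add: diff_divide_distrib flip: powr_add)
  finally have "gauss_kernel (2 * a) z \<le> (t / pi) powr (t / 2) * a powr (- ((d - t) / 2)) * norm z powr (- t)" .
  moreover have "1 / epow (ennreal (norm z)) t = ennreal (norm z powr (- t))"
    using False t by (simp add: epow_def powr_minus inverse_ennreal divide_ennreal_def)
  ultimately show ?thesis
    using t by (simp add: d_def ennreal_leI flip: ennreal_mult)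
qed

text \<open>A crude tangent bound for the concave power. With s the mean of x under a probability
  measure, integrating it gives Jensen's inequality up to a factor 2.\<close>

lemma powr_le_tangent:
  assumes "0 \<le> x" "0 < s" "0 < e" "e \<le> 1"
  shows "x powr e \<le> s powr e + s powr (e - 1) * (x::real)"
proof (cases "x \<le> s")
  case True
  then have "x powr e \<le> s powr e" using assms by (intro powr_mono2) auto
  then show ?thesis using assms by (simp add: add_increasing2)
next
  case False
  then have "x powr e = x * x powr (e - 1)" using assms by (simp add: powr_mult_base)
  also have "\<dots> \<le> x * s powr (e - 1)" using False assms by (intro mult_left_mono powr_mono2') auto
  finally show ?thesis using assms by (simp add: add_increasing mult.commute)
qed

lemma epow_mono_mult:
  assumes "ennreal v \<le> ennreal d * I" "0 < d" "0 \<le> v" "0 < e"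
  shows "ennreal (v powr e) \<le> ennreal (d powr e) * epow I e"
proof (cases "I = \<infinity>")
  case True
  then show ?thesis using assms by (simp add: epow_def ennreal_mult_top)
next
  case False
  define i where "i = enn2real I"
  have I: "I = ennreal i" "0 \<le> i" using False by (auto simp: i_def less_top)
  have "v \<le> d * i" using assms I by (simp add: I ennreal_le_iff flip: ennreal_mult)
  then have "v powr e \<le> (d * i) powr e" using assms by (intro powr_mono2) auto
  also have "\<dots> = d powr e * i powr e" using assms I by (simp add: powr_mult)
  finally show ?thesis using assms I by (simp add: epow_def flip: ennreal_mult)
qed

lemma norm_smooth_one:
  assumes "0 < a"
  shows "norm (smooth M \<phi> (\<lambda>_. 1) a x) = (\<integral>\<omega>. gauss_kernel a (x - \<phi> \<omega>) \<partial>M)"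
proof -
  have "smooth M \<phi> (\<lambda>_. 1) a x = of_real (\<integral>\<omega>. gauss_kernel a (x - \<phi> \<omega>) \<partial>M)"
    unfolding smooth_def by simp
  then show ?thesis
    using assms by (simp add: integral_nonneg gauss_kernel_pos less_imp_le)
qed

lemma integrable_gauss_kernel_finite:
  assumes "finite_measure M" and a: "0 < a" and [measurable]: "\<phi> \<in> M \<rightarrow>\<^sub>M borel"
  shows "integrable M (\<lambda>\<omega>. gauss_kernel a (x - \<phi> \<omega> :: 'a::euclidean_space))"
proof -
  interpret finite_measure M by fact
  show ?thesis
    using gauss_kernel_le[OF a, where 'a='a] gauss_kernel_pos[OF a, where 'a='a]
    by (intro integrable_const_bound[of _ "a powr (- (real DIM('a) / 2))"]) (auto simp: less_imp_le)
qed

lemma nn_integral_gauss_kernel_eq: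
  assumes "finite_measure M" and a: "0 < a" and [measurable]: "\<phi> \<in> M \<rightarrow>\<^sub>M borel"
  shows "(\<integral>\<^sup>+\<omega>. ennreal (gauss_kernel a (x - \<phi> \<omega> :: 'a::euclidean_space)) \<partial>M) = ennreal (\<integral>\<omega>. gauss_kernel a (x - \<phi> \<omega>) \<partial>M)"
  using gauss_kernel_pos[OF a, where 'a='a]
  by (intro nn_integral_eq_integral integrable_gauss_kernel_finite assms) (auto simp: less_imp_le)

text \<open>Strict positivity is wanted because these values serve as the base points at which power
  inequalities are applied.\<close>

lemma integral_gauss_kernel_pos:
  assumes fin: "finite_measure M" and a: "0 < a" and [measurable]: "\<phi> \<in> M \<rightarrow>\<^sub>M borel" and nz: "emeasure M (space M) \<noteq> 0"
  shows "0 < (\<integral>\<omega>. gauss_kernel a (x - \<phi> \<omega> :: 'a::euclidean_space) \<partial>M)"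
proof -
  have "(\<integral>\<^sup>+\<omega>. ennreal (gauss_kernel a (x - \<phi> \<omega>)) \<partial>M) \<noteq> 0"
  proof
    assume "(\<integral>\<^sup>+\<omega>. ennreal (gauss_kernel a (x - \<phi> \<omega>)) \<partial>M) = 0"
    then have "AE \<omega> in M. False"
      using gauss_kernel_pos[OF a, where 'a='a] by (subst (asm) nn_integral_0_iff_AE) (auto simp: ennreal_eq_0_iff not_le[symmetric])
    then show False using nz by (simp add: eventually_False ae_filter_eq_bot_iff)
  qed
  then show ?thesis unfolding nn_integral_gauss_kernel_eq[OF assms(1-3)] by (simp add: ennreal_eq_0_iff not_le)
qed

text \<open>In the p-th power of the mollification m one factor is unfolded into an integral over
  \<mu>. What remains is the Gaussian average of m^(p-1) around each y, and p - 1 \<le> 1 allows the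
  average to be moved inside the power. The averaged function is a Gaussian potential of \<mu> at
  scale 2 a, which is dominated by the Riesz potential.\<close>

lemma smooth_energy_bound:
  fixes \<mu> :: "'a::euclidean_space measure"
  assumes sets [measurable_cong]: "sets \<mu> = sets borel" and fin: "finite_measure \<mu>" and nz: "emeasure \<mu> (space \<mu>) \<noteq> 0"
    and p: "1 < p" "p \<le> 2" and t: "0 < t" and a: "0 < a"
  shows "(\<integral>\<^sup>+x. ennreal (norm (smooth \<mu> (\<lambda>x. x) (\<lambda>_. 1) a x) powr p) \<partial>lborel)
     \<le> ennreal (2 * ((t / pi) powr (t / 2) * a powr (- ((real DIM('a) - t) / 2))) powr (p - 1))
       * (\<integral>\<^sup>+x. epow (\<integral>\<^sup>+y. 1 / epow (ennreal (norm (x - y))) t \<partial>\<mu>) (p - 1) \<partial>\<mu>)"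
proof -
  interpret finite_measure \<mu> by fact
  interpret pair_sigma_finite \<mu> "lborel :: 'a measure" ..
  interpret P: pair_sigma_finite \<mu> \<mu> ..
  have [measurable]: "(\<lambda>x. x) \<in> \<mu> \<rightarrow>\<^sub>M borel" using measurable_ident_sets[OF sets] .
  define m where "m x = (\<integral>y. gauss_kernel a (x - y) \<partial>\<mu>)" for x
  define v where "v x = (\<integral>y. gauss_kernel (2 * a) (x - y) \<partial>\<mu>)" for x
  define D where "D = (t / pi) powr (t / 2) * a powr (- ((real DIM('a) - t) / 2))"
  let ?I = "\<lambda>x. \<integral>\<^sup>+y. 1 / epow (ennreal (norm (x - y))) t \<partial>\<mu>"
  have D: "0 < D" using t a by (simp add: D_def)
  have m: "0 < m x" for x unfolding m_def by (rule integral_gauss_kernel_pos[OF fin a _ nz]) simp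
  have v: "0 < v x" for x unfolding v_def using a by (intro integral_gauss_kernel_pos[OF fin _ _ nz]) simp_all
  have m_nn: "(\<integral>\<^sup>+y. ennreal (gauss_kernel a (x - y)) \<partial>\<mu>) = ennreal (m x)" for x
    unfolding m_def by (rule nn_integral_gauss_kernel_eq[OF fin a]) simp
  have v_nn: "(\<integral>\<^sup>+y. ennreal (gauss_kernel (2 * a) (x - y)) \<partial>\<mu>) = ennreal (v x)" for x
    unfolding v_def using a by (intro nn_integral_gauss_kernel_eq[OF fin]) simp_all
  have m_meas [measurable]: "m \<in> borel_measurable borel" unfolding m_def by measurable
  have conv: "(\<integral>\<^sup>+x. ennreal (gauss_kernel a (x - y)) * ennreal (m x) \<partial>lborel) = ennreal (v y)" for y
  proof -
    have "(\<integral>\<^sup>+x. ennreal (gauss_kernel a (x - y)) * ennreal (m x) \<partial>lborel)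
      = (\<integral>\<^sup>+x. (\<integral>\<^sup>+z. ennreal (gauss_kernel a (x - y)) * ennreal (gauss_kernel a (x - z)) \<partial>\<mu>) \<partial>lborel)"
      by (simp add: nn_integral_cmult flip: m_nn)
    also have "\<dots> = (\<integral>\<^sup>+z. (\<integral>\<^sup>+x. ennreal (gauss_kernel a (x - y)) * ennreal (gauss_kernel a (x - z)) \<partial>lborel) \<partial>\<mu>)"
      by (rule Fubini') simp
    also have "\<dots> = ennreal (v y)" by (simp add: nn_integral_gauss_kernel_mult[OF a] v_nn)
    finally show ?thesis .
  qed
  \<comment> \<open>Jensen for the concave power p - 1 and the probability density x ->
    \<open>gauss_kernel a (x - y)\<close>: by \<open>conv\<close> the mean of m is v y, so the
    tangent is taken there.\<close>
  have inner: "(\<integral>\<^sup>+x. ennreal (gauss_kernel a (x - y)) * ennreal (m x powr (p - 1)) \<partial>lborel) \<le> ennreal (2 * v y powr (p - 1))" for y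
  proof -
    have "(\<integral>\<^sup>+x. ennreal (gauss_kernel a (x - y)) * ennreal (m x powr (p - 1)) \<partial>lborel)
      \<le> (\<integral>\<^sup>+x. ennreal (v y powr (p - 1)) * ennreal (gauss_kernel a (x - y)) + ennreal (v y powr (p - 1 - 1)) * (ennreal (gauss_kernel a (x - y)) * ennreal (m x)) \<partial>lborel)"
    proof (intro nn_integral_mono)
      fix x
      have "m x powr (p - 1) \<le> v y powr (p - 1) + v y powr (p - 1 - 1) * m x"
        using m[of x] v[of y] p by (intro powr_le_tangent) auto
      then have "ennreal (gauss_kernel a (x - y)) * ennreal (m x powr (p - 1)) \<le> ennreal (gauss_kernel a (x - y)) * ennreal (v y powr (p - 1) + v y powr (p - 1 - 1) * m x)"
        by (intro mult_left_mono ennreal_leI) auto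
      also have "\<dots> = ennreal (v y powr (p - 1)) * ennreal (gauss_kernel a (x - y)) + ennreal (v y powr (p - 1 - 1)) * (ennreal (gauss_kernel a (x - y)) * ennreal (m x))"
        using m[of x] by (simp add: ennreal_plus ennreal_mult distrib_left mult_ac less_imp_le)
      finally show "ennreal (gauss_kernel a (x - y)) * ennreal (m x powr (p - 1)) \<le> \<dots>" .
    qed
    also have "\<dots> = ennreal (v y powr (p - 1)) + ennreal (v y powr (p - 1 - 1)) * ennreal (v y)"
      by (simp add: nn_integral_add nn_integral_cmult conv nn_integral_gauss_kernel[OF a])
    also have "\<dots> = ennreal (2 * v y powr (p - 1))"
    proof -
      have "v y powr (p - 1 - 1) * v y = v y powr (p - 1)" using v[of y] by (simp add: powr_mult_base mult.commute)
      then show ?thesis using v[of y] by (simp add: less_imp_le flip: ennreal_mult ennreal_plus)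
    qed
    finally show ?thesis .
  qed
  have "(\<integral>\<^sup>+x. ennreal (norm (smooth \<mu> (\<lambda>x. x) (\<lambda>_. 1) a x) powr p) \<partial>lborel) = (\<integral>\<^sup>+x. (\<integral>\<^sup>+y. ennreal (gauss_kernel a (x - y)) * ennreal (m x powr (p - 1)) \<partial>\<mu>) \<partial>lborel)"
  proof (intro nn_integral_cong)
    fix x
    have "m x powr p = m x * m x powr (p - 1)" using m[of x] by (simp add: powr_mult_base)
    then show "ennreal (norm (smooth \<mu> (\<lambda>x. x) (\<lambda>_. 1) a x) powr p) = (\<integral>\<^sup>+y. ennreal (gauss_kernel a (x - y)) * ennreal (m x powr (p - 1)) \<partial>\<mu>)"
      using m[of x] by (simp add: norm_smooth_one[OF a] m_def[symmetric] nn_integral_multc m_nn ennreal_mult less_imp_le)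
  qed
  also have "\<dots> = (\<integral>\<^sup>+y. (\<integral>\<^sup>+x. ennreal (gauss_kernel a (x - y)) * ennreal (m x powr (p - 1)) \<partial>lborel) \<partial>\<mu>)"
    by (rule Fubini') simp
  also have "\<dots> \<le> (\<integral>\<^sup>+y. ennreal (2 * D powr (p - 1)) * epow (?I y) (p - 1) \<partial>\<mu>)"
  proof (intro nn_integral_mono order_trans[OF inner])
    fix y
    have "ennreal (v y) \<le> (\<integral>\<^sup>+z. ennreal D * (1 / epow (ennreal (norm (y - z))) t) \<partial>\<mu>)"
      unfolding v_nn[symmetric] D_def by (intro nn_integral_mono gauss_kernel_le_Riesz a t)
    also have "\<dots> = ennreal D * ?I y"
      by (rule nn_integral_cmult) (simp add: epow_def)
    finally have "ennreal (v y powr (p - 1)) \<le> ennreal (D powr (p - 1)) * epow (?I y) (p - 1)"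
      using v[of y] D p by (intro epow_mono_mult) auto
    then have "ennreal 2 * ennreal (v y powr (p - 1)) \<le> ennreal 2 * (ennreal (D powr (p - 1)) * epow (?I y) (p - 1))"
      by (rule mult_left_mono) simp
    then show "ennreal (2 * v y powr (p - 1)) \<le> ennreal (2 * D powr (p - 1)) * epow (?I y) (p - 1)"
      by (simp only: ennreal_mult'' powr_ge_zero mult.assoc)
  qed
  also have "\<dots> = ennreal (2 * D powr (p - 1)) * (\<integral>\<^sup>+y. epow (?I y) (p - 1) \<partial>\<mu>)"
  proof (rule nn_integral_cmult)
    have [measurable]: "(\<lambda>x. epow x e) \<in> borel_measurable borel" for e
      unfolding epow_def by measurable
    show "(\<lambda>y. epow (?I y) (p - 1)) \<in> borel_measurable \<mu>" by measurable
  qed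
  finally show ?thesis by (simp add: D_def)
qed

section \<open>The mollified convolution of the two measures\<close>

text \<open>Every term satisfies y_i \<le> \<tau>^i m^(1/p), where m is the weighted sum and \<tau>
  = \<kappa>^(1/p), and the geometric series does the rest. The bound is pointwise and thus
  integrates term by term, taking the place of the triangle inequality in L^p.\<close>

lemma sum_powr_le_weighted:
  fixes y :: "nat \<Rightarrow> real"
  assumes \<kappa>: "0 < \<kappa>" "\<kappa> < 1" and p: "0 < p" and y: "\<And>i. 0 \<le> y i"
  shows "(\<Sum>i<n. y i) powr p \<le> (1 / (1 - \<kappa> powr (1 / p))) powr p * (\<Sum>i<n. y i powr p / \<kappa> ^ i)"
proof -
  define \<tau> where "\<tau> = \<kappa> powr (1 / p)"
  define m where "m = (\<Sum>i<n. y i powr p / \<kappa> ^ i)"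
  have \<tau>: "0 < \<tau>" "\<tau> < 1" using \<kappa> p powr_less_mono2[of "1/p" \<kappa> 1] by (auto simp: \<tau>_def)
  have m: "0 \<le> m" using \<kappa> unfolding m_def by (intro sum_nonneg) auto
  have le: "y i \<le> \<tau> ^ i * m powr (1 / p)" if "i < n" for i
  proof -
    have "y i powr p / \<kappa> ^ i \<le> m"
      unfolding m_def using that \<kappa> by (intro member_le_sum) auto
    then have "y i powr p \<le> \<kappa> ^ i * m" using \<kappa> by (simp add: field_simps)
    then have "(y i powr p) powr (1 / p) \<le> (\<kappa> ^ i * m) powr (1 / p)"
      using p by (intro powr_mono2) auto
    also have "(\<kappa> ^ i * m) powr (1 / p) = \<tau> ^ i * m powr (1 / p)"
      using \<kappa> m by (simp add: powr_mult \<tau>_def powr_powr mult.commute flip: powr_realpow)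
    finally show ?thesis using p y[of i] by (simp add: powr_powr)
  qed
  have "(\<Sum>i<n. y i) \<le> (\<Sum>i<n. \<tau> ^ i) * m powr (1 / p)"
    unfolding sum_distrib_right by (intro sum_mono le) auto
  also have "(\<Sum>i<n. \<tau> ^ i) \<le> 1 / (1 - \<tau>)"
    using \<tau> by (simp add: sum_gp_strict divide_right_mono)
  finally have "(\<Sum>i<n. y i) \<le> 1 / (1 - \<tau>) * m powr (1 / p)" by (simp add: mult_right_mono)
  then have "(\<Sum>i<n. y i) powr p \<le> (1 / (1 - \<tau>) * m powr (1 / p)) powr p"
    using p y by (intro powr_mono2 sum_nonneg) auto
  also have "\<dots> = (1 / (1 - \<tau>)) powr p * m"
    using p m \<tau> by (subst powr_mult) (auto simp: powr_powr)
  finally show ?thesis by (simp add: \<tau>_def m_def)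
qed

lemma poly_factor_X:
  fixes Q :: "real poly"
  assumes "poly Q 0 = 0"
  shows "\<exists>A. \<forall>s. poly Q s = s * poly A s"
  using assms by (cases Q) auto

text \<open>The number u = 1 - P lies in [0, 1] and is at most \<pi> a |\<xi>|^2. Hence u^N \<le>
  u^(\<sigma>/4) yields the factor a^(\<sigma>/4) |\<xi>|^(\<sigma>/2), and the decay of w absorbs
  the power of |\<xi>|.\<close>

lemma one_minus_gauss_mult_decay:
  fixes \<xi> :: "'a::euclidean_space" and w :: complex
  assumes a: "0 < a" and \<sigma>: "0 < \<sigma>" "\<sigma> / 4 \<le> real N" and M: "(norm w)\<^sup>2 * norm \<xi> powr \<sigma> \<le> M"
  shows "(1 - gauss_mult a \<xi>) ^ N * norm w \<le> pi powr (\<sigma> / 4) * sqrt M * a powr (\<sigma> / 4)"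
proof (cases "\<xi> = 0")
  case True
  have "0 \<le> M" using M by (rule order_trans[rotated]) simp
  moreover have "0 < N" using \<sigma> by (cases N) auto
  ultimately show ?thesis using True by (simp add: gauss_mult_def zero_power)
next
  case False
  define u where "u = 1 - gauss_mult a \<xi>"
  have g: "gauss_mult a \<xi> < 1" using False a by (simp add: gauss_mult_def)
  have u: "0 < u" "u \<le> 1" using g gauss_mult_pos[of a \<xi>] by (auto simp: u_def)
  have "u \<le> pi * a * (norm \<xi>)\<^sup>2"
    using exp_ge_add_one_self[of "- (pi * a * (norm \<xi>)\<^sup>2)"] by (simp add: u_def gauss_mult_def)
  then have "u powr (\<sigma> / 4) \<le> (pi * a * (norm \<xi>)\<^sup>2) powr (\<sigma> / 4)"
    using u \<sigma> by (intro powr_mono2) auto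
  also have "\<dots> = pi powr (\<sigma> / 4) * a powr (\<sigma> / 4) * norm \<xi> powr (\<sigma> / 2)"
    using a False by (simp add: powr_mult powr_powr flip: powr_numeral)
  finally have u1: "u powr (\<sigma> / 4) \<le> pi powr (\<sigma> / 4) * a powr (\<sigma> / 4) * norm \<xi> powr (\<sigma> / 2)" .
  have "u ^ N = u powr real N" using u by (simp add: powr_realpow)
  also have "\<dots> \<le> u powr (\<sigma> / 4)" using u \<sigma> by (intro powr_mono') auto
  finally have u2: "u ^ N \<le> pi powr (\<sigma> / 4) * a powr (\<sigma> / 4) * norm \<xi> powr (\<sigma> / 2)" using u1 by simp
  have "(norm w * norm \<xi> powr (\<sigma> / 2))\<^sup>2 \<le> M"
    using M False by (simp add: power_mult_distrib powr_power)
  then have w: "norm \<xi> powr (\<sigma> / 2) * norm w \<le> sqrt M"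
    by (intro real_le_rsqrt) (simp add: mult.commute)
  have "u ^ N * norm w \<le> (pi powr (\<sigma> / 4) * a powr (\<sigma> / 4)) * (norm \<xi> powr (\<sigma> / 2) * norm w)"
    using mult_right_mono[OF u2, of "norm w"] by (simp add: mult_ac)
  also have "\<dots> \<le> (pi powr (\<sigma> / 4) * a powr (\<sigma> / 4)) * sqrt M"
    by (intro mult_left_mono w) auto
  finally show ?thesis by (simp add: u_def mult_ac)
qed

lemma mult_op_smooth_bound:
  fixes \<mu> \<nu> :: "'a::euclidean_space measure"
  assumes sets: "sets \<mu> = sets borel" "sets \<nu> = sets borel" and fin: "finite_measure \<mu>" "finite_measure \<nu>"
    and nz: "emeasure \<mu> (space \<mu>) \<noteq> 0"
    and p: "1 < p" "p \<le> 2" and t: "0 < t" and a: "0 < a" and c: "0 < c"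
    and E: "(\<integral>\<^sup>+x. epow (\<integral>\<^sup>+y. 1 / epow (ennreal (norm (x - y))) t \<partial>\<mu>) (p - 1) \<partial>\<mu>) \<le> ennreal E" "0 \<le> E"
    and B: "\<And>\<xi>. \<bar>poly A (gauss_mult a \<xi>)\<bar> * norm (ft \<nu> (\<lambda>x. x) (\<lambda>_. 1) \<xi>) \<le> B" "0 < B"
  shows "(\<integral>\<^sup>+x. ennreal (norm (mult_op \<nu> c A a (smooth \<mu> (\<lambda>x. x) (\<lambda>_. 1) a) x) powr p) \<partial>lborel)
    \<le> ennreal ((4 * ((\<Sum>k\<le>degree A. \<bar>coeff A k\<bar>) * measure \<nu> (space \<nu>)) / (p - 1) + 8 / (2 - p) + 1)
         * B powr (2 * (p - 1)) * (2 * ((t / pi) powr (t / 2) * a powr (- ((real DIM('a) - t) / 2))) powr (p - 1)) * E)"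
proof -
  interpret mu: finite_measure \<mu> by fact
  let ?K = "4 * ((\<Sum>k\<le>degree A. \<bar>coeff A k\<bar>) * measure \<nu> (space \<nu>)) / (p - 1) + 8 / (2 - p) + 1"
  have K: "0 \<le> ?K" using p by (intro add_nonneg_nonneg divide_nonneg_nonneg mult_nonneg_nonneg sum_nonneg) auto
  have h: "integrable lborel (smooth \<mu> (\<lambda>x. x) (\<lambda>_. 1) a)"
    by (intro integrable_smooth a mu.sigma_finite_measure_axioms measurable_ident_sets sets) auto
  have "(\<integral>\<^sup>+x. ennreal (norm (mult_op \<nu> c A a (smooth \<mu> (\<lambda>x. x) (\<lambda>_. 1) a) x) powr p) \<partial>lborel)
    \<le> ennreal (?K * B powr (2 * (p - 1))) * (\<integral>\<^sup>+x. ennreal (norm (smooth \<mu> (\<lambda>x. x) (\<lambda>_. 1) a x) powr p) \<partial>lborel)"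
    by (rule mult_op_Lp[OF sets(2) fin(2) c a p B h])
  also have "\<dots> \<le> ennreal (?K * B powr (2 * (p - 1))) * (ennreal (2 * ((t / pi) powr (t / 2) * a powr (- ((real DIM('a) - t) / 2))) powr (p - 1)) * ennreal E)"
    by (intro mult_left_mono order_trans[OF smooth_energy_bound[OF sets(1) fin(1) nz p t a]] E(1)) auto
  also have "\<dots> = ennreal (?K * B powr (2 * (p - 1)) * (2 * ((t / pi) powr (t / 2) * a powr (- ((real DIM('a) - t) / 2))) powr (p - 1)) * E)"
    using K E(2) by (simp only: ennreal_mult'' ennreal_mult' mult_nonneg_nonneg powr_ge_zero zero_le_numeral mult.assoc)
  finally show ?thesis .
qed

text \<open>Littlewood--Paley decomposition with Gaussians: with \<open>P\<^sub>j = exp (- \<pi> 2\<^sup>-\<^sup>j |\<xi>|\<^sup>2)\<close> and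
  \<open>Q\<^sub>j = 1 - (1 - P\<^sub>j)\<^sup>N\<close> one has \<open>1 = Q\<^sub>0 + (\<Sum>j<J. Q\<^sub>j\<^sub>+\<^sub>1 - Q\<^sub>j) + (1 - P\<^sub>J)\<^sup>N\<close>. Since \<open>P\<^sub>j\<close> is the square of
  \<open>P\<^sub>j\<^sub>+\<^sub>1\<close>, each piece is a fixed polynomial in \<open>P\<^sub>j\<^sub>+\<^sub>1\<close>; it vanishes to order \<open>N\<close> at the frequency
  \<open>0\<close>, which is what lets the decay of the transform of \<open>\<nu>\<close> be exploited when it is fast.\<close>
lemma gauss_telescope:
  fixes \<xi> :: "'a::euclidean_space"
  assumes A0: "\<And>s. 1 - (1 - s) ^ N = s * poly A0 s" and R: "\<And>s. (1 + s) ^ N - 1 = s * poly R s"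
  shows "(\<Sum>i<J + 2. gauss_mult (if i \<le> J then 2 * (1/2) ^ J else (1/2) ^ J) \<xi>
       * poly (if i = 0 then A0 else if i \<le> J then [:1, -1:] ^ N * R else [:1, -1:] ^ N) (gauss_mult (if i \<le> J then (1/2) ^ i else (1/2) ^ J) \<xi>)
       * gauss_mult (if i \<le> J then (1/2) ^ i else (1/2) ^ J) \<xi>) = gauss_mult (2 * (1/2) ^ J) \<xi>"
    (is "(\<Sum>i<J + 2. ?T i) = ?G")
proof -
  define P where "P j = gauss_mult ((1/2) ^ j) \<xi>" for j :: nat
  have P: "P j = (P (Suc j))\<^sup>2" for j by (simp add: P_def gauss_mult_power)
  have G: "?G = (P J)\<^sup>2" by (simp add: P_def gauss_mult_power)
  \<comment> \<open>With s = P_{k+1} one has 1 - P_k = (1 - s)(1 + s). So Q_{k+1} - Q_k is (1 - s)^N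
    times (1 + s)^N - 1, and the second factor supplies the s that mollifies \<mu>.\<close>
  have A1: "P (Suc k) * poly ([:1, -1:] ^ N * R) (P (Suc k)) = (1 - P k) ^ N - (1 - P (Suc k)) ^ N" for k
  proof -
    let ?s = "P (Suc k)"
    have "?s * poly ([:1, -1:] ^ N * R) ?s = (1 - ?s) ^ N * ((1 + ?s) ^ N - 1)"
      unfolding R by (simp add: mult_ac)
    also have "\<dots> = ((1 - ?s) * (1 + ?s)) ^ N - (1 - ?s) ^ N"
      by (simp add: power_mult_distrib right_diff_distrib)
    also have "(1 - ?s) * (1 + ?s) = 1 - P k" unfolding P[of k] by (simp add: algebra_simps power2_eq_square)
    finally show ?thesis .
  qed
  have "(\<Sum>i<Suc k. ?T i) = ?G * (1 - (1 - P k) ^ N)" if "k \<le> J" for k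
    using that
  proof (induction k)
    case 0
    then show ?case by (simp add: A0 P_def mult_ac)
  next
    case (Suc k)
    have "?T (Suc k) = ?G * (P (Suc k) * poly ([:1, -1:] ^ N * R) (P (Suc k)))"
      using Suc.prems by (simp add: P_def mult_ac)
    then show ?case
      unfolding sum.lessThan_Suc[of _ "Suc k"] A1 using Suc by (simp add: algebra_simps)
  qed
  then have "(\<Sum>i<Suc J. ?T i) = ?G * (1 - (1 - P J) ^ N)" by simp
  \<comment> \<open>The remainder (1 - P_J)^N is not divisible by P_J. This is why the whole
    identity is multiplied by P_J^2: one copy of P_J mollifies \<mu> and the other remains as
    convergence factor, whence the different parameter in the last piece.\<close>
  moreover have "?T (Suc J) = ?G * (1 - P J) ^ N"
    unfolding G by (simp add: P_def power2_eq_square)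
  ultimately show ?thesis by (simp add: algebra_simps)
qed

lemma smooth_pair_Lp_bounded:
  fixes \<mu> \<nu> :: "'a::euclidean_space measure"
  assumes sets: "sets \<mu> = sets borel" "sets \<nu> = sets borel" and fin: "finite_measure \<mu>" "finite_measure \<nu>"
    and nz: "emeasure \<mu> (space \<mu>) \<noteq> 0"
    and p: "1 < p" "p \<le> 2" and t: "0 < t" and \<sigma>: "0 < \<sigma>" "real DIM('a) < \<sigma> + t"
    and E: "(\<integral>\<^sup>+x. epow (\<integral>\<^sup>+y. 1 / epow (ennreal (norm (x - y))) t \<partial>\<mu>) (p - 1) \<partial>\<mu>) < \<infinity>"
    and M: "\<And>\<xi>. (norm (ft \<nu> (\<lambda>x. x) (\<lambda>_. 1) \<xi>))\<^sup>2 * norm \<xi> powr \<sigma> \<le> M"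
  shows "\<exists>C. \<forall>J. (\<integral>\<^sup>+x. ennreal (norm (smooth (\<mu> \<Otimes>\<^sub>M \<nu>) (\<lambda>z. fst z + snd z) (\<lambda>_. 1) (2 * (1/2) ^ J) x) powr p) \<partial>lborel) \<le> ennreal C"
proof -
  interpret mu: finite_measure \<mu> by fact
  interpret nu: finite_measure \<nu> by fact
  interpret P: pair_sigma_finite \<mu> \<nu> ..
  note sfl = lborel.sigma_finite_measure_axioms
  have sfP: "sigma_finite_measure (\<mu> \<Otimes>\<^sub>M \<nu>)" by (rule P.sigma_finite_measure_axioms)
  have [measurable]: "(\<lambda>x. x) \<in> \<mu> \<rightarrow>\<^sub>M borel" "(\<lambda>x. x) \<in> \<nu> \<rightarrow>\<^sub>M borel"
    using measurable_ident_sets sets by auto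
  note [measurable_cong] = sets
  have finP: "finite_measure (\<mu> \<Otimes>\<^sub>M \<nu>)"
    by (rule finite_measure_pair_measure) fact+
  define d where "d = real DIM('a)"
  obtain e where e: "(\<integral>\<^sup>+x. epow (\<integral>\<^sup>+y. 1 / epow (ennreal (norm (x - y))) t \<partial>\<mu>) (p - 1) \<partial>\<mu>) \<le> ennreal e" "0 \<le> e"
    using E by (cases "\<integral>\<^sup>+x. epow (\<integral>\<^sup>+y. 1 / epow (ennreal (norm (x - y))) t \<partial>\<mu>) (p - 1) \<partial>\<mu>" rule: ennreal_cases) auto
  define V where "V = (\<integral>x. norm (1::complex) \<partial>\<nu>)"
  have V: "norm (ft \<nu> (\<lambda>x. x) (\<lambda>_. 1) \<xi>) \<le> V" for \<xi> :: 'a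
    unfolding V_def by (rule norm_ft_le) simp
  have V0: "0 \<le> V" unfolding V_def by simp
  obtain N where N: "\<sigma> / 4 \<le> real N" using real_arch_simple by blast
  have "\<exists>A. \<forall>s::real. poly (1 - [:1, -1:] ^ N) s = s * poly A s"
    by (rule poly_factor_X) (simp add: poly_power)
  then obtain A0 where "\<forall>s::real. poly (1 - [:1, -1:] ^ N) s = s * poly A0 s" by blast
  then have A0: "\<And>s. 1 - (1 - s) ^ N = s * poly A0 s" by (simp add: poly_power)
  have "\<exists>A. \<forall>s::real. poly ([:1, 1:] ^ N - 1) s = s * poly A s"
    by (rule poly_factor_X) (simp add: poly_power)
  then obtain R where "\<forall>s::real. poly ([:1, 1:] ^ N - 1) s = s * poly R s" by blast
  then have R: "\<And>s. (1 + s) ^ N - 1 = s * poly R s" by (simp add: poly_power)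
  define S where "S A = (\<Sum>k\<le>degree A. \<bar>coeff A k\<bar>)" for A :: "real poly"
  have S0: "0 \<le> S A" for A unfolding S_def by (intro sum_nonneg) auto
  have SA: "\<bar>poly A (gauss_mult a \<xi>)\<bar> \<le> S A" if "0 < a" for A a and \<xi> :: 'a
    unfolding S_def using that gauss_mult_pos[of a \<xi>] gauss_mult_le_1[of a \<xi>] by (intro norm_poly_le) auto
  \<comment> \<open>The symbols of the differences and of the remainder. Both contain (1 - s)^N, the
    factor through which Fourier decay enters.\<close>
  define A1 A2 where "A1 = [:1, -1:] ^ N * R" and "A2 = ([:1, -1:] ^ N :: real poly)"
  \<comment> \<open>Makes b a^(\<sigma>/4) a bound for both symbols times the transform of \<nu>: S
    R + 1 dominates the cofactors R and 1. The added units keep b positive.\<close>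
  define b where "b = (S R + 1) * (pi powr (\<sigma> / 4) * sqrt (\<bar>M\<bar> + 1))"
  have b: "0 < b" unfolding b_def using S0[of R] by (intro mult_pos_pos) auto
  \<comment> \<open>The net power of the scale: \<sigma> (p - 1) / 2 gained from the L^2 norm, minus
    (d - t)(p - 1) / 2 lost in the mollification of \<mu>.\<close>
  define \<delta> where "\<delta> = (p - 1) * (\<sigma> + t - d) / 2"
  have \<delta>: "0 < \<delta>" using p \<sigma> by (simp add: \<delta>_def d_def)
  define K where "K A = 4 * (S A * measure \<nu> (space \<nu>)) / (p - 1) + 8 / (2 - p) + 1" for A
  have K: "0 \<le> K A" for A unfolding K_def using p S0[of A]
    by (intro add_nonneg_nonneg divide_nonneg_nonneg mult_nonneg_nonneg) auto
  define Y where "Y c A a = mult_op \<nu> c A a (smooth \<mu> (\<lambda>x. x) (\<lambda>_. 1) a)" for c A a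
  define L where "L A = K A * b powr (2 * (p - 1)) * (2 * ((t / pi) powr (t / 2)) powr (p - 1)) * e" for A
  have L: "0 \<le> L A" for A unfolding L_def using K[of A] e by (intro mult_nonneg_nonneg) auto
  have decay: "(1 - gauss_mult a \<xi>) ^ N * norm (ft \<nu> (\<lambda>x. x) (\<lambda>_. 1) \<xi>) \<le> pi powr (\<sigma> / 4) * sqrt (\<bar>M\<bar> + 1) * a powr (\<sigma> / 4)"
    if "0 < a" for a and \<xi> :: 'a
    using M[of \<xi>] by (intro one_minus_gauss_mult_decay that \<sigma> N) auto
  have piece: "(\<integral>\<^sup>+x. ennreal (norm (Y c A a x) powr p) \<partial>lborel) \<le> ennreal (L A * a powr \<delta>)"
    if a: "0 < a" and c: "0 < c" and A: "A = A1 \<or> A = A2" for a c A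
  proof -
    have B: "\<bar>poly A (gauss_mult a \<xi>)\<bar> * norm (ft \<nu> (\<lambda>x. x) (\<lambda>_. 1) \<xi>) \<le> b * a powr (\<sigma> / 4)" for \<xi> :: 'a
    proof -
      let ?u = "(1 - gauss_mult a \<xi>) ^ N"
      have u: "0 \<le> ?u" using gauss_mult_le_1[of a \<xi>] a by auto
      have "\<bar>poly A (gauss_mult a \<xi>)\<bar> \<le> (S R + 1) * ?u"
      proof -
        have "\<bar>poly A (gauss_mult a \<xi>)\<bar> = (if A = A2 then 1 else \<bar>poly R (gauss_mult a \<xi>)\<bar>) * ?u"
          using A u by (auto simp: A1_def A2_def abs_mult poly_power)
        also have "\<dots> \<le> (S R + 1) * ?u"
          using SA[OF a, of R \<xi>] S0[of R] by (intro mult_right_mono u) auto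
        finally show ?thesis .
      qed
      then have "\<bar>poly A (gauss_mult a \<xi>)\<bar> * norm (ft \<nu> (\<lambda>x. x) (\<lambda>_. 1) \<xi>) \<le> (S R + 1) * (?u * norm (ft \<nu> (\<lambda>x. x) (\<lambda>_. 1) \<xi>))"
        unfolding mult.assoc[symmetric] by (rule mult_right_mono) simp
      also have "\<dots> \<le> (S R + 1) * (pi powr (\<sigma> / 4) * sqrt (\<bar>M\<bar> + 1) * a powr (\<sigma> / 4))"
        using S0[of R] by (intro mult_left_mono decay a) auto
      finally show ?thesis by (simp add: b_def mult_ac)
    qed
    have Bp: "0 < b * a powr (\<sigma> / 4)" using a b by simp
    have "(b * a powr (\<sigma> / 4)) powr (2 * (p - 1)) = b powr (2 * (p - 1)) * a powr (\<sigma> * (p - 1) / 2)"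
      using a b by (subst powr_mult) (auto simp: powr_powr intro: arg_cong2[where f="(powr)"])
    moreover have "((t / pi) powr (t / 2) * a powr (- ((d - t) / 2))) powr (p - 1) = ((t / pi) powr (t / 2)) powr (p - 1) * a powr (- ((d - t) / 2) * (p - 1))"
      using a by (simp add: powr_mult powr_powr)
    moreover have "a powr (\<sigma> * (p - 1) / 2) * a powr (- ((d - t) / 2) * (p - 1)) = a powr \<delta>"
    proof -
      have "\<sigma> * (p - 1) / 2 + - ((d - t) / 2) * (p - 1) = \<delta>" by (simp add: \<delta>_def field_simps)
      then show ?thesis by (simp only: powr_add[symmetric])
    qed
    ultimately have "K A * (b * a powr (\<sigma> / 4)) powr (2 * (p - 1)) * (2 * ((t / pi) powr (t / 2) * a powr (- ((d - t) / 2))) powr (p - 1)) * e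
        = L A * a powr \<delta>"
      unfolding L_def by (simp add: mult_ac)
    then show ?thesis
      using mult_op_smooth_bound[OF sets fin nz p t a c e B Bp] unfolding Y_def K_def S_def d_def by simp
  qed
  \<comment> \<open>The lowest piece has no cancellation at frequency 0. It occurs only at scale 1,
    where the total mass V is bound enough for the transform of \<nu>.\<close>
  define L0 where "L0 = K A0 * (S A0 * V + 1) powr (2 * (p - 1)) * (2 * ((t / pi) powr (t / 2)) powr (p - 1)) * e"
  have piece0: "(\<integral>\<^sup>+x. ennreal (norm (Y c A0 1 x) powr p) \<partial>lborel) \<le> ennreal L0" if c: "0 < c" for c
  proof -
    have B: "\<bar>poly A0 (gauss_mult 1 \<xi>)\<bar> * norm (ft \<nu> (\<lambda>x. x) (\<lambda>_. 1) \<xi>) \<le> S A0 * V + 1" for \<xi> :: 'a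
      using mult_mono[OF SA[of 1 A0 \<xi>] V[of \<xi>]] S0[of A0] by simp
    have Bp: "0 < S A0 * V + 1" using S0[of A0] V0 by (simp add: add_nonneg_pos)
    show ?thesis
      using mult_op_smooth_bound[OF sets fin nz p t zero_less_one c e B Bp] unfolding Y_def L0_def K_def S_def by simp
  qed
  \<comment> \<open>The square root of the decay ratio 2^(-\<delta>). One factor \<kappa>^i pays for
    the weights in the pointwise sum, the other makes the resulting series converge.\<close>
  define \<kappa> where "\<kappa> = (1/2::real) powr (\<delta> / 2)"
  have \<kappa>: "0 < \<kappa>" "\<kappa> < 1" using \<delta> powr_less_mono2[of "\<delta> / 2" "1/2::real" 1] by (auto simp: \<kappa>_def)
  have \<kappa>i: "((1/2) ^ i) powr \<delta> = \<kappa> ^ i * \<kappa> ^ i" for i :: nat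
    unfolding \<kappa>_def by (simp add: powr_powr mult.commute flip: powr_realpow powr_add)
  \<comment> \<open>The last piece has index J + 1 but scale 2^(-J), one step behind the pattern;
    dividing by \<kappa>^2 makes up for it.\<close>
  define H where "H = \<bar>L0\<bar> + L A1 + L A2 / (\<kappa> * \<kappa>)"
  have H: "0 \<le> H" unfolding H_def using L \<kappa> by (intro add_nonneg_nonneg) auto
  define W where "W = (1 / (1 - \<kappa> powr (1 / p))) powr p"
  have "(\<integral>\<^sup>+x. ennreal (norm (smooth (\<mu> \<Otimes>\<^sub>M \<nu>) (\<lambda>z. fst z + snd z) (\<lambda>_. 1) (2 * (1/2) ^ J) x) powr p) \<partial>lborel) \<le> ennreal (W * (H * (1 / (1 - \<kappa>))))" for J
  proof -
    define cc where "cc i = (if i \<le> J then 2 * (1/2) ^ J else (1/2) ^ J :: real)" for i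
    define AA where "AA i = (if i = 0 then A0 else if i \<le> J then A1 else A2)" for i
    define aa where "aa i = (if i \<le> J then (1/2) ^ i else (1/2) ^ J :: real)" for i
    define Z where "Z i = Y (cc i) (AA i) (aa i)" for i
    have pos: "0 < cc i" "0 < aa i" for i by (auto simp: cc_def aa_def)
    have h: "integrable lborel (smooth \<mu> (\<lambda>x. x) (\<lambda>_. 1) (aa i))" for i
      by (intro integrable_smooth pos mu.sigma_finite_measure_axioms) auto
    have hm: "smooth \<mu> (\<lambda>x. x) (\<lambda>_. 1) (aa i) \<in> borel_measurable borel" for i
      by (intro smooth_measurable mu.sigma_finite_measure_axioms) auto
    have Zm: "Z i \<in> borel_measurable borel" for i
    proof -
      \<comment> \<open>A single function is regarded as a constant family, in order to apply the
        measurability result for families.\<close>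
      have "(\<lambda>z. smooth \<mu> (\<lambda>x. x) (\<lambda>_. 1) (aa i) (snd z)) \<in> borel_measurable (borel \<Otimes>\<^sub>M borel)"
        using hm by measurable
      then have "(\<lambda>z. mult_op \<nu> (cc i) (AA i) (aa i) (smooth \<mu> (\<lambda>x. x) (\<lambda>_. 1) (aa i)) (snd z)) \<in> borel_measurable ((borel :: real measure) \<Otimes>\<^sub>M borel)"
        by (rule mult_op_measurable[OF sets(2) fin(2) pos])
      from measurable_compose[OF _ this, of "\<lambda>x. (0, x)" borel] show ?thesis
        by (simp add: Z_def Y_def)
    qed
    have Zb: "(\<integral>\<^sup>+x. ennreal (norm (Z i x) powr p) \<partial>lborel) \<le> ennreal (H * (\<kappa> ^ i * \<kappa> ^ i))" if "i < J + 2" for i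
    proof -
      have "i = 0 \<or> 0 < i \<and> i \<le> J \<or> i = Suc J" using that by arith
      then consider "i = 0" | "0 < i" "i \<le> J" | "i = Suc J" by blast
      then show ?thesis
      proof cases
        case 1
        have "0 \<le> L A2 / (\<kappa> * \<kappa>)" using L[of A2] \<kappa> by simp
        then have "L0 \<le> H" unfolding H_def using L[of A1] by linarith
        from order_trans[OF piece0[OF pos(1)] ennreal_leI[OF this]] show ?thesis
          using 1 by (simp add: Z_def AA_def aa_def)
      next
        case 2
        have "L A1 \<le> H" unfolding H_def using L[of A2] \<kappa> by auto
        then have "L A1 * (\<kappa> ^ i * \<kappa> ^ i) \<le> H * (\<kappa> ^ i * \<kappa> ^ i)" using \<kappa> by (intro mult_right_mono) auto
        moreover have "Z i = Y (cc i) A1 (aa i)" "aa i = (1/2) ^ i" using 2 by (simp_all add: Z_def AA_def aa_def)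
        ultimately show ?thesis
          using piece[OF pos(2) pos(1), of A1 i i] by (simp only: \<kappa>i) (blast intro: order_trans ennreal_leI)
      next
        case 3
        have "L A2 / (\<kappa> * \<kappa>) \<le> H" unfolding H_def using L[of A1] by auto
        then have "L A2 / (\<kappa> * \<kappa>) * (\<kappa> ^ i * \<kappa> ^ i) \<le> H * (\<kappa> ^ i * \<kappa> ^ i)" using \<kappa> by (intro mult_right_mono) auto
        moreover have "L A2 / (\<kappa> * \<kappa>) * (\<kappa> ^ i * \<kappa> ^ i) = L A2 * (\<kappa> ^ J * \<kappa> ^ J)"
          using 3 \<kappa> by simp
        ultimately have "L A2 * (\<kappa> ^ J * \<kappa> ^ J) \<le> H * (\<kappa> ^ i * \<kappa> ^ i)" by simp
        moreover have "Z i = Y (cc i) A2 (aa i)" "aa i = (1/2) ^ J" using 3 by (simp_all add: Z_def AA_def aa_def)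
        ultimately show ?thesis
          using piece[OF pos(2) pos(1), of A2 i i] by (simp only: \<kappa>i) (blast intro: order_trans ennreal_leI)
      qed
    qed
    have one: "integrable \<mu> (\<lambda>_. 1 :: complex)" "integrable \<nu> (\<lambda>_. 1 :: complex)" by simp_all
    have oneP: "integrable (\<mu> \<Otimes>\<^sub>M \<nu>) (\<lambda>_. 1 :: complex)"
      by (rule finite_measure.integrable_const[OF finP])
    have ftP: "ft (\<mu> \<Otimes>\<^sub>M \<nu>) (\<lambda>z. fst z + snd z) (\<lambda>_. 1) \<xi> = ft \<mu> (\<lambda>x. x) (\<lambda>_. 1) \<xi> * ft \<nu> (\<lambda>x. x) (\<lambda>_. 1) \<xi>" for \<xi> :: 'a
      using ft_pair[OF mu.sigma_finite_measure_axioms nu.sigma_finite_measure_axioms measurable_ident_sets[OF sets(1)] measurable_ident_sets[OF sets(2)] one]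
      by (simp only: mult_1_left)
    \<comment> \<open>On the Fourier side, mollifying \<mu> inside a piece supplies the last
      Gaussian factor of each term, so \<open>gauss_telescope\<close> gives the equality exactly;
      there is no limit in J.\<close>
    have decomp: "smooth (\<mu> \<Otimes>\<^sub>M \<nu>) (\<lambda>z. fst z + snd z) (\<lambda>_. 1) (2 * (1/2) ^ J) x = (\<Sum>i<J + 2. Z i x)" for x
    proof -
      let ?w = "\<lambda>i \<xi>. of_real (gauss_mult (cc i) \<xi> * poly (AA i) (gauss_mult (aa i) \<xi>)) * ft \<nu> (\<lambda>x. x) (\<lambda>_. 1) \<xi>
         * ft lborel (\<lambda>x. x) (smooth \<mu> (\<lambda>x. x) (\<lambda>_. 1) (aa i)) \<xi>"
      have "(\<Sum>i<J + 2. Z i x) = (\<integral>\<xi>. (\<Sum>i<J + 2. ?w i \<xi> * cis (2 * pi * (x \<bullet> \<xi>))) \<partial>lborel)"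
        unfolding Z_def Y_def mult_op_def
        by (intro Bochner_Integration.integral_sum[symmetric] integrable_mult_cis integrable_mult_op[OF sets(2) fin(2) pos h]) simp
      also have "\<dots> = (\<integral>\<xi>. of_real (gauss_mult (2 * (1/2) ^ J) \<xi>) * ft (\<mu> \<Otimes>\<^sub>M \<nu>) (\<lambda>z. fst z + snd z) (\<lambda>_. 1) \<xi> * cis (2 * pi * (x \<bullet> \<xi>)) \<partial>lborel)"
      proof (intro Bochner_Integration.integral_cong refl)
        fix \<xi> :: 'a
        have "?w i \<xi> = of_real (gauss_mult (cc i) \<xi> * poly (AA i) (gauss_mult (aa i) \<xi>) * gauss_mult (aa i) \<xi>) * ft (\<mu> \<Otimes>\<^sub>M \<nu>) (\<lambda>z. fst z + snd z) (\<lambda>_. 1) \<xi>" for i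
          unfolding ftP by (subst ft_smooth[OF pos(2) mu.sigma_finite_measure_axioms _ one(1)]) (auto simp: mult_ac)
        then have "(\<Sum>i<J + 2. ?w i \<xi> * cis (2 * pi * (x \<bullet> \<xi>))) = of_real (\<Sum>i<J + 2. gauss_mult (cc i) \<xi> * poly (AA i) (gauss_mult (aa i) \<xi>) * gauss_mult (aa i) \<xi>)
           * ft (\<mu> \<Otimes>\<^sub>M \<nu>) (\<lambda>z. fst z + snd z) (\<lambda>_. 1) \<xi> * cis (2 * pi * (x \<bullet> \<xi>))"
          by (simp only: of_real_sum sum_distrib_right)
        also have "(\<Sum>i<J + 2. gauss_mult (cc i) \<xi> * poly (AA i) (gauss_mult (aa i) \<xi>) * gauss_mult (aa i) \<xi>) = gauss_mult (2 * (1/2) ^ J) \<xi>"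
          using gauss_telescope[OF A0 R, of J \<xi>] unfolding cc_def AA_def aa_def A1_def A2_def .
        finally show "(\<Sum>i<J + 2. ?w i \<xi> * cis (2 * pi * (x \<bullet> \<xi>))) = of_real (gauss_mult (2 * (1/2) ^ J) \<xi>) * ft (\<mu> \<Otimes>\<^sub>M \<nu>) (\<lambda>z. fst z + snd z) (\<lambda>_. 1) \<xi> * cis (2 * pi * (x \<bullet> \<xi>))" .
      qed
      also have "\<dots> = smooth (\<mu> \<Otimes>\<^sub>M \<nu>) (\<lambda>z. fst z + snd z) (\<lambda>_. 1) (2 * (1/2) ^ J) x"
        by (rule smooth_eq_inverse_fourier[symmetric, OF _ sfP _ oneP]) auto
      finally show ?thesis ..
    qed
    have "(\<integral>\<^sup>+x. ennreal (norm (smooth (\<mu> \<Otimes>\<^sub>M \<nu>) (\<lambda>z. fst z + snd z) (\<lambda>_. 1) (2 * (1/2) ^ J) x) powr p) \<partial>lborel)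
      \<le> (\<integral>\<^sup>+x. ennreal W * (\<Sum>i<J + 2. ennreal (1 / \<kappa> ^ i) * ennreal (norm (Z i x) powr p)) \<partial>lborel)"
    proof (intro nn_integral_mono)
      fix x
      have "norm (smooth (\<mu> \<Otimes>\<^sub>M \<nu>) (\<lambda>z. fst z + snd z) (\<lambda>_. 1) (2 * (1/2) ^ J) x) powr p \<le> (\<Sum>i<J + 2. norm (Z i x)) powr p"
        unfolding decomp using p by (intro powr_mono2 norm_sum) auto
      also have "\<dots> \<le> W * (\<Sum>i<J + 2. norm (Z i x) powr p / \<kappa> ^ i)"
        unfolding W_def using p by (intro sum_powr_le_weighted \<kappa>) auto
      finally have "ennreal (norm (smooth (\<mu> \<Otimes>\<^sub>M \<nu>) (\<lambda>z. fst z + snd z) (\<lambda>_. 1) (2 * (1/2) ^ J) x) powr p) \<le> ennreal (W * (\<Sum>i<J + 2. norm (Z i x) powr p / \<kappa> ^ i))"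
        by (rule ennreal_leI)
      also have "\<dots> = ennreal W * ennreal (\<Sum>i<J + 2. norm (Z i x) powr p / \<kappa> ^ i)"
        by (rule ennreal_mult') (simp add: W_def)
      also have "ennreal (\<Sum>i<J + 2. norm (Z i x) powr p / \<kappa> ^ i) = (\<Sum>i<J + 2. ennreal (norm (Z i x) powr p / \<kappa> ^ i))"
        using \<kappa> by (intro sum_ennreal[symmetric]) auto
      also have "\<dots> = (\<Sum>i<J + 2. ennreal (1 / \<kappa> ^ i) * ennreal (norm (Z i x) powr p))"
        using \<kappa> by (intro sum.cong refl) (simp flip: ennreal_mult)
      finally show "ennreal (norm (smooth (\<mu> \<Otimes>\<^sub>M \<nu>) (\<lambda>z. fst z + snd z) (\<lambda>_. 1) (2 * (1/2) ^ J) x) powr p) \<le> ennreal W * \<dots>" .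
    qed
    also have "\<dots> = ennreal W * (\<Sum>i<J + 2. ennreal (1 / \<kappa> ^ i) * (\<integral>\<^sup>+x. ennreal (norm (Z i x) powr p) \<partial>lborel))"
      using Zm by (subst nn_integral_cmult, simp, subst nn_integral_sum) (auto simp: nn_integral_cmult)
    also have "\<dots> \<le> ennreal W * (\<Sum>i<J + 2. ennreal (1 / \<kappa> ^ i) * ennreal (H * (\<kappa> ^ i * \<kappa> ^ i)))"
      by (intro mult_left_mono sum_mono Zb) auto
    also have "(\<Sum>i<J + 2. ennreal (1 / \<kappa> ^ i) * ennreal (H * (\<kappa> ^ i * \<kappa> ^ i))) = (\<Sum>i<J + 2. ennreal (H * \<kappa> ^ i))"
      using \<kappa> H by (intro sum.cong refl) (simp flip: ennreal_mult)
    also have "\<dots> = ennreal (\<Sum>i<J + 2. H * \<kappa> ^ i)"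
      using \<kappa> H by (intro sum_ennreal) auto
    also have "\<dots> \<le> ennreal (H * (1 / (1 - \<kappa>)))"
      unfolding sum_distrib_left[symmetric] using \<kappa> H
      by (intro ennreal_leI mult_left_mono) (auto simp: sum_gp_strict divide_right_mono simp del: sum.lessThan_Suc)
    also have "ennreal W * ennreal (H * (1 / (1 - \<kappa>))) = ennreal (W * (H * (1 / (1 - \<kappa>))))"
      by (rule ennreal_mult'[symmetric]) (simp add: W_def)
    finally show ?thesis by (simp add: mult_left_mono)
  qed
  then show ?thesis by blast
qed

section \<open>From mollified bounds to the extension estimate\<close>

text \<open>At q = 2 the conjugate exponent is also 2 and the claim is the Plancherel inequality;
  the constant from real interpolation contains 1 / (q - 2) and covers only q > 2.\<close>

lemma Hausdorff_Young_ge: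
  fixes q N :: real
  assumes q: "2 \<le> q" and N: "0 < N"
  shows "\<exists>K::real. \<forall>h :: 'a::euclidean_space \<Rightarrow> complex. integrable lborel h \<longrightarrow>
     (\<integral>\<^sup>+x. ennreal (norm (h x) powr (q / (q - 1))) \<partial>lborel) \<le> ennreal N \<longrightarrow>
     (\<integral>\<^sup>+\<xi>. ennreal (norm (ft lborel (\<lambda>x. x) h \<xi>) powr q) \<partial>lborel) \<le> ennreal K"
proof (cases "q = 2")
  case True
  show ?thesis
    unfolding True by (intro exI[of _ N]) (auto intro: order_trans[OF Plancherel_le])
next
  case False
  then show ?thesis using q by (intro Hausdorff_Young N) simp
qed

text \<open>Mollifying at scale a multiplies the product of transforms by a Gaussian.
  Hausdorff--Young bounds this with K independent of the scale, which therefore survives the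
  limit.\<close>

lemma ft_product_Lq_bound:
  fixes \<mu> \<nu> :: "'a::euclidean_space measure"
  assumes sets: "sets \<mu> = sets borel" "sets \<nu> = sets borel" and fin: "finite_measure \<mu>" "finite_measure \<nu>"
    and q: "2 \<le> q" and N: "0 < N"
  shows "\<exists>K::real. \<forall>f g. integrable \<mu> f \<longrightarrow> integrable \<nu> g \<longrightarrow>
     (\<forall>J. (\<integral>\<^sup>+x. ennreal (norm (smooth (\<mu> \<Otimes>\<^sub>M \<nu>) (\<lambda>z. fst z + snd z) (\<lambda>z. f (fst z) * g (snd z)) (2 * (1/2) ^ J) x) powr (q / (q - 1))) \<partial>lborel) \<le> ennreal N) \<longrightarrow>
     (\<integral>\<^sup>+\<xi>. ennreal (norm (ft \<mu> (\<lambda>x. x) f \<xi> * ft \<nu> (\<lambda>x. x) g \<xi>) powr q) \<partial>lborel) \<le> ennreal K"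
proof -
  interpret mu: finite_measure \<mu> by fact
  interpret nu: finite_measure \<nu> by fact
  interpret P: pair_sigma_finite \<mu> \<nu> ..
  note sfP = P.sigma_finite_measure_axioms
  note sf = mu.sigma_finite_measure_axioms nu.sigma_finite_measure_axioms
  note [measurable_cong] = sets
  note ids = measurable_ident_sets[OF sets(1)] measurable_ident_sets[OF sets(2)]
  obtain K where K: "\<And>h :: 'a \<Rightarrow> complex. integrable lborel h \<Longrightarrow>
     (\<integral>\<^sup>+x. ennreal (norm (h x) powr (q / (q - 1))) \<partial>lborel) \<le> ennreal N \<Longrightarrow>
     (\<integral>\<^sup>+\<xi>. ennreal (norm (ft lborel (\<lambda>x. x) h \<xi>) powr q) \<partial>lborel) \<le> ennreal K"
    using Hausdorff_Young_ge[OF q N] by blast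
  show ?thesis
  proof (intro exI[of _ K] allI impI)
    fix f g
    assume f: "integrable \<mu> f" and g: "integrable \<nu> g"
      and bound: "\<forall>J. (\<integral>\<^sup>+x. ennreal (norm (smooth (\<mu> \<Otimes>\<^sub>M \<nu>) (\<lambda>z. fst z + snd z) (\<lambda>z. f (fst z) * g (snd z)) (2 * (1/2) ^ J) x) powr (q / (q - 1))) \<partial>lborel) \<le> ennreal N"
    let ?\<Phi> = "\<lambda>\<xi>. ft \<mu> (\<lambda>x. x) f \<xi> * ft \<nu> (\<lambda>x. x) g \<xi>"
    note fg = integrable_product[OF sf f g]
    have sum_meas: "(\<lambda>z. fst z + snd z) \<in> \<mu> \<Otimes>\<^sub>M \<nu> \<rightarrow>\<^sub>M borel" by measurable
    have m: "ft \<mu> (\<lambda>x. x) f \<in> borel_measurable borel" "ft \<nu> (\<lambda>x. x) g \<in> borel_measurable borel"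
      by (rule ft_measurable[OF sf(1) ids(1) borel_measurable_integrable[OF f]],
          rule ft_measurable[OF sf(2) ids(2) borel_measurable_integrable[OF g]])
    show "(\<integral>\<^sup>+\<xi>. ennreal (norm (?\<Phi> \<xi>) powr q) \<partial>lborel) \<le> ennreal K"
    \<comment> \<open>The q-th power of the Gaussian at scale a is the Gaussian at scale q a, hence
      the factor q.\<close>
    proof (rule nn_integral_le_gauss_limit[where a="\<lambda>J. q * (2 * (1/2) ^ J)"])
      show "(\<lambda>\<xi>. ennreal (norm (?\<Phi> \<xi>) powr q)) \<in> borel_measurable borel"
        using m by measurable
      have "(\<lambda>J. q * (2 * (1/2) ^ J)) \<longlonglongrightarrow> q * (2 * 0)"
        by (intro tendsto_intros LIMSEQ_power_zero) simp
      then show "(\<lambda>J. q * (2 * (1/2) ^ J)) \<longlonglongrightarrow> 0" by simp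
      fix J :: nat
      define a where "a = 2 * (1/2::real) ^ J"
      have a: "0 < a" by (simp add: a_def)
      let ?h = "smooth (\<mu> \<Otimes>\<^sub>M \<nu>) (\<lambda>z. fst z + snd z) (\<lambda>z. f (fst z) * g (snd z)) a"
      have "norm (?\<Phi> \<xi>) powr q * gauss_mult (q * a) \<xi> = norm (ft lborel (\<lambda>x. x) ?h \<xi>) powr q" for \<xi>
      proof -
        have "gauss_mult (q * a) \<xi> = gauss_mult a \<xi> powr q"
          by (simp add: gauss_mult_def exp_powr_real mult_ac)
        then show ?thesis
          unfolding ft_smooth[OF a sfP sum_meas fg] ft_pair[OF sf ids f g] norm_mult[of "of_real _"]
          using gauss_mult_pos[of a \<xi>] by (simp add: powr_mult mult.commute)
      qed
      then have "(\<integral>\<^sup>+\<xi>. ennreal (norm (?\<Phi> \<xi>) powr q) * ennreal (gauss_mult (q * a) \<xi>) \<partial>lborel)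
        = (\<integral>\<^sup>+\<xi>. ennreal (norm (ft lborel (\<lambda>x. x) ?h \<xi>) powr q) \<partial>lborel)"
        by (intro nn_integral_cong) (simp only: ennreal_mult'[symmetric] powr_ge_zero)
      also have "\<dots> \<le> ennreal K"
        using bound by (intro K integrable_smooth a sfP sum_meas fg) (simp add: a_def)
      finally show "(\<integral>\<^sup>+\<xi>. ennreal (norm (?\<Phi> \<xi>) powr q) * ennreal (gauss_mult (q * (2 * (1/2) ^ J)) \<xi>) \<partial>lborel) \<le> ennreal K"
        by (simp add: a_def)
    qed
  qed
qed

text \<open>Hoelder's inequality in the form needed here, obtained by optimising the scale \<open>s\<close> in
  \<open>A \<le> A\<^sup>p s\<^sup>1\<^sup>-\<^sup>p + s\<close>; the value of \<open>r\<close> makes the exponents of \<open>F\<close> and \<open>u\<close> balance.\<close>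
lemma powr_bound_from_scales:
  fixes F u H p q :: real
  assumes p: "1 < p" and q: "2 \<le> q" and r: "r = q * (p - 1) / (q * (p - 1) - p)" "0 < q * (p - 1) - p"
    and F: "0 \<le> F" and u: "0 < u" and H: "0 \<le> H" and le: "\<And>s. 0 < s \<Longrightarrow> H \<le> s powr (1 - p) * F + s * u"
  shows "H powr (q / (q - 1)) \<le> 4 * (F + u powr r)"
proof -
  define w where "w = max F (u powr r)"
  have r0: "0 < r" using p q r(2) by (simp add: r(1))
  have w: "0 < w" "F \<le> w" "u powr r \<le> w" using u by (auto simp: w_def less_max_iff_disj)
  \<comment> \<open>The scale used is s = w^e. This value of e gives both terms the same power (q -
    1) / q of w, which the outer exponent q / (q - 1) cancels.\<close>
  define e where "e = 1 / (q * (p - 1))"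
  have e1: "e * (1 - p) + 1 = (q - 1) / q" using p q by (simp add: e_def field_simps)
  have "1 / r = 1 - p * e" using r(2) p q by (simp add: r(1) e_def field_simps)
  then have e2: "e + 1 / r = (q - 1) / q" using e1 by (simp add: algebra_simps)
  have "u = (u powr r) powr (1 / r)" using u r0 by (simp add: powr_powr)
  also have "\<dots> \<le> w powr (1 / r)" using w r0 by (intro powr_mono2) auto
  finally have uw: "u \<le> w powr (1 / r)" .
  have "H \<le> (w powr e) powr (1 - p) * F + w powr e * u" using w by (intro le) auto
  also have "\<dots> \<le> (w powr e) powr (1 - p) * w + w powr e * w powr (1 / r)"
    using w uw by (intro add_mono mult_left_mono) auto
  also have "\<dots> = w powr (e * (1 - p) + 1) + w powr (e + 1 / r)"
    using w by (simp add: powr_powr powr_add)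
  also have "\<dots> = 2 * w powr ((q - 1) / q)" unfolding e1 e2 by simp
  finally have "H powr (q / (q - 1)) \<le> (2 * w powr ((q - 1) / q)) powr (q / (q - 1))"
    using H q by (intro powr_mono2) auto
  also have "\<dots> = 2 powr (q / (q - 1)) * w"
    using w q by (subst powr_mult) (auto simp: powr_powr)
  also have "\<dots> \<le> 2 powr 2 * w"
    using w q by (intro mult_right_mono powr_mono) (auto simp: field_simps)
  also have "\<dots> \<le> 4 * (F + u powr r)" using F by (auto simp: w_def max_def)
  finally show ?thesis .
qed

lemma le_powr_scale:
  fixes A s p :: real
  assumes "0 \<le> A" "0 < s" "1 < p"
  shows "A \<le> s powr (1 - p) * A powr p + s"
proof (cases "A \<le> s")
  case False
  have "A = A powr (1 - p) * A powr p" using assms False by (simp flip: powr_add)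
  also have "\<dots> \<le> s powr (1 - p) * A powr p"
    using assms False by (intro mult_right_mono powr_mono2') auto
  finally show ?thesis using assms by simp
qed (use assms in \<open>simp add: add_increasing\<close>)

text \<open>Pointwise, the mollification of G is controlled by F, the mollification of |G|^p, and u,
  that of the measure alone. The first has integral at most 1 and the second is bounded in L^r by
  hypothesis, so the pointwise bound integrates directly.\<close>

lemma smooth_Lp_weight_bound:
  fixes \<phi> :: "'w \<Rightarrow> 'a::euclidean_space" and p q :: real
  assumes fin: "finite_measure M" and nz: "emeasure M (space M) \<noteq> 0"
    and \<phi> [measurable]: "\<phi> \<in> M \<rightarrow>\<^sub>M borel" and G [measurable]: "G \<in> borel_measurable M" and a: "0 < a"
    and p: "1 < p" and q: "2 \<le> q" and r: "r = q * (p - 1) / (q * (p - 1) - p)" "0 < q * (p - 1) - p"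
    and G1: "(\<integral>\<^sup>+\<omega>. ennreal (norm (G \<omega>) powr p) \<partial>M) \<le> 1"
    and C: "(\<integral>\<^sup>+x. ennreal (norm (smooth M \<phi> (\<lambda>_. 1) a x) powr r) \<partial>lborel) \<le> ennreal C"
  shows "(\<integral>\<^sup>+x. ennreal (norm (smooth M \<phi> G a x) powr (q / (q - 1))) \<partial>lborel) \<le> ennreal (4 * (1 + \<bar>C\<bar>))"
proof -
  interpret finite_measure M by fact
  interpret pair_sigma_finite M "lborel :: 'a measure" ..
  define u where "u x = norm (smooth M \<phi> (\<lambda>_. 1) a x)" for x
  define F where "F x = (\<integral>\<^sup>+\<omega>. ennreal (gauss_kernel a (x - \<phi> \<omega>)) * ennreal (norm (G \<omega>) powr p) \<partial>M)" for x
  have Fm [measurable]: "F \<in> borel_measurable borel" unfolding F_def by measurable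
  have um [measurable]: "u \<in> borel_measurable borel"
    unfolding u_def norm_smooth_one[OF a] by measurable
  have F1: "(\<integral>\<^sup>+x. F x \<partial>lborel) \<le> 1"
  proof -
    have "(\<integral>\<^sup>+x. F x \<partial>lborel) = (\<integral>\<^sup>+\<omega>. (\<integral>\<^sup>+x. ennreal (gauss_kernel a (x - \<phi> \<omega>)) * ennreal (norm (G \<omega>) powr p) \<partial>lborel) \<partial>M)"
      unfolding F_def by (rule Fubini') simp
    also have "\<dots> = (\<integral>\<^sup>+\<omega>. ennreal (norm (G \<omega>) powr p) \<partial>M)"
      by (simp add: nn_integral_multc nn_integral_gauss_kernel[OF a])
    finally show ?thesis using G1 by simp
  qed
  have pw: "ennreal (norm (smooth M \<phi> G a x) powr (q / (q - 1))) \<le> 4 * (F x + ennreal (u x powr r))" for x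
  \<comment> \<open>The real-variable inequality needs a finite F; where F is infinite the bound is
    trivial.\<close>
  proof (cases "F x = \<infinity>")
    case True
    then show ?thesis by (simp add: ennreal_mult_top)
  next
    case False
    define F' where "F' = enn2real (F x)"
    have F': "F x = ennreal F'" "0 \<le> F'" using False by (auto simp: F'_def less_top)
    have u: "0 < u x"
      unfolding u_def norm_smooth_one[OF a] by (rule integral_gauss_kernel_pos[OF fin a \<phi> nz])
    have "norm (smooth M \<phi> G a x) powr (q / (q - 1)) \<le> 4 * (F' + u x powr r)"
    proof (rule powr_bound_from_scales[OF p q r F'(2) u])
      fix s :: real assume s: "0 < s"
      have "ennreal (norm (smooth M \<phi> G a x)) \<le> (\<integral>\<^sup>+\<omega>. ennreal (gauss_kernel a (x - \<phi> \<omega>)) * ennreal (norm (G \<omega>)) \<partial>M)"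
        by (rule norm_smooth_le) (auto intro: a)
      also have "\<dots> \<le> (\<integral>\<^sup>+\<omega>. ennreal (s powr (1 - p)) * (ennreal (gauss_kernel a (x - \<phi> \<omega>)) * ennreal (norm (G \<omega>) powr p)) + ennreal s * ennreal (gauss_kernel a (x - \<phi> \<omega>)) \<partial>M)"
      proof (intro nn_integral_mono)
        fix \<omega>
        have "ennreal (gauss_kernel a (x - \<phi> \<omega>)) * ennreal (norm (G \<omega>)) \<le> ennreal (gauss_kernel a (x - \<phi> \<omega>)) * ennreal (s powr (1 - p) * norm (G \<omega>) powr p + s)"
          using s p by (intro mult_left_mono ennreal_leI le_powr_scale) auto
        also have "\<dots> = ennreal (s powr (1 - p)) * (ennreal (gauss_kernel a (x - \<phi> \<omega>)) * ennreal (norm (G \<omega>) powr p)) + ennreal s * ennreal (gauss_kernel a (x - \<phi> \<omega>))"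
          using s by (simp add: ennreal_plus ennreal_mult distrib_left mult_ac)
        finally show "ennreal (gauss_kernel a (x - \<phi> \<omega>)) * ennreal (norm (G \<omega>)) \<le> \<dots>" .
      qed
      also have "\<dots> = ennreal (s powr (1 - p)) * F x + ennreal s * ennreal (u x)"
        unfolding F_def u_def norm_smooth_one[OF a] nn_integral_gauss_kernel_eq[OF fin a \<phi>, symmetric]
        by (subst nn_integral_add) (simp_all add: nn_integral_cmult)
      also have "\<dots> = ennreal (s powr (1 - p) * F' + s * u x)"
        using s F' u by (simp add: F'(1) ennreal_plus ennreal_mult)
      finally have "ennreal (norm (smooth M \<phi> G a x)) \<le> ennreal (s powr (1 - p) * F' + s * u x)" .
      moreover have "0 \<le> s powr (1 - p) * F' + s * u x" using s F' u by simp
      ultimately show "norm (smooth M \<phi> G a x) \<le> s powr (1 - p) * F' + s * u x"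
        by (simp only: ennreal_le_iff)
    qed simp
    then have "ennreal (norm (smooth M \<phi> G a x) powr (q / (q - 1))) \<le> ennreal (4 * (F' + u x powr r))"
      by (rule ennreal_leI)
    also have "\<dots> = 4 * (F x + ennreal (u x powr r))"
      using F' by (simp add: ennreal_mult ennreal_plus)
    finally show ?thesis .
  qed
  have "(\<integral>\<^sup>+x. ennreal (norm (smooth M \<phi> G a x) powr (q / (q - 1))) \<partial>lborel) \<le> (\<integral>\<^sup>+x. 4 * (F x + ennreal (u x powr r)) \<partial>lborel)"
    by (intro nn_integral_mono pw)
  also have "\<dots> = 4 * ((\<integral>\<^sup>+x. F x \<partial>lborel) + (\<integral>\<^sup>+x. ennreal (u x powr r) \<partial>lborel))"
    by (simp add: nn_integral_cmult nn_integral_add)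
  also have "\<dots> \<le> 4 * (1 + ennreal \<bar>C\<bar>)"
    using C by (intro mult_left_mono add_mono F1) (auto simp: u_def intro: order_trans ennreal_leI)
  also have "\<dots> = ennreal (4 * (1 + \<bar>C\<bar>))"
    by (simp add: ennreal_mult ennreal_plus)
  finally show ?thesis .
qed

section \<open>Norms, scaling and the reduction to unit balls\<close>

lemma epow_le_1:
  assumes "epow I e \<le> 1" "0 < e" shows "I \<le> 1"
proof (cases "I = \<infinity>")
  case False
  then obtain i where i: "I = ennreal i" "0 \<le> i" by (cases I) auto
  have "i powr e \<le> 1" using assms i by (simp add: epow_def ennreal_le_1)
  then have "\<not> 1 < i" using powr_less_mono2[OF assms(2), of 1 i] by force
  then have "i \<le> 1" by simp
  then show ?thesis using i by (simp add: ennreal_le_1)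
qed (use assms in \<open>auto simp: epow_def\<close>)

lemma epow_le_ennreal:
  assumes "I \<le> ennreal K" "0 < e" shows "epow I e \<le> ennreal (\<bar>K\<bar> powr e)"
proof -
  obtain i where i: "I = ennreal i" "0 \<le> i"
    using assms(1) by (cases I) (auto simp: top_unique)
  have "i \<le> \<bar>K\<bar>" using assms(1) i by (auto simp: ennreal_le_iff2)
  then show ?thesis using assms i by (simp add: epow_def ennreal_leI powr_mono2)
qed

lemma Lp_norm_scale_le:
  fixes f :: "'w \<Rightarrow> complex"
  assumes [measurable]: "f \<in> borel_measurable M" and c: "0 < c" and p: "1 \<le> p"
  shows "Lp_norm p M (\<lambda>x. of_real c * f x) \<le> ennreal c * Lp_norm p M f"
proof (cases "p = \<infinity>")
  case True
  have "AE x in M. ennreal (norm (f x)) \<le> esssup M (\<lambda>x. ennreal (norm (f x)))"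
    by (rule esssup_AE)
  then have "AE x in M. ennreal (norm (of_real c * f x)) \<le> ennreal c * esssup M (\<lambda>x. ennreal (norm (f x)))"
    by eventually_elim (use c in \<open>simp add: norm_mult ennreal_mult mult_left_mono\<close>)
  then have "esssup M (\<lambda>x. ennreal (norm (of_real c * f x))) \<le> ennreal c * esssup M (\<lambda>x. ennreal (norm (f x)))"
    by (intro esssup_I) auto
  then show ?thesis using True by (simp add: Lp_norm_def)
next
  case False
  then obtain P where P: "p = ennreal P" "1 \<le> P"
    using p by (cases p) auto
  let ?I = "\<integral>\<^sup>+x. ennreal (norm (f x) powr P) \<partial>M"
  have "(\<integral>\<^sup>+x. ennreal (norm (of_real c * f x) powr P) \<partial>M) = (\<integral>\<^sup>+x. ennreal (c powr P) * ennreal (norm (f x) powr P) \<partial>M)"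
    using c by (intro nn_integral_cong) (simp add: norm_mult powr_mult ennreal_mult)
  also have "\<dots> = ennreal (c powr P) * ?I" by (rule nn_integral_cmult) simp
  finally have eq: "(\<integral>\<^sup>+x. ennreal (norm (of_real c * f x) powr P) \<partial>M) = ennreal (c powr P) * ?I" .
  have "epow (ennreal (c powr P) * ?I) (1 / P) = ennreal c * epow ?I (1 / P)"
  proof (cases "?I = \<infinity>")
    case True
    then show ?thesis using c P by (simp add: epow_def ennreal_mult_top)
  next
    case False
    then obtain i where i: "?I = ennreal i" "0 \<le> i" by (cases ?I) auto
    show ?thesis
      using c P i(2) unfolding i(1) by (simp add: epow_def powr_mult powr_powr flip: ennreal_mult)
  qed
  then show ?thesis using P eq False by (simp add: Lp_norm_def)
qed

lemma Lp_norm_ennreal: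
  "0 \<le> P \<Longrightarrow> Lp_norm (ennreal P) M f = epow (\<integral>\<^sup>+x. ennreal (norm (f x) powr P) \<partial>M) (1 / P)"
  by (simp add: Lp_norm_def)

lemma Lp_norm_ennreal_le_1:
  assumes "Lp_norm (ennreal P) M f \<le> 1" "0 < P"
  shows "(\<integral>\<^sup>+x. ennreal (norm (f x) powr P) \<partial>M) \<le> 1"
proof (rule epow_le_1)
  show "epow (\<integral>\<^sup>+x. ennreal (norm (f x) powr P) \<partial>M) (1 / P) \<le> 1"
    using assms(1) unfolding Lp_norm_ennreal[OF less_imp_le[OF assms(2)]] .
qed (use assms(2) in simp)

lemma Lp_norm_infinity_le_1:
  assumes "Lp_norm \<infinity> M f \<le> 1"
  shows "AE x in M. norm (f x) \<le> 1"
  using esssup_AE[of "\<lambda>x. ennreal (norm (f x))" M]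
proof eventually_elim
  case (elim x)
  then have "ennreal (norm (f x)) \<le> 1" using assms by (simp only: Lp_norm_def if_True refl order_trans)
  then show ?case by simp
qed

text \<open>For finite exponents y \<le> 1 + y^P suffices, instead of a sharp inclusion of L^p in
  L^1.\<close>

lemma Lp_norm_le_1_integrable:
  assumes fin: "finite_measure M" and f: "f \<in> Lp_space p M" and p: "1 \<le> p" and le: "Lp_norm p M f \<le> 1"
  shows "integrable M f" and "(\<integral>x. norm (f x) \<partial>M) \<le> measure M (space M) + 1"
proof -
  interpret finite_measure M by fact
  have [measurable]: "f \<in> borel_measurable M" using f by (simp add: Lp_space_def)
  have nn: "(\<integral>\<^sup>+x. ennreal (norm (f x)) \<partial>M) \<le> ennreal (measure M (space M) + 1)"
  proof (cases "p = \<infinity>")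
    case True
    have "AE x in M. ennreal (norm (f x)) \<le> 1"
      using Lp_norm_infinity_le_1[of M f] le True by simp
    then have "(\<integral>\<^sup>+x. ennreal (norm (f x)) \<partial>M) \<le> (\<integral>\<^sup>+x. 1 \<partial>M)" by (rule nn_integral_mono_AE)
    also have "\<dots> \<le> ennreal (measure M (space M) + 1)" by (simp add: emeasure_eq_measure)
    finally show ?thesis .
  next
    case False
    then obtain P where P: "p = ennreal P" "1 \<le> P" using p by (cases p) auto
    have I: "(\<integral>\<^sup>+x. ennreal (norm (f x) powr P) \<partial>M) \<le> 1"
      by (rule Lp_norm_ennreal_le_1) (use le P in simp_all)
    have "(\<integral>\<^sup>+x. ennreal (norm (f x)) \<partial>M) \<le> (\<integral>\<^sup>+x. 1 + ennreal (norm (f x) powr P) \<partial>M)"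
    proof (intro nn_integral_mono)
      fix x
      have "norm (f x) \<le> 1 + norm (f x) powr P"
      proof (cases "norm (f x) \<le> 1")
        case True
        then show ?thesis using powr_ge_zero[of "norm (f x)" P] by linarith
      next
        case False
        then show ?thesis using P powr_mono[of 1 P "norm (f x)"] by simp
      qed
      then have "ennreal (norm (f x)) \<le> ennreal (1 + norm (f x) powr P)" by (rule ennreal_leI)
      then show "ennreal (norm (f x)) \<le> 1 + ennreal (norm (f x) powr P)" by (simp add: ennreal_plus)
    qed
    also have "\<dots> = emeasure M (space M) + (\<integral>\<^sup>+x. ennreal (norm (f x) powr P) \<partial>M)"
      by (subst nn_integral_add) auto
    also have "\<dots> \<le> ennreal (measure M (space M)) + 1"
      using I by (simp add: emeasure_eq_measure add_left_mono)
    also have "\<dots> = ennreal (measure M (space M) + 1)" by (simp add: ennreal_plus)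
    finally show ?thesis .
  qed
  show int: "integrable M f"
    using le_less_trans[OF nn] by (intro integrableI_bounded) auto
  have "ennreal (\<integral>x. norm (f x) \<partial>M) \<le> ennreal (measure M (space M) + 1)"
    using nn by (subst (asm) nn_integral_eq_integral) (use int in auto)
  then show "(\<integral>x. norm (f x) \<partial>M) \<le> measure M (space M) + 1"
    by (subst (asm) ennreal_le_iff) (auto intro: add_nonneg_nonneg)
qed

lemma ft_scale: "ft M \<phi> (\<lambda>\<omega>. c * f \<omega>) \<xi> = c * ft M \<phi> f \<xi>"
  unfolding ft_def by (simp add: mult.assoc)

text \<open>Bilinearity. Normalising by the norm plus e > 0 avoids a separate treatment of functions
  of norm 0; e tends to 0 at the end.\<close>

lemma Lp_product_bound_from_unit_balls:
  fixes \<mu> \<nu> :: "'a::euclidean_space measure"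
  assumes sets: "sets \<mu> = sets borel" "sets \<nu> = sets borel" and fin: "finite_measure \<mu>" "finite_measure \<nu>"
    and p: "1 \<le> p" and q: "1 \<le> q" and C: "0 \<le> C"
    and unit: "\<And>f g. f \<in> Lp_space p \<mu> \<Longrightarrow> g \<in> Lp_space p \<nu> \<Longrightarrow> Lp_norm p \<mu> f \<le> 1 \<Longrightarrow> Lp_norm p \<nu> g \<le> 1 \<Longrightarrow>
       Lp_norm q lborel (\<lambda>\<xi>. fourier \<mu> f \<xi> * fourier \<nu> g \<xi>) \<le> ennreal C"
    and f: "f \<in> Lp_space p \<mu>" and g: "g \<in> Lp_space p \<nu>"
  shows "Lp_norm q lborel (\<lambda>\<xi>. fourier \<mu> f \<xi> * fourier \<nu> g \<xi>) \<le> ennreal C * Lp_norm p \<mu> f * Lp_norm p \<nu> g"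
proof -
  interpret mu: finite_measure \<mu> by fact
  interpret nu: finite_measure \<nu> by fact
  let ?F = "\<lambda>f g \<xi>. fourier \<mu> f \<xi> * fourier \<nu> g \<xi>"
  have fm: "f \<in> borel_measurable \<mu>" and gm: "g \<in> borel_measurable \<nu>" using f g by (auto simp: Lp_space_def)
  obtain \<alpha> where \<alpha>: "Lp_norm p \<mu> f = ennreal \<alpha>" "0 \<le> \<alpha>"
    using f by (cases "Lp_norm p \<mu> f") (auto simp: Lp_space_def)
  obtain \<beta> where \<beta>: "Lp_norm p \<nu> g = ennreal \<beta>" "0 \<le> \<beta>"
    using g by (cases "Lp_norm p \<nu> g") (auto simp: Lp_space_def)
  have unit_scale: "(\<lambda>x. of_real (1 / (\<gamma> + e)) * h x) \<in> Lp_space p M \<and> Lp_norm p M (\<lambda>x. of_real (1 / (\<gamma> + e)) * h x) \<le> 1"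
    if [measurable]: "h \<in> borel_measurable M" and \<gamma>: "Lp_norm p M h = ennreal \<gamma>" "0 \<le> \<gamma>" and e: "0 < e"
    for h \<gamma> e and M :: "'a measure"
  proof -
    have "Lp_norm p M (\<lambda>x. of_real (1 / (\<gamma> + e)) * h x) \<le> ennreal (1 / (\<gamma> + e)) * ennreal \<gamma>"
      unfolding \<gamma>(1)[symmetric] using \<gamma>(2) e by (intro Lp_norm_scale_le p) auto
    also have "\<dots> = ennreal (\<gamma> / (\<gamma> + e))" using \<gamma>(2) e by (simp flip: ennreal_mult)
    also have "\<dots> \<le> 1" using \<gamma>(2) e by simp
    finally have le: "Lp_norm p M (\<lambda>x. of_real (1 / (\<gamma> + e)) * h x) \<le> 1" .
    have "Lp_norm p M (\<lambda>x. of_real (1 / (\<gamma> + e)) * h x) < \<infinity>"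
      using le_less_trans[OF le] by simp
    with le show ?thesis by (simp add: Lp_space_def)
  qed
  have bound: "Lp_norm q lborel (?F f g) \<le> ennreal (C * (\<alpha> + e) * (\<beta> + e))" if e: "0 < e" for e
  proof -
    let ?f = "\<lambda>x. of_real (1 / (\<alpha> + e)) * f x" and ?g = "\<lambda>x. of_real (1 / (\<beta> + e)) * g x"
    have 1: "Lp_norm q lborel (?F ?f ?g) \<le> ennreal C"
      using unit_scale[OF fm \<alpha> e] unit_scale[OF gm \<beta> e] by (intro unit) auto
    have pos: "0 < (\<alpha> + e) * (\<beta> + e)" using \<alpha> \<beta> e by (intro mult_pos_pos) auto
    have eq: "?F f g = (\<lambda>\<xi>. of_real ((\<alpha> + e) * (\<beta> + e)) * ?F ?f ?g \<xi>)"
    proof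
      fix \<xi>
      have "(\<alpha> + e) * (\<beta> + e) * (1 / (\<alpha> + e) * (1 / (\<beta> + e))) = 1" using \<alpha> \<beta> e by simp
      then have "?F f g \<xi> = of_real ((\<alpha> + e) * (\<beta> + e) * (1 / (\<alpha> + e) * (1 / (\<beta> + e)))) * ?F f g \<xi>" by simp
      also have "\<dots> = of_real ((\<alpha> + e) * (\<beta> + e)) * ?F ?f ?g \<xi>"
        unfolding fourier_eq_ft ft_scale by (simp only: of_real_mult mult_ac)
      finally show "?F f g \<xi> = of_real ((\<alpha> + e) * (\<beta> + e)) * ?F ?f ?g \<xi>" .
    qed
    have "ft \<mu> (\<lambda>x. x) ?f \<in> borel_measurable borel" "ft \<nu> (\<lambda>x. x) ?g \<in> borel_measurable borel"
      using fm gm by (auto intro!: ft_measurable mu.sigma_finite_measure_axioms nu.sigma_finite_measure_axioms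
          measurable_ident_sets sets)
    then have "?F ?f ?g \<in> borel_measurable lborel" unfolding fourier_eq_ft by simp
    then have "Lp_norm q lborel (?F f g) \<le> ennreal ((\<alpha> + e) * (\<beta> + e)) * Lp_norm q lborel (?F ?f ?g)"
      unfolding eq by (intro Lp_norm_scale_le pos q)
    also have "\<dots> \<le> ennreal ((\<alpha> + e) * (\<beta> + e)) * ennreal C" by (intro mult_left_mono 1) simp
    also have "\<dots> = ennreal (C * (\<alpha> + e) * (\<beta> + e))"
      using pos C by (simp add: mult_ac flip: ennreal_mult)
    finally show ?thesis .
  qed
  obtain x where x: "Lp_norm q lborel (?F f g) = ennreal x" "0 \<le> x"
    using bound[of 1] by (cases "Lp_norm q lborel (?F f g)") (auto simp: top_unique)
  have "x \<le> C * (\<alpha> + inverse (real (Suc n))) * (\<beta> + inverse (real (Suc n)))" for n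
  proof -
    have "ennreal x \<le> ennreal (C * (\<alpha> + inverse (real (Suc n))) * (\<beta> + inverse (real (Suc n))))"
      using bound[of "inverse (real (Suc n))"] unfolding x(1) by simp
    moreover have "0 \<le> C * (\<alpha> + inverse (real (Suc n))) * (\<beta> + inverse (real (Suc n)))"
      using C \<alpha> \<beta> by (intro mult_nonneg_nonneg add_nonneg_nonneg) auto
    ultimately show ?thesis by (simp only: ennreal_le_iff)
  qed
  moreover have "(\<lambda>n. C * (\<alpha> + inverse (real (Suc n))) * (\<beta> + inverse (real (Suc n)))) \<longlonglongrightarrow> C * (\<alpha> + 0) * (\<beta> + 0)"
    by (intro tendsto_intros LIMSEQ_inverse_real_of_nat)
  ultimately have "x \<le> C * (\<alpha> + 0) * (\<beta> + 0)" by (intro LIMSEQ_le_const) auto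
  then have "ennreal x \<le> ennreal (C * \<alpha> * \<beta>)" by (simp add: ennreal_leI)
  also have "\<dots> = ennreal C * ennreal \<alpha> * ennreal \<beta>" using C \<alpha> \<beta> by (simp add: ennreal_mult)
  finally show ?thesis unfolding x(1) \<alpha>(1) \<beta>(1) .
qed

text \<open>A finite q forces p' to be finite, which excludes p = 1. The rest translates the
  extended exponents into real numbers.\<close>

lemma conjugate_exponent_bounds:
  fixes p p' q :: ennreal
  assumes p: "1 \<le> p" and pp: "1 / p + 1 / p' = 1" and q: "2 * p' \<le> q" and fin: "q \<noteq> \<infinity>"
  obtains Q where "q = ennreal Q" "2 \<le> Q" "p = \<infinity>"
  | Q P where "q = ennreal Q" "p = ennreal P" "1 < P" "2 * (P / (P - 1)) \<le> Q"
proof -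
  obtain Q where Q: "q = ennreal Q" "0 \<le> Q" using fin by (cases q) auto
  have "p' \<noteq> \<infinity>" using q fin by (auto simp: ennreal_mult_top top_unique)
  then obtain r where r: "p' = ennreal r" "0 \<le> r" by (cases p') auto
  have r0: "0 < r"
  proof (rule ccontr)
    assume "\<not> 0 < r"
    then have "p' = 0" using r by simp
    then show False using pp by simp
  qed
  have inv: "1 / p' = ennreal (1 / r)" unfolding r(1) using r0 divide_ennreal[of 1 r] by simp
  have "ennreal 2 * ennreal r \<le> ennreal Q" using q unfolding Q(1) r(1) by simp
  then have rQ: "2 * r \<le> Q" using Q r by (simp add: ennreal_le_iff del: ennreal_numeral flip: ennreal_mult)
  show thesis
  proof (cases "p = \<infinity>")
    case True
    then have "ennreal (1 / r) = ennreal 1" using pp by (simp add: inv)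
    then have "1 / r = 1" using r0 by (subst (asm) ennreal_inj) auto
    then show thesis using that(1)[OF Q(1)] True rQ r0 by simp
  next
    case False
    then obtain P where P: "p = ennreal P" "1 \<le> P" using p by (cases p) auto
    have "1 / p = ennreal (1 / P)" unfolding P(1) using P(2) divide_ennreal[of 1 P] by simp
    then have "ennreal (1 / P + 1 / r) = ennreal 1"
      using pp inv P r0 by (simp add: ennreal_plus)
    then have e: "1 / P + 1 / r = 1" using P r0 by (subst (asm) ennreal_inj) auto
    have "P \<noteq> 1" using e r0 by auto
    then have P1: "1 < P" using P by simp
    have "r = P / (P - 1)" using e r0 P1 by (simp add: field_simps)
    then show thesis using that(2)[OF Q(1) P(1) P1] rQ by simp
  qed
qed

text \<open>Both dimensions are suprema, so a strict inequality between them is already witnessed by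
  admissible exponents.\<close>

lemma dimension_witnesses:
  fixes \<mu> \<nu> :: "'a::euclidean_space measure"
  assumes gap: "ereal (real DIM('a)) - Ls_dim r \<mu> < fourier_dim \<nu>" and r: "r \<noteq> 1"
  obtains t \<sigma> M where "0 < t" "0 < \<sigma>" "real DIM('a) < \<sigma> + t"
    "(\<integral>\<^sup>+x. epow (\<integral>\<^sup>+y. 1 / epow (ennreal (norm (x - y))) t \<partial>\<mu>) (r - 1) \<partial>\<mu>) < \<infinity>"
    "\<And>\<xi>. (norm (ft \<nu> (\<lambda>x. x) (\<lambda>_. 1) \<xi>))\<^sup>2 * norm \<xi> powr \<sigma> \<le> M"
proof -
  obtain \<sigma> where \<sigma>: "0 \<le> \<sigma>" "\<sigma> \<le> real DIM('a)"
      "bdd_above (range (\<lambda>\<xi>. (norm (fourier \<nu> (\<lambda>_. 1) \<xi>))\<^sup>2 * norm \<xi> powr \<sigma>))"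
    and gap\<sigma>: "ereal (real DIM('a)) - Ls_dim r \<mu> < ereal \<sigma>"
    using gap unfolding fourier_dim_def less_SUP_iff by auto
  have "ereal (real DIM('a) - \<sigma>) < Ls_dim r \<mu>"
    using gap\<sigma> by (cases "Ls_dim r \<mu>") auto
  then obtain t where t: "0 \<le> t" "t \<le> real DIM('a)" "real DIM('a) - \<sigma> < t"
      "(\<integral>\<^sup>+x. epow (\<integral>\<^sup>+y. 1 / epow (ennreal (norm (x - y))) t \<partial>\<mu>) (r - 1) \<partial>\<mu>) < \<infinity>"
    using r unfolding Ls_dim_def by (auto simp: less_SUP_iff)
  obtain M where M: "\<And>\<xi>. (norm (fourier \<nu> (\<lambda>_. 1) \<xi>))\<^sup>2 * norm \<xi> powr \<sigma> \<le> M"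
    using \<sigma>(3) unfolding bdd_above_def by auto
  \<comment> \<open>Positivity comes for free: neither exponent exceeds d, while their sum is larger
    than d.\<close>
  show thesis
    using that[of t \<sigma> M] t \<sigma> M unfolding fourier_eq_ft by auto
qed

lemma unit_ball_bound_infinity:
  fixes \<mu> \<nu> :: "'a::euclidean_space measure"
  assumes sets: "sets \<mu> = sets borel" "sets \<nu> = sets borel" and fin: "finite_measure \<mu>" "finite_measure \<nu>"
    and p: "1 \<le> p" and f: "f \<in> Lp_space p \<mu>" "Lp_norm p \<mu> f \<le> 1" and g: "g \<in> Lp_space p \<nu>" "Lp_norm p \<nu> g \<le> 1"
  shows "Lp_norm \<infinity> lborel (\<lambda>\<xi>. fourier \<mu> f \<xi> * fourier \<nu> g \<xi>)
    \<le> ennreal ((measure \<mu> (space \<mu>) + 1) * (measure \<nu> (space \<nu>) + 1))"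
proof -
  interpret mu: finite_measure \<mu> by fact
  interpret nu: finite_measure \<nu> by fact
  note fi = Lp_norm_le_1_integrable[OF fin(1) f(1) p f(2)] and gi = Lp_norm_le_1_integrable[OF fin(2) g(1) p g(2)]
  have [measurable]: "ft \<mu> (\<lambda>x. x) f \<in> borel_measurable borel" "ft \<nu> (\<lambda>x. x) g \<in> borel_measurable borel"
    using f(1) g(1) by (auto intro!: ft_measurable mu.sigma_finite_measure_axioms nu.sigma_finite_measure_axioms
        measurable_ident_sets sets simp: Lp_space_def)
  have "norm (ft \<mu> (\<lambda>x. x) f \<xi> * ft \<nu> (\<lambda>x. x) g \<xi>) \<le> (measure \<mu> (space \<mu>) + 1) * (measure \<nu> (space \<nu>) + 1)" for \<xi>
    unfolding norm_mult
    by (intro mult_mono order_trans[OF norm_ft_le[OF fi(1)] fi(2)] order_trans[OF norm_ft_le[OF gi(1)] gi(2)])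
       (auto intro: add_nonneg_nonneg)
  then show ?thesis
    unfolding Lp_norm_def fourier_eq_ft by (auto intro!: esssup_I AE_I2 ennreal_leI)
qed

theorem corollary3p5:
  fixes \<mu> \<nu> :: "'a::euclidean_space measure"
    and p p' q :: ennreal
  assumes "sets \<mu> = sets borel" and "sets \<nu> = sets borel"
    and "finite_measure \<mu>" and "finite_measure \<nu>"
    and "emeasure \<mu> UNIV \<noteq> 0" and "emeasure \<nu> UNIV \<noteq> 0"
    and "compact (measure_support \<mu>)" and "compact (measure_support \<nu>)"
    and "1 \<le> p" and "1 / p + 1 / p' = 1" and "2 * p' \<le> q"
    and "ereal (real DIM('a)) - Ls_dim (p0_exponent p q) \<mu> < fourier_dim \<nu>"
  shows "\<exists>C::real. 0 < C \<and>
           (\<forall>f \<in> Lp_space p \<mu>. \<forall>g \<in> Lp_space p \<nu>.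
              Lp_norm q lborel (\<lambda>\<xi>. fourier \<mu> f \<xi> * fourier \<nu> g \<xi>)
                \<le> ennreal C * Lp_norm p \<mu> f * Lp_norm p \<nu> g)"
proof -
  note sets = assms(1,2) and fin = assms(3,4) and p = \<open>1 \<le> p\<close>
  interpret mu: finite_measure \<mu> by fact
  interpret nu: finite_measure \<nu> by fact
  interpret P: pair_sigma_finite \<mu> \<nu> ..
  note [measurable_cong] = sets
  have space: "space \<mu> = UNIV" "space \<nu> = UNIV" using sets[THEN sets_eq_imp_space_eq] by simp_all
  have nz: "emeasure \<mu> (space \<mu>) \<noteq> 0" "emeasure \<nu> (space \<nu>) \<noteq> 0" using assms(5,6) space by simp_all
  let ?P = "\<mu> \<Otimes>\<^sub>M \<nu>"
  have finP: "finite_measure ?P" by (rule finite_measure_pair_measure) fact+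
  have nzP: "emeasure ?P (space ?P) \<noteq> 0"
    unfolding space_pair_measure by (subst nu.emeasure_pair_measure_Times) (auto simp: nz)
  have \<phi>: "(\<lambda>z. fst z + snd z) \<in> ?P \<rightarrow>\<^sub>M borel" by measurable
  let ?s = "smooth ?P (\<lambda>z. fst z + snd z)"
  have q1: "1 \<le> q"
  proof (cases "q = \<infinity>")
    case False
    show ?thesis
    proof (rule conjugate_exponent_bounds[OF p assms(10,11) False])
      fix Q :: real assume "q = ennreal Q" "2 \<le> Q"
      then show ?thesis by (simp add: ennreal_ge_1)
    next
      fix Q P :: real assume *: "q = ennreal Q" "1 < P" "2 * (P / (P - 1)) \<le> Q"
      then have "1 \<le> P / (P - 1)" by simp
      then have "1 \<le> Q" using *(3) by linarith
      then show ?thesis using *(1) by (simp add: ennreal_ge_1)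
    qed
  qed simp
  have "\<exists>C\<ge>0. \<forall>f\<in>Lp_space p \<mu>. \<forall>g\<in>Lp_space p \<nu>. Lp_norm p \<mu> f \<le> 1 \<longrightarrow> Lp_norm p \<nu> g \<le> 1 \<longrightarrow>
       Lp_norm q lborel (\<lambda>\<xi>. fourier \<mu> f \<xi> * fourier \<nu> g \<xi>) \<le> ennreal C"
  proof (cases "q = \<infinity>")
    \<comment> \<open>This contains p = 1, where p' = \<infinity> forces q = \<infinity>.\<close>
    case True
    then show ?thesis
      using unit_ball_bound_infinity[OF sets fin p]
      by (intro exI[of _ "(measure \<mu> (space \<mu>) + 1) * (measure \<nu> (space \<nu>) + 1)"]) (auto intro!: mult_nonneg_nonneg add_nonneg_nonneg)
  next
    case q_fin: False
    define r where "r = p0_exponent p q"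
    obtain Q where Q: "q = ennreal Q" "2 \<le> Q" and r: "1 < r" "r \<le> 2"
      and cases: "(p = \<infinity> \<and> r = Q / (Q - 1)) \<or>
        (\<exists>P. p = ennreal P \<and> 1 < P \<and> r = Q * (P - 1) / (Q * (P - 1) - P) \<and> 0 < Q * (P - 1) - P)"
    proof (rule conjugate_exponent_bounds[OF p assms(10,11) q_fin])
      fix Q assume *: "q = ennreal Q" "2 \<le> Q" "p = \<infinity>"
      then have req: "r = Q / (Q - 1)" by (simp add: r_def p0_exponent_def)
      have "1 < r" unfolding req using *(2) by (subst less_divide_eq) auto
      moreover have "r \<le> 2" unfolding req using *(2) by (subst divide_le_eq) auto
      ultimately show thesis using * req by (intro that[of Q]) auto
    next
      fix Q P assume *: "q = ennreal Q" "p = ennreal P" "1 < P" "2 * (P / (P - 1)) \<le> Q"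
      \<comment> \<open>The hypothesis q \<ge> 2p' cleared of denominators. In this form it is the
        inequality r \<le> 2, and it also makes the denominator of r positive.\<close>
      then have x: "2 * P \<le> Q * (P - 1)" by (simp add: field_simps)
      have "1 \<le> P / (P - 1)" using * by simp
      then have Q2: "2 \<le> Q" using * by linarith
      have req: "r = Q * (P - 1) / (Q * (P - 1) - P)" using * Q2 by (simp add: r_def p0_exponent_def)
      have pos: "0 < Q * (P - 1) - P" using x * by linarith
      have "1 < r" unfolding req using pos * by (subst less_divide_eq) auto
      moreover have "r \<le> 2" unfolding req using pos x by (subst divide_le_eq) auto
      ultimately show thesis using * Q2 req pos by (intro that[of Q]) auto
    qed
    obtain C where C: "\<And>J. (\<integral>\<^sup>+x. ennreal (norm (?s (\<lambda>_. 1) (2 * (1/2) ^ J) x) powr r) \<partial>lborel) \<le> ennreal C"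
    proof -
      have "r \<noteq> 1" using r by simp
      with assms(12)[folded r_def] show thesis
      proof (rule dimension_witnesses)
        fix t \<sigma> M assume *: "0 < t" "0 < \<sigma>" "real DIM('a) < \<sigma> + t"
          "(\<integral>\<^sup>+x. epow (\<integral>\<^sup>+y. 1 / epow (ennreal (norm (x - y))) t \<partial>\<mu>) (r - 1) \<partial>\<mu>) < \<infinity>"
          "\<And>\<xi>. (norm (ft \<nu> (\<lambda>x. x) (\<lambda>_. 1) \<xi>))\<^sup>2 * norm \<xi> powr \<sigma> \<le> M"
        show thesis
          using smooth_pair_Lp_bounded[OF sets fin nz(1) r *] that by blast
      qed
    qed
    have N: "0 < 4 * (1 + \<bar>C\<bar>)" by (simp add: add_pos_nonneg)
    obtain K where K: "\<And>f g. integrable \<mu> f \<Longrightarrow> integrable \<nu> g \<Longrightarrow>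
      (\<And>J. (\<integral>\<^sup>+x. ennreal (norm (?s (\<lambda>z. f (fst z) * g (snd z)) (2 * (1/2) ^ J) x) powr (Q / (Q - 1))) \<partial>lborel) \<le> ennreal (4 * (1 + \<bar>C\<bar>))) \<Longrightarrow>
      (\<integral>\<^sup>+\<xi>. ennreal (norm (ft \<mu> (\<lambda>x. x) f \<xi> * ft \<nu> (\<lambda>x. x) g \<xi>) powr Q) \<partial>lborel) \<le> ennreal K"
      using ft_product_Lq_bound[OF sets fin Q(2) N] by blast
    show ?thesis
    proof (intro exI[of _ "\<bar>K\<bar> powr (1 / Q)"] conjI ballI impI)
      fix f g assume f: "f \<in> Lp_space p \<mu>" "Lp_norm p \<mu> f \<le> 1" and g: "g \<in> Lp_space p \<nu>" "Lp_norm p \<nu> g \<le> 1"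
      have [measurable]: "f \<in> borel_measurable \<mu>" "g \<in> borel_measurable \<nu>"
        using f(1) g(1) by (simp_all add: Lp_space_def)
      note fi = Lp_norm_le_1_integrable(1)[OF fin(1) f(1) p f(2)] and gi = Lp_norm_le_1_integrable(1)[OF fin(2) g(1) p g(2)]
      let ?G = "\<lambda>z. f (fst z) * g (snd z)"
      have Gm: "?G \<in> borel_measurable ?P" by measurable
      have "(\<integral>\<^sup>+x. ennreal (norm (?s ?G (2 * (1/2) ^ J) x) powr (Q / (Q - 1))) \<partial>lborel) \<le> ennreal (4 * (1 + \<bar>C\<bar>))" for J
      proof -
        define a where "a = 2 * (1/2::real) ^ J"
        have a: "0 < a" by (simp add: a_def)
        from cases show ?thesis
        proof (elim disjE exE conjE)
          \<comment> \<open>For p = \<infinity> the exponent r is q / (q - 1) itself, so domination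
            of the weight by 1 is enough and Hoelder is not involved.\<close>
          assume pinf: "p = \<infinity>" and req: "r = Q / (Q - 1)"
          have f1: "AE x in \<mu>. norm (f x) \<le> 1" and g1: "AE x in \<nu>. norm (g x) \<le> 1"
            using f(2) g(2) unfolding pinf by (auto intro: Lp_norm_infinity_le_1)
          have "AE x in \<mu>. AE y in \<nu>. norm (?G (x, y)) \<le> 1"
            using f1
          proof eventually_elim
            case (elim x)
            show ?case using g1 by eventually_elim (use elim in \<open>auto simp: norm_mult intro!: mult_le_one\<close>)
          qed
          then have G1: "AE z in ?P. norm (?G z) \<le> 1"
            by (intro P.AE_pair_measure) auto
          have "norm (?s ?G a x) \<le> norm (?s (\<lambda>_. 1) a x)" for x
          proof -
            have "ennreal (norm (?s ?G a x)) \<le> (\<integral>\<^sup>+z. ennreal (gauss_kernel a (x - (fst z + snd z))) * ennreal (norm (?G z)) \<partial>?P)"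
              by (rule norm_smooth_le[OF a Gm \<phi>])
            also have "\<dots> \<le> (\<integral>\<^sup>+z. ennreal (gauss_kernel a (x - (fst z + snd z))) \<partial>?P)"
            proof (rule nn_integral_mono_AE)
              show "AE z in ?P. ennreal (gauss_kernel a (x - (fst z + snd z))) * ennreal (norm (?G z)) \<le> ennreal (gauss_kernel a (x - (fst z + snd z)))"
                using G1 by eventually_elim (metis ennreal_le_1 mult.right_neutral mult_left_mono zero_le)
            qed
            also have "\<dots> = ennreal (norm (?s (\<lambda>_. 1) a x))"
              unfolding norm_smooth_one[OF a] by (rule nn_integral_gauss_kernel_eq[OF finP a \<phi>])
            finally show ?thesis by (simp add: ennreal_le_iff)
          qed
          then have "(\<integral>\<^sup>+x. ennreal (norm (?s ?G a x) powr (Q / (Q - 1))) \<partial>lborel) \<le> (\<integral>\<^sup>+x. ennreal (norm (?s (\<lambda>_. 1) a x) powr r) \<partial>lborel)"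
            unfolding req using Q by (intro nn_integral_mono ennreal_leI powr_mono2) auto
          also have "\<dots> \<le> ennreal C" using C[of J] by (simp add: a_def)
          also have "\<dots> \<le> ennreal (4 * (1 + \<bar>C\<bar>))" by (intro ennreal_leI) simp
          finally show ?thesis by (simp add: a_def)
        next
          fix P assume P: "p = ennreal P" "1 < P" and req: "r = Q * (P - 1) / (Q * (P - 1) - P)" "0 < Q * (P - 1) - P"
          have fP: "(\<integral>\<^sup>+x. ennreal (norm (f x) powr P) \<partial>\<mu>) \<le> 1" and gP: "(\<integral>\<^sup>+x. ennreal (norm (g x) powr P) \<partial>\<nu>) \<le> 1"
            using f(2) g(2) P(2) unfolding P(1) by (auto intro: Lp_norm_ennreal_le_1)
          \<comment> \<open>The weight is a tensor product, so by Tonelli its P-th power integral is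
            a product and stays at most 1.\<close>
          have "(\<integral>\<^sup>+z. ennreal (norm (?G z) powr P) \<partial>?P) = (\<integral>\<^sup>+x. (\<integral>\<^sup>+y. ennreal (norm (f x) powr P) * ennreal (norm (g y) powr P) \<partial>\<nu>) \<partial>\<mu>)"
            by (subst nu.nn_integral_fst[symmetric]) (simp_all add: norm_mult powr_mult ennreal_mult)
          also have "\<dots> = (\<integral>\<^sup>+x. ennreal (norm (f x) powr P) \<partial>\<mu>) * (\<integral>\<^sup>+y. ennreal (norm (g y) powr P) \<partial>\<nu>)"
            by (simp add: nn_integral_cmult nn_integral_multc)
          also have "\<dots> \<le> 1 * 1" by (intro mult_mono fP gP) auto
          finally have GP: "(\<integral>\<^sup>+z. ennreal (norm (?G z) powr P) \<partial>?P) \<le> 1" by simp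
          have "(\<integral>\<^sup>+x. ennreal (norm (?s (\<lambda>_. 1) a x) powr r) \<partial>lborel) \<le> ennreal C" using C[of J] by (simp add: a_def)
          from smooth_Lp_weight_bound[OF finP nzP \<phi> Gm a P(2) Q(2) req GP this]
          show ?thesis by (simp add: a_def)
        qed
      qed
      then have "(\<integral>\<^sup>+\<xi>. ennreal (norm (ft \<mu> (\<lambda>x. x) f \<xi> * ft \<nu> (\<lambda>x. x) g \<xi>) powr Q) \<partial>lborel) \<le> ennreal K"
        by (rule K[OF fi gi])
      then have "epow (\<integral>\<^sup>+\<xi>. ennreal (norm (ft \<mu> (\<lambda>x. x) f \<xi> * ft \<nu> (\<lambda>x. x) g \<xi>) powr Q) \<partial>lborel) (1 / Q) \<le> ennreal (\<bar>K\<bar> powr (1 / Q))"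
        using Q by (intro epow_le_ennreal) auto
      then show "Lp_norm q lborel (\<lambda>\<xi>. fourier \<mu> f \<xi> * fourier \<nu> g \<xi>) \<le> ennreal (\<bar>K\<bar> powr (1 / Q))"
        using Q by (simp add: Lp_norm_def fourier_eq_ft)
    qed simp
  qed
  then obtain C where C: "0 \<le> C" "\<And>f g. f \<in> Lp_space p \<mu> \<Longrightarrow> g \<in> Lp_space p \<nu> \<Longrightarrow> Lp_norm p \<mu> f \<le> 1 \<Longrightarrow> Lp_norm p \<nu> g \<le> 1 \<Longrightarrow>
       Lp_norm q lborel (\<lambda>\<xi>. fourier \<mu> f \<xi> * fourier \<nu> g \<xi>) \<le> ennreal C" by blast
  show ?thesis
  \<comment> \<open>The constant obtained may be 0, and a positive one is asked for.\<close>
  proof (intro exI[of _ "C + 1"] conjI ballI)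
    show "0 < C + 1" using C by simp
    fix f g assume f: "f \<in> Lp_space p \<mu>" and g: "g \<in> Lp_space p \<nu>"
    have "Lp_norm q lborel (\<lambda>\<xi>. fourier \<mu> f \<xi> * fourier \<nu> g \<xi>) \<le> ennreal C * Lp_norm p \<mu> f * Lp_norm p \<nu> g"
      by (rule Lp_product_bound_from_unit_balls[OF sets fin p q1 C f g])
    also have "\<dots> \<le> ennreal (C + 1) * Lp_norm p \<mu> f * Lp_norm p \<nu> g"
      by (intro mult_right_mono ennreal_leI) auto
    finally show "Lp_norm q lborel (\<lambda>\<xi>. fourier \<mu> f \<xi> * fourier \<nu> g \<xi>) \<le> ennreal (C + 1) * Lp_norm p \<mu> f * Lp_norm p \<nu> g" .
  qed
qed

end
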